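(* The Benjamini--Schramm (local weak) limit of the steady state cluster $\mathcal{C}$ conditioned on $|\mathcal{C}|=k$, as $k\to\infty$, exists and has the law of $\hat{H}^{(0)}$. That is, for every $r\in\mathbb{N}$, the ball of radius $r$ (in graph distance) about the root of $\mathcal{C}$ conditioned on $|\mathcal{C}|=k$ converges in distribution as $k\to\infty$ to the ball of radius $r$ about the root of $\hat{H}^{(0)}$, as rooted trees.
   Context: The steady state cluster $\mathcal{C}$ is the random finite rooted tree whose law is the unique solution of the following recursive distributional equation: $\mathcal{C}$ is a singleton with probability $1/2$, and otherwise is obtained from two independent rooted trees with the law of $\mathcal{C}$ by joining their roots by an edge and then choosing the root uniformly at random among the vertices of the resulting tree. (Its law is invariant under re-rooting at a uniformly random vertex, and $\mathbb{P}(|\mathcal{C}|=k)=\frac2k\binom{2k-2}{k-1}4^{-k}$.) $\hat{H}^{(0)}$ is the following infinite random rooted tree, with vertices carrying ages in $[0,\infty)$ and classified as spinal or non-spinal. The root is spinal and its age has density $\operatorname{sech}^2(\tfrac a2)\tanh(\tfrac a2)\,da$ on $[0,\infty)$. Every vertex of age $b$ (spinal or not) has non-spinal children whose ages form an independent Poisson random measure on $[0,\infty)$ of intensity $\lambda_b(da)=(b\wedge a)\,\tfrac12\operatorname{sech}^2(\tfrac a2)\,da$. In addition, each spinal vertex of age $b$ has exactly one spinal child, independently, whose age has probability density $\frac{(b\wedge a)\operatorname{sech}^2(\frac a2)\tanh(\frac a2)}{2\tanh(\frac b2)}\,da$; non-spinal vertices have no spinal children. *)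

theory Defs
  imports "HOL-Probability.Probability" "HOL-Probability.SPMF" "HOL-Real_Asymp.Real_Asymp"
begin

section \<open>Finite rooted trees\<close>

instance multiset :: (countable) countable
proof
  have "inj (\<lambda>M :: 'a multiset. to_nat (SOME xs. mset xs = M))"
    by (rule injI) (metis (mono_tags, lifting) ex_mset injD inj_to_nat someI_ex)
  then show "\<exists>f :: 'a multiset \<Rightarrow> nat. inj f" by blast
qed

text \<open>Isomorphism classes of finite rooted trees: the children of a vertex carry no order, so two
  finite rooted trees are isomorphic iff they are represented by the same term.\<close>

datatype rtree = Node (subtrees: "rtree multiset")

instance rtree :: countable by countable_datatype

primrec num_vertices :: "rtree \<Rightarrow> nat" where
  "num_vertices (Node M) = Suc (\<Sum>\<^sub># (image_mset num_vertices M))"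

primrec join_roots :: "rtree \<Rightarrow> rtree \<Rightarrow> rtree" where
  "join_roots (Node M) t = Node (add_mset t M)"

lemma image_mset_fundef_cong [fundef_cong]:
  "M = N \<Longrightarrow> (\<And>x. x \<in># N \<Longrightarrow> f x = g x) \<Longrightarrow> image_mset f M = image_mset g N"
  by (auto intro: image_mset_cong)

lemma size_child_less [termination_simp]: "t \<in># M \<Longrightarrow> size t < Suc (size_multiset size M)"
  by (auto dest!: multi_member_split)

text \<open>\<open>rerootings_below U t\<close> describes the tree \<open>t\<close> with the further branches \<open>U\<close> attached to its
  root: it contains, for every vertex \<open>v\<close> of \<open>t\<close>, the result of moving the root to \<open>v\<close>, so that
  isomorphic results are counted with multiplicity. If \<open>v\<close> lies in the branch \<open>c\<close> below the root, then,
  seen from \<open>v\<close>, everything outside \<open>c\<close> is one further branch at the root of \<open>c\<close>.\<close>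

fun rerootings_below :: "rtree multiset \<Rightarrow> rtree \<Rightarrow> rtree multiset" where
  "rerootings_below U (Node M) = add_mset (Node (M + U))
     (\<Sum>\<^sub># (image_mset (\<lambda>c. rerootings_below {#Node (M - {#c#} + U)#} c) M))"

definition rerootings :: "rtree \<Rightarrow> rtree multiset" where
  "rerootings = rerootings_below {#}"

lemma size_Sum_mset: "size (\<Sum>\<^sub># (A :: 'a multiset multiset)) = \<Sum>\<^sub># (image_mset size A)"
  by (induction A) simp_all

lemma size_rerootings_below: "size (rerootings_below U t) = num_vertices t"
proof (induction U t rule: rerootings_below.induct)
  case (1 U M)
  then show ?case
    by (simp add: size_Sum_mset multiset.map_comp comp_def cong: image_mset_cong)
qed

lemma size_rerootings: "size (rerootings t) = num_vertices t"
  by (simp add: rerootings_def size_rerootings_below)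

lemma num_vertices_rerootings_below:
  "s \<in># rerootings_below U t \<Longrightarrow> num_vertices s = num_vertices t + \<Sum>\<^sub># (image_mset num_vertices U)"
proof (induction U t rule: rerootings_below.induct)
  case (1 U M)
  from "1.prems" consider "s = Node (M + U)"
    | c where "c \<in># M" "s \<in># rerootings_below {#Node (M - {#c#} + U)#} c" by auto
  then show ?case
  proof cases
    case 2
    from 1(1)[OF 2] obtain M' where "M = add_mset c M'"
      "num_vertices s = num_vertices c + \<Sum>\<^sub># (image_mset num_vertices {#Node (M - {#c#} + U)#})"
      using 2(1) by (metis mset_add)
    then show ?thesis by simp
  qed simp
qed

text \<open>The graph distance to the root is the depth.\<close>

primrec rtree_ball :: "nat \<Rightarrow> rtree \<Rightarrow> rtree" where
  "rtree_ball 0 = (\<lambda>t. Node {#})"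
| "rtree_ball (Suc r) = (\<lambda>t. Node (image_mset (rtree_ball r) (subtrees t)))"

text \<open>The uniform choice is over vertices, hence weighted by multiplicity.\<close>

definition random_rerooting :: "rtree \<Rightarrow> rtree pmf" where
  "random_rerooting t = pmf_of_multiset (rerootings t)"

section \<open>The steady state cluster\<close>

text \<open>The law of the cluster is a probability mass function on isomorphism classes. The root of
  \<open>join_roots s t\<close> is provisional; only its underlying tree matters after the re-rooting.\<close>

definition steady_state_equation :: "rtree pmf \<Rightarrow> bool" where
  "steady_state_equation C \<longleftrightarrow>
     C = do {
       singleton \<leftarrow> bernoulli_pmf (1/2);
       if singleton then return_pmf (Node {#})
       else do { s \<leftarrow> C; t \<leftarrow> C; random_rerooting (join_roots s t) } }"

context begin

private partial_function (spmf) cluster :: "unit \<Rightarrow> rtree spmf" where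
  "cluster u = bind_pmf (bernoulli_pmf (1/2)) (\<lambda>b. if b then return_spmf (Node {#})
     else bind_spmf (cluster ()) (\<lambda>s. bind_spmf (cluster ())
       (\<lambda>t. spmf_of_pmf (random_rerooting (join_roots s t)))))"

private lemma lossless_cluster: "lossless_spmf (cluster ())"
proof -
  let ?w = "weight_spmf (cluster ())"
  have "?w = weight_spmf (bind_spmf (spmf_of_pmf (bernoulli_pmf (1/2))) (\<lambda>b. if b then return_spmf (Node {#})
      else bind_spmf (cluster ()) (\<lambda>s. bind_spmf (cluster ())
        (\<lambda>t. spmf_of_pmf (random_rerooting (join_roots s t))))))"
    unfolding weight_spmf_def bind_spmf_of_pmf
    by (rule arg_cong[where f="\<lambda>p. measure (measure_spmf p) UNIV"], rule cluster.simps)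
  also have "\<dots> = 1/2 + ?w * ?w / 2"
    by (subst weight_bind_spmf) (simp add: weight_bind_spmf o_def)
  finally have "?w = 1/2 + ?w * ?w / 2" .
  then have "(?w - 1)^2 = 0" by (simp add: power2_eq_square algebra_simps)
  then show ?thesis by (simp add: lossless_spmf_def)
qed

lemma steady_state_equation_ex1: "\<exists>!C. steady_state_equation C"
proof -
  obtain C where C: "cluster () = spmf_of_pmf C"
    using lossless_cluster by (auto simp: lossless_spmf_conv_spmf_of_pmf)
  have lift: "bind_pmf (bernoulli_pmf (1/2)) (\<lambda>b. if b then return_spmf (Node {#})
      else bind_spmf (spmf_of_pmf p) (\<lambda>s. bind_spmf (spmf_of_pmf p)
        (\<lambda>t. spmf_of_pmf (random_rerooting (join_roots s t))))) =
    spmf_of_pmf (do { b \<leftarrow> bernoulli_pmf (1/2);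
       if b then return_pmf (Node {#})
       else do { s \<leftarrow> p; t \<leftarrow> p; random_rerooting (join_roots s t) } })" for p
    by (simp add: spmf_of_pmf_bind if_distrib[of spmf_of_pmf] cong: if_cong)
  have inj: "p = q" if "spmf_of_pmf p = spmf_of_pmf q" for p q :: "rtree pmf"
    using that by (metis pmf_eqI spmf_spmf_of_pmf)
  show ?thesis
  proof
    show "steady_state_equation C" unfolding steady_state_equation_def
      by (rule inj) (simp only: lift[symmetric] C[symmetric], rule cluster.simps)
  next
    fix D assume D: "steady_state_equation D"
    have "ord_spmf (=) (cluster ()) (spmf_of_pmf D)"
    proof (induction rule: cluster.fixp_induct)
      case (3 X)
      have *: "spmf_of_pmf D = bind_pmf (bernoulli_pmf (1/2)) (\<lambda>b. if b then return_spmf (Node {#})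
          else bind_spmf (spmf_of_pmf D) (\<lambda>s. bind_spmf (spmf_of_pmf D)
            (\<lambda>t. spmf_of_pmf (random_rerooting (join_roots s t)))))"
        unfolding lift using D unfolding steady_state_equation_def by (rule arg_cong)
      show ?case
        by (subst *, rule rel_pmf_bindI[where R="(=)"])
          (auto simp: pmf.rel_eq simp del: bind_spmf_of_pmf intro!: bind_spmf_mono' ord_spmf_reflI 3)
    qed auto
    then show "D = C"
      using ord_spmf_eq_pmf_None_eq[of "{}" "spmf_of_pmf C" "spmf_of_pmf D"]
      by (auto simp: C Complete_Partial_Order.chain_def intro: inj[symmetric])
  qed
qed
end

definition steady_state_cluster :: "rtree pmf" where
  "steady_state_cluster = (THE C. steady_state_equation C)"

lemma steady_state_equation_cluster: "steady_state_equation steady_state_cluster"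
  unfolding steady_state_cluster_def by (rule theI'[OF steady_state_equation_ex1])


lemma num_vertices_join_roots: "num_vertices (join_roots s t) = num_vertices s + num_vertices t"
  by (cases s) simp

lemma set_pmf_steady_state_cluster_rerooting:
  assumes "s \<in> set_pmf steady_state_cluster" "t \<in> set_pmf steady_state_cluster"
    and "u \<in># rerootings (join_roots s t)"
  shows "u \<in> set_pmf steady_state_cluster"
proof -
  have "rerootings (join_roots s t) \<noteq> {#}" using assms(3) by auto
  then have u: "u \<in> set_pmf (random_rerooting (join_roots s t))"
    using assms(3) by (simp add: random_rerooting_def)
  show ?thesis
    by (subst steady_state_equation_cluster[unfolded steady_state_equation_def])
      (use u assms(1,2) in \<open>force simp: set_bind_pmf set_pmf_bernoulli\<close>)
qed

text \<open>The events on which the cluster is conditioned have positive probability.\<close>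

lemma steady_state_cluster_size_pos:
  "set_pmf steady_state_cluster \<inter> {t. num_vertices t = Suc k} \<noteq> {}"
proof (induction k)
  case 0
  have "Node {#} \<in> set_pmf steady_state_cluster"
    by (subst steady_state_equation_cluster[unfolded steady_state_equation_def])
      (force simp: set_bind_pmf set_pmf_bernoulli)
  then show ?case by force
next
  case (Suc k)
  have sing: "Node {#} \<in> set_pmf steady_state_cluster"
    by (subst steady_state_equation_cluster[unfolded steady_state_equation_def])
      (force simp: set_bind_pmf set_pmf_bernoulli)
  from Suc obtain s where s: "s \<in> set_pmf steady_state_cluster" "num_vertices s = Suc k" by auto
  let ?j = "join_roots s (Node {#})"
  have "size (rerootings ?j) \<noteq> 0"
    by (simp add: size_rerootings num_vertices_join_roots)
  then obtain u where u: "u \<in># rerootings ?j" by (cases "rerootings ?j") auto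
  then have "num_vertices u = Suc (Suc k)"
    using num_vertices_rerootings_below[of u "{#}" ?j] s(2)
    by (simp add: rerootings_def num_vertices_join_roots)
  with set_pmf_steady_state_cluster_rerooting[OF s(1) sing u] show ?case by auto
qed

section \<open>Poisson random measures of finite intensity\<close>

text \<open>The Poisson random measure with finite intensity \<open>L\<close>, given by its points: \<open>(n, x)\<close> stands for the
  \<open>n\<close> points \<open>x 0, \<dots>, x (n - 1)\<close>, where \<open>n\<close> is Poisson distributed with the total mass of \<open>L\<close> as parameter
  and \<open>x\<close> is an independent i.i.d. sequence with law \<open>L\<close> normalised. The entries \<open>x i\<close> with \<open>i \<ge> n\<close> are
  not points. That this is a Poisson random measure is confirmed by its generating functional, computed in
  \<open>nn_integral_poisson_process\<close> below.\<close>

definition poisson_process :: "real measure \<Rightarrow> (nat \<times> (nat \<Rightarrow> real)) measure" where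
  "poisson_process L = (let m = measure L (space L) in
     measure_pmf (if m = 0 then return_pmf 0 else poisson_pmf m) \<Otimes>\<^sub>M
     (\<Pi>\<^sub>M i\<in>UNIV. if m = 0 then return borel 0 else uniform_measure L (space L)))"

lemma PiM_nn_integral_prod_UNIV:
  fixes D :: "real measure"
  assumes D: "prob_space D" and f: "f \<in> borel_measurable D"
  shows "(\<integral>\<^sup>+x. (\<Prod>i<n. f (x i)) \<partial>(\<Pi>\<^sub>M i\<in>(UNIV::nat set). D)) = (\<integral>\<^sup>+x. f x \<partial>D) ^ n"
proof -
  interpret D: prob_space D by fact
  interpret P: product_prob_space "\<lambda>_. D" "UNIV :: nat set" ..
  have "(\<integral>\<^sup>+x. (\<Prod>i<n. f (x i)) \<partial>(\<Pi>\<^sub>M i\<in>(UNIV::nat set). D)) =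
      (\<integral>\<^sup>+x. (\<Prod>i<n. f (x i)) \<partial>distr (\<Pi>\<^sub>M i\<in>(UNIV::nat set). D) (\<Pi>\<^sub>M i\<in>{..<n}. D) (\<lambda>x. restrict x {..<n}))"
    using f by (subst nn_integral_distr) (auto intro!: measurable_restrict_subset)
  also have "\<dots> = (\<integral>\<^sup>+x. (\<Prod>i<n. f (x i)) \<partial>(\<Pi>\<^sub>M i\<in>{..<n}. D))"
    by (subst P.distr_PiM_restrict_finite) auto
  also have "\<dots> = (\<integral>\<^sup>+x. f x \<partial>D) ^ n"
    using f by (subst P.product_nn_integral_prod) auto
  finally show ?thesis .
qed

lemma nn_integral_iid:
  fixes D :: "real measure" and f :: "real \<Rightarrow> ennreal"
  assumes D: "prob_space D" "sets D = sets borel" and f[measurable]: "f \<in> borel_measurable borel"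
  shows "(\<integral>\<^sup>+(n, x). (\<Prod>i<n. f (x i)) \<partial>(measure_pmf p \<Otimes>\<^sub>M (\<Pi>\<^sub>M i\<in>UNIV. D))) =
    (\<integral>\<^sup>+n. (\<integral>\<^sup>+x. f x \<partial>D) ^ n \<partial>measure_pmf p)"
proof -
  interpret P: prob_space "\<Pi>\<^sub>M i\<in>(UNIV::nat set). D"
    by (intro prob_space_PiM D)
  have s: "sets (measure_pmf p \<Otimes>\<^sub>M (\<Pi>\<^sub>M i\<in>(UNIV::nat set). D)) =
      sets (count_space UNIV \<Otimes>\<^sub>M (\<Pi>\<^sub>M i\<in>(UNIV::nat set). borel))"
    by (intro sets_pair_measure_cong sets_PiM_cong) (auto simp: D)
  have "(\<lambda>(n, x). (\<Prod>i<n. f (x i))) \<in> borel_measurable (count_space UNIV \<Otimes>\<^sub>M (\<Pi>\<^sub>M i\<in>(UNIV::nat set). borel))"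
    by measurable
  then have [measurable]: "(\<lambda>(n, x). (\<Prod>i<n. f (x i))) \<in> borel_measurable (measure_pmf p \<Otimes>\<^sub>M (\<Pi>\<^sub>M i\<in>(UNIV::nat set). D))"
    using measurable_cong_sets[OF s refl] by blast
  have "f \<in> borel_measurable D" using f measurable_cong_sets[OF D(2) refl] by blast
  then show ?thesis
    by (subst P.nn_integral_fst[symmetric]) (simp_all add: PiM_nn_integral_prod_UNIV[OF D(1)])
qed

lemma nn_integral_poisson_process:
  fixes f :: "real \<Rightarrow> real"
  assumes L: "finite_measure L" "sets L = sets borel" and [measurable]: "f \<in> borel_measurable borel"
    and f: "\<And>x. 0 \<le> f x" "\<And>x. f x \<le> 1"
  shows "(\<integral>\<^sup>+(n, x). ennreal (\<Prod>i<n. f (x i)) \<partial>poisson_process L) =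
    ennreal (exp (- (\<integral>x. 1 - f x \<partial>L)))"
proof -
  interpret L: finite_measure L by fact
  define m where "m = measure L (space L)"
  have sp[simp]: "space L = UNIV" using sets_eq_imp_space_eq[OF L(2)] by simp
  note [measurable_cong] = L(2)
  have int: "integrable L f" by (rule L.integrable_const_bound[where B=1]) (use f in auto)
  have I: "(\<integral>x. 1 - f x \<partial>L) = m - (\<integral>x. f x \<partial>L)"
    using int by (simp add: m_def)
  show ?thesis
  proof (cases "m = 0")
    case True
    then have "emeasure L UNIV = 0" by (simp add: m_def L.emeasure_eq_measure)
    then have "AE x in L. False" by (subst AE_iff_null) (auto simp: null_sets_def)
    then have "(\<integral>x. f x \<partial>L) = (\<integral>x. 0 \<partial>L)" by (intro integral_cong_AE) auto
    moreover have "(\<integral>\<^sup>+(n, x). ennreal (\<Prod>i<n. f (x i)) \<partial>poisson_process L) = 1"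
      using True f
      by (simp add: poisson_process_def Let_def m_def prod_ennreal[symmetric])
        (subst nn_integral_iid, auto intro: prob_space_return)
    ultimately show ?thesis using True I by simp
  next
    case False
    then have m: "m > 0" by (simp add: m_def order_less_le)
    let ?D = "uniform_measure L UNIV"
    have em: "emeasure L UNIV = ennreal m" by (simp add: m_def L.emeasure_eq_measure)
    interpret D: prob_space ?D
      using m by (intro prob_space_uniform_measure) (auto simp: em)
    define a where "a = (\<integral>x. f x \<partial>L)"
    have a: "a \<ge> 0" unfolding a_def using f by simp
    have A: "(\<integral>\<^sup>+x. f x \<partial>?D) = ennreal (a / m)"
    proof -
      have "(\<integral>\<^sup>+x. f x \<partial>?D) = (\<integral>\<^sup>+x. f x \<partial>L) / ennreal m"
        by (subst nn_integral_uniform_measure) (auto simp: em)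
      also have "(\<integral>\<^sup>+x. f x \<partial>L) = ennreal a"
        unfolding a_def using int f by (intro nn_integral_eq_integral) auto
      finally show ?thesis using m a by (simp add: divide_ennreal)
    qed
    have "(\<integral>\<^sup>+(n, x). ennreal (\<Prod>i<n. f (x i)) \<partial>poisson_process L) =
      (\<integral>\<^sup>+n. ennreal (a / m) ^ n \<partial>measure_pmf (poisson_pmf m))"
      using False f L(2) D.prob_space_axioms
      unfolding poisson_process_def Let_def m_def[symmetric]
      by (simp add: nn_integral_iid[where f="\<lambda>x. ennreal (f x)"] A prod_ennreal[symmetric])
    also have "\<dots> = (\<integral>\<^sup>+n. ennreal (a ^ n / fact n * exp (- m)) \<partial>count_space UNIV)"
      using m a by (subst nn_integral_measure_pmf)
        (auto simp: ennreal_power ennreal_mult[symmetric] power_divide intro!: nn_integral_cong)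
    also have "\<dots> = ennreal (\<Sum>n. a ^ n / fact n * exp (- m))"
      using a summable_exp[of a]
      by (subst nn_integral_count_space_nat, subst suminf_ennreal2)
        (auto intro!: summable_mult2 simp: divide_inverse mult.commute)
    also have "(\<Sum>n. a ^ n / fact n * exp (- m)) = exp a * exp (-m)"
      using summable_exp[of a] by (subst suminf_mult2[symmetric]) (auto simp: exp_def field_simps)
    also have "\<dots> = exp (- (\<integral>x. 1 - f x \<partial>L))"
      unfolding I a_def by (simp add: exp_add[symmetric])
    finally show ?thesis .
  qed
qed

section \<open>The infinite tree\<close>

definition sech :: "real \<Rightarrow> real" where
  "sech x = 1 / cosh x"

definition offspring_intensity :: "real \<Rightarrow> real measure" where
  "offspring_intensity b =
     density lborel (\<lambda>a. ennreal (indicator {0..} a * (min b a * (1/2) * (sech (a/2))\<^sup>2)))"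

definition root_age_law :: "real measure" where
  "root_age_law =
     density lborel (\<lambda>a. ennreal (indicator {0..} a * ((sech (a/2))\<^sup>2 * tanh (a/2))))"

text \<open>Ages are positive almost surely, so the value for \<open>b \<le> 0\<close>, where the density is not defined,
  is irrelevant.\<close>

definition spinal_age_law :: "real \<Rightarrow> real measure" where
  "spinal_age_law b = (if b \<le> 0 then return borel 0 else
     density lborel (\<lambda>a. ennreal (indicator {0..} a *
       (min b a * (sech (a/2))\<^sup>2 * tanh (a/2) / (2 * tanh (b/2))))))"

lemma sech_0 [simp]: "sech 0 = 1"
  by (simp add: sech_def)

lemma measurable_sech[measurable]: "sech \<in> borel_measurable borel"
  unfolding sech_def by (intro borel_measurable_continuous_onI continuous_intros) auto

lemma measurable_tanh[measurable]: "(tanh :: real \<Rightarrow> real) \<in> borel_measurable borel"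
  by (intro borel_measurable_continuous_onI continuous_intros) auto

lemma tail_deriv: "((\<lambda>a. - (sech (a/2))\<^sup>2) has_real_derivative (sech (a/2))\<^sup>2 * tanh (a/2)) (at a)"
  unfolding sech_def
  by (auto intro!: derivative_eq_intros simp: tanh_def field_simps power2_eq_square)

lemma tail_lim: "((\<lambda>a. - (sech (a/2))\<^sup>2) \<longlongrightarrow> 0) at_top"
  unfolding sech_def cosh_def by simp real_asymp

lemma prob_space_root_age_law: "prob_space root_age_law"
proof
  have "(\<integral>\<^sup>+a. ennreal ((sech (a/2))\<^sup>2 * tanh (a/2)) * indicator {0..} a \<partial>lborel) = ennreal (0 - (- (sech (0/2))\<^sup>2))"
    by (rule nn_integral_FTC_atLeast[where F="\<lambda>a. - (sech (a/2))\<^sup>2"])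
      (auto intro!: tail_deriv tail_lim)
  then show "emeasure root_age_law (space root_age_law) = 1"
    unfolding root_age_law_def
    by (subst emeasure_density) (auto simp: mult.commute sech_0 simp flip: ennreal_indicator ennreal_mult')
qed

lemma prob_space_spinal_age_law: "prob_space (spinal_age_law b)"
proof (cases "b \<le> 0")
  case False
  let ?G = "\<lambda>a. (2 * tanh (a/2) - a * (sech (a/2))\<^sup>2) / (2 * tanh (b/2))"
  let ?H = "\<lambda>a. (2 * tanh (b/2) - b * (sech (a/2))\<^sup>2) / (2 * tanh (b/2))"
  let ?f = "\<lambda>a. min b a * (sech (a/2))\<^sup>2 * tanh (a/2) / (2 * tanh (b/2))"
  have t: "tanh (b/2) > 0" using False by simp
  have dt: "((\<lambda>a. 2 * tanh (a/2)) has_real_derivative (sech (a/2))\<^sup>2) (at a)" for a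
    unfolding sech_def by (auto intro!: derivative_eq_intros simp: tanh_def field_simps power2_eq_square) (use hyperbolic_pythagoras[of "a/2"] in \<open>simp add: power2_eq_square\<close>)
  have dG: "(?G has_real_derivative a * (sech (a/2))\<^sup>2 * tanh (a/2) / (2 * tanh (b/2))) (at a)" for a
  proof -
    have "((\<lambda>a. 2 * tanh (a/2) + a * (- (sech (a/2))\<^sup>2)) has_real_derivative
      (sech (a/2))\<^sup>2 + (1 * (- (sech (a/2))\<^sup>2) + (sech (a/2))\<^sup>2 * tanh (a/2) * a)) (at a)"
      by (intro DERIV_add dt DERIV_mult DERIV_ident tail_deriv)
    from DERIV_cdivide[OF this, of "2 * tanh (b/2)"] show ?thesis by (simp add: mult_ac)
  qed
  have dH: "(?H has_real_derivative b * (sech (a/2))\<^sup>2 * tanh (a/2) / (2 * tanh (b/2))) (at a)" for a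
  proof -
    have "((\<lambda>a. 2 * tanh (b/2) + b * (- (sech (a/2))\<^sup>2)) has_real_derivative
      0 + b * ((sech (a/2))\<^sup>2 * tanh (a/2))) (at a)"
      by (intro DERIV_add DERIV_const DERIV_cmult tail_deriv)
    from DERIV_cdivide[OF this, of "2 * tanh (b/2)"] show ?thesis by (simp add: mult_ac)
  qed
  have limH: "(?H \<longlongrightarrow> 1) at_top"
  proof -
    have "((\<lambda>a. (2 * tanh (b/2) + b * (- (sech (a/2))\<^sup>2)) / (2 * tanh (b/2))) \<longlongrightarrow> 
       (2 * tanh (b/2) + b * 0) / (2 * tanh (b/2))) at_top"
      using t by (intro tendsto_intros tail_lim) auto
    then show ?thesis using t by simp
  qed
  let ?K = "\<lambda>a. if a \<le> b then ?G a else ?H a"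
  have "(\<integral>\<^sup>+a. ennreal (?f a) * indicator {0..} a \<partial>lborel) = ennreal (1 - ?K 0)"
  proof (rule nn_integral_FTC_atLeast)
    show "(?K \<longlongrightarrow> 1) at_top"
      by (rule Lim_transform_eventually[OF limH]) (use eventually_gt_at_top[of b] in eventually_elim, auto)
  next
    fix a :: real assume "0 \<le> a"
    show "(?K has_real_derivative ?f a) (at a)"
    proof (cases a b rule: linorder_cases)
      case less
      have "\<forall>\<^sub>F x in nhds a. ?K x = ?G x"
        using eventually_nhds_in_open[of "{..<b}" a] less by (auto elim!: eventually_mono)
      with dG[of a] less show ?thesis by (subst DERIV_cong_ev[OF refl _ refl]) auto
    next
      case greater
      have "\<forall>\<^sub>F x in nhds a. ?K x = ?H x"
        using eventually_nhds_in_open[of "{b<..}" a] greater by (auto elim!: eventually_mono)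
      with dH[of a] greater show ?thesis by (subst DERIV_cong_ev[OF refl _ refl]) auto
    next
      case equal
      have "((\<lambda>y. (?K y - ?K a) / (y - a)) \<longlongrightarrow> ?f a) (at_left a)"
      proof (rule Lim_transform_eventually)
        show "((\<lambda>y. (?G y - ?G a) / (y - a)) \<longlongrightarrow> ?f a) (at_left a)"
          using has_field_derivative_at_within[OF dG[of a], of "{..<a}"] equal
          by (simp add: has_field_derivative_iff)
        show "\<forall>\<^sub>F y in at_left a. (?G y - ?G a) / (y - a) = (?K y - ?K a) / (y - a)"
          using equal by (auto simp: eventually_at_filter)
      qed
      moreover have "((\<lambda>y. (?K y - ?K a) / (y - a)) \<longlongrightarrow> ?f a) (at_right a)"
      proof (rule Lim_transform_eventually)
        show "((\<lambda>y. (?H y - ?H a) / (y - a)) \<longlongrightarrow> ?f a) (at_right a)"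
          using has_field_derivative_at_within[OF dH[of a], of "{a<..}"] equal
          by (simp add: has_field_derivative_iff)
        show "\<forall>\<^sub>F y in at_right a. (?H y - ?H a) / (y - a) = (?K y - ?K a) / (y - a)"
          using equal by (auto simp: eventually_at_filter)
      qed
      ultimately show ?thesis
        unfolding has_field_derivative_iff by (rule filterlim_split_at)
    qed
    show "0 \<le> ?f a" using t False \<open>0 \<le> a\<close> by auto
  qed simp
  also have "\<dots> = 1" using False by simp
  finally show ?thesis using False
    by (intro prob_spaceI) (simp add: spinal_age_law_def emeasure_density mult.commute flip: ennreal_indicator ennreal_mult')
qed (auto simp: spinal_age_law_def intro!: prob_space_return)


lemma finite_offspring_intensity: "finite_measure (offspring_intensity b)"
proof
  have dt: "((\<lambda>a. b * tanh (a/2)) has_real_derivative b * (1/2) * (sech (a/2))\<^sup>2) (at a)" for a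
    unfolding sech_def by (auto intro!: derivative_eq_intros simp: tanh_def field_simps power2_eq_square)
      (use hyperbolic_pythagoras[of "a/2"] in \<open>simp add: power2_eq_square algebra_simps\<close>)
  show "emeasure (offspring_intensity b) (space (offspring_intensity b)) \<noteq> \<infinity>"
  proof (cases "b \<le> 0")
    case True
    then have "min b a * (1/2) * (sech (a/2))\<^sup>2 \<le> 0" for a
      by (intro mult_nonpos_nonneg) auto
    then have "indicator {0..} a * (min b a * (1/2) * (sech (a/2))\<^sup>2) \<le> 0" for a :: real
      by (auto simp: indicator_def)
    then have "ennreal (indicator {0..} a * (min b a * (1/2) * (sech (a/2))\<^sup>2)) = 0" for a :: real
      by (rule ennreal_neg)
    then show ?thesis
      by (simp add: offspring_intensity_def emeasure_density)
  next
    case False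
    have "emeasure (offspring_intensity b) (space (offspring_intensity b)) \<le>
        (\<integral>\<^sup>+a. ennreal (b * (1/2) * (sech (a/2))\<^sup>2) * indicator {0..} a \<partial>lborel)"
      unfolding offspring_intensity_def using False
      by (subst emeasure_density)
        (auto intro!: nn_integral_mono ennreal_leI mult_right_mono split: split_indicator)
    also have "\<dots> = ennreal (b - b * tanh (0/2))"
    proof (rule nn_integral_FTC_atLeast[OF _ dt])
      have "((\<lambda>a::real. tanh (a/2)) \<longlongrightarrow> 1) at_top"
        unfolding tanh_altdef by real_asymp
      from tendsto_mult_left[OF this, of b] show "((\<lambda>a. b * tanh (a/2)) \<longlongrightarrow> b) at_top" by simp
    qed (use False in auto)
    finally show ?thesis by (auto simp: top_unique)
  qed
qed

lemma measurable_PiM_kernel: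
  fixes K :: "'a \<Rightarrow> 'b measure"
  assumes K[measurable]: "K \<in> M \<rightarrow>\<^sub>M prob_algebra N"
  shows "(\<lambda>x. \<Pi>\<^sub>M i\<in>I. K x) \<in> M \<rightarrow>\<^sub>M prob_algebra (\<Pi>\<^sub>M i\<in>I. N)"
proof (rule measurable_prob_algebra_generated[OF sets_PiM Int_stable_prod_algebra prod_algebra_sets_into_space])
  fix a assume a: "a \<in> space M"
  have pK: "prob_space (K a)" and sK[measurable_cong]: "sets (K a) = sets N"
    using measurable_space[OF K a] by (auto simp: space_prob_algebra)
  show "prob_space (\<Pi>\<^sub>M i\<in>I. K a)" by (intro prob_space_PiM pK)
  show "sets (\<Pi>\<^sub>M i\<in>I. K a) = sets (\<Pi>\<^sub>M i\<in>I. N)" by (intro sets_PiM_cong refl sK)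
next
  fix A assume "A \<in> prod_algebra I (\<lambda>_. N)"
  then obtain J E where A: "A = prod_emb I (\<lambda>_. N) J (Pi\<^sub>E J E)" and J: "finite J" "J \<subseteq> I"
    and E[measurable]: "\<And>i. i \<in> J \<Longrightarrow> E i \<in> sets N"
    by (auto elim!: prod_algebraE)
  have "emeasure (\<Pi>\<^sub>M i\<in>I. K a) A = (\<Prod>i\<in>J. emeasure (K a) (E i))" if a: "a \<in> space M" for a
  proof -
    have pK: "prob_space (K a)" and sK: "sets (K a) = sets N"
      using measurable_space[OF K a] by (auto simp: space_prob_algebra)
    have "A = prod_emb I (\<lambda>_. K a) J (Pi\<^sub>E J E)"
      unfolding A using sets_eq_imp_space_eq[OF sK] by (simp add: prod_emb_def)
    then show ?thesis
      using J E by (simp add: emeasure_PiM_emb pK sK)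
  qed
  moreover have "(\<lambda>a. \<Prod>i\<in>J. emeasure (K a) (E i)) \<in> borel_measurable M"
    using measurable_prob_algebraD[OF K] E
    by (intro borel_measurable_prod_ennreal measurable_emeasure_kernel)
  ultimately show "(\<lambda>a. emeasure (\<Pi>\<^sub>M i\<in>I. K a) A) \<in> borel_measurable M"
    by (subst measurable_cong) auto
qed

lemma measurable_density_kernel:
  fixes f :: "real \<Rightarrow> real \<Rightarrow> ennreal"
  assumes f[measurable]: "(\<lambda>(b, a). f b a) \<in> borel_measurable (borel \<Otimes>\<^sub>M borel)"
    and A[measurable]: "A \<in> sets borel"
  shows "(\<lambda>b. emeasure (density lborel (f b)) A) \<in> borel_measurable borel"
proof -
  have "(\<lambda>b. \<integral>\<^sup>+a. f b a * indicator A a \<partial>lborel) \<in> borel_measurable borel"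
    by measurable
  then show ?thesis
    by (subst emeasure_density) auto
qed

lemma emeasure_offspring_intensity_measurable:
  assumes [measurable]: "A \<in> sets borel"
  shows "(\<lambda>b. emeasure (offspring_intensity b) A) \<in> borel_measurable borel"
  unfolding offspring_intensity_def by (rule measurable_density_kernel) measurable

lemma sets_offspring_intensity [simp]: "sets (offspring_intensity b) = sets borel"
  and space_offspring_intensity [simp]: "space (offspring_intensity b) = UNIV"
  by (simp_all add: offspring_intensity_def)

lemma measurable_measure_offspring_intensity [measurable]:
  "(\<lambda>b. measure (offspring_intensity b) UNIV) \<in> borel_measurable borel"
  unfolding measure_def by (intro measurable_compose[OF emeasure_offspring_intensity_measurable]) auto

lemma measurable_poisson_kernel:
  fixes m :: "real \<Rightarrow> real"
  assumes [measurable]: "m \<in> borel_measurable borel" and m: "\<And>b. 0 \<le> m b"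
  shows "(\<lambda>b. measure_pmf (if m b = 0 then return_pmf 0 else poisson_pmf (m b)))
    \<in> borel \<rightarrow>\<^sub>M prob_algebra (count_space UNIV)" (is "(\<lambda>b. measure_pmf (?p b)) \<in> _")
proof (rule measurable_prob_algebraI[OF _ measurable_subprob_algebra])
  fix A :: "nat set"
  have [measurable]: "(\<lambda>b. pmf (?p b) n) \<in> borel_measurable borel" for n
  proof -
    have eq: "pmf (?p b) n = (if m b = 0 then indicator {0} n else m b ^ n / fact n * exp (- m b))" for b
    proof (cases "m b = 0")
      case False
      then have "m b > 0" using m[of b] by linarith
      then show ?thesis using False by (simp only: pmf_poisson if_False)
    qed (auto split: split_indicator)
    show ?thesis unfolding eq by measurable
  qed
  have "(\<lambda>b. \<Sum>n. ennreal (pmf (?p b) n) * indicator A n) \<in> borel_measurable borel"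
    by measurable
  moreover have "emeasure (measure_pmf (?p b)) A = (\<Sum>n. ennreal (pmf (?p b) n) * indicator A n)" for b
  proof -
    have "emeasure (measure_pmf (?p b)) A = (\<integral>\<^sup>+n. indicator A n \<partial>measure_pmf (?p b))" by simp
    also have "\<dots> = (\<integral>\<^sup>+n. ennreal (pmf (?p b) n) * indicator A n \<partial>count_space UNIV)"
      by (rule nn_integral_measure_pmf)
    also have "\<dots> = (\<Sum>n. ennreal (pmf (?p b) n) * indicator A n)"
      by (rule nn_integral_count_space_nat)
    finally show ?thesis .
  qed
  ultimately show "(\<lambda>b. emeasure (measure_pmf (?p b)) A) \<in> borel_measurable borel"
    by (simp only:)
qed (auto intro: measure_pmf.prob_space_axioms prob_space_imp_subprob_space)

lemma measurable_normalised_offspring_intensity: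
  "(\<lambda>b. if measure (offspring_intensity b) UNIV = 0 then return borel 0
     else uniform_measure (offspring_intensity b) UNIV) \<in> borel \<rightarrow>\<^sub>M prob_algebra borel"
  (is "?D \<in> _")
proof -
  have p: "prob_space (?D b)" for b
  proof -
    interpret finite_measure "offspring_intensity b" by (rule finite_offspring_intensity)
    show ?thesis
      by (auto intro!: prob_space_return prob_space_uniform_measure simp: emeasure_eq_measure)
  qed
  show ?thesis
  proof (rule measurable_prob_algebraI[OF p measurable_subprob_algebra])
    fix A :: "real set" assume A[measurable]: "A \<in> sets borel"
    have eq: "emeasure (?D b) A = (if measure (offspring_intensity b) UNIV = 0 then indicator A 0
        else emeasure (offspring_intensity b) A / emeasure (offspring_intensity b) UNIV)" for b
      using A by simp
    note [measurable] = emeasure_offspring_intensity_measurable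
    show "(\<lambda>b. emeasure (?D b) A) \<in> borel_measurable borel"
      unfolding eq by measurable
  next
    show "subprob_space (?D b)" for b by (rule prob_space_imp_subprob_space[OF p])
  qed simp
qed

lemma measurable_poisson_process_offspring:
  "(\<lambda>b. poisson_process (offspring_intensity b)) \<in>
     borel \<rightarrow>\<^sub>M prob_algebra (count_space UNIV \<Otimes>\<^sub>M (\<Pi>\<^sub>M i\<in>UNIV. borel))"
  unfolding poisson_process_def Let_def space_offspring_intensity
  by (intro measurable_pair_prob measurable_poisson_kernel measurable_PiM_kernel
      measurable_normalised_offspring_intensity measurable_measure_offspring_intensity measure_nonneg)

lemma measurable_spinal_age_law: "spinal_age_law \<in> borel \<rightarrow>\<^sub>M prob_algebra borel"
proof (rule measurable_prob_algebraI[OF prob_space_spinal_age_law measurable_subprob_algebra])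
  fix A :: "real set" assume A[measurable]: "A \<in> sets borel"
  let ?d = "\<lambda>b. density lborel (\<lambda>a. ennreal (indicator {0..} a *
       (min b a * (sech (a/2))\<^sup>2 * tanh (a/2) / (2 * tanh (b/2)))))"
  have [measurable]: "(\<lambda>b. emeasure (?d b) A) \<in> borel_measurable borel"
    by (rule measurable_density_kernel) measurable
  have "(\<lambda>b. emeasure (spinal_age_law b) A) = (\<lambda>b. if b \<le> 0 then indicator A 0 else emeasure (?d b) A)"
    using A by (auto simp: fun_eq_iff spinal_age_law_def)
  moreover have "(\<lambda>b. if b \<le> 0 then indicator A 0 else emeasure (?d b) A) \<in> borel_measurable borel"
    by measurable
  ultimately show "(\<lambda>b. emeasure (spinal_age_law b) A) \<in> borel_measurable borel" by simp
next
  show "subprob_space (spinal_age_law b)" for b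
    by (rule prob_space_imp_subprob_space[OF prob_space_spinal_age_law])
qed (simp add: spinal_age_law_def)


text \<open>Vertices are labelled by natural numbers: the root is \<open>0\<close>, and every label \<open>v\<close> has the potential
  children \<open>child v 0, child v 1, \<dots>\<close>; every positive label arises in this way exactly once, and a child
  has a larger label than its parent. The label \<open>child v 0\<close> is reserved for a spinal child, and
  \<open>child v (Suc i)\<close> for the non-spinal child given by the \<open>i\<close>-th point of the Poisson random measure
  at \<open>v\<close>. A configuration assigns to every label, whether or not it belongs to the tree, its age
  and the point configuration of the ages of its non-spinal children; the labels which do belong to the tree
  are selected in \<open>tree_at\<close> below.\<close>

definition vertex_space :: "(real \<times> nat \<times> (nat \<Rightarrow> real)) measure" where
  "vertex_space = borel \<Otimes>\<^sub>M (count_space UNIV \<Otimes>\<^sub>M (\<Pi>\<^sub>M i\<in>UNIV. borel))"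

type_synonym configuration = "nat \<Rightarrow> real \<times> nat \<times> (nat \<Rightarrow> real)"

definition vertex_age :: "configuration \<Rightarrow> nat \<Rightarrow> real" where
  "vertex_age \<omega> v = fst (\<omega> v)"

definition num_nonspinal :: "configuration \<Rightarrow> nat \<Rightarrow> nat" where
  "num_nonspinal \<omega> v = fst (snd (\<omega> v))"

definition nonspinal_age :: "configuration \<Rightarrow> nat \<Rightarrow> nat \<Rightarrow> real" where
  "nonspinal_age \<omega> v i = snd (snd (\<omega> v)) i"

definition child :: "nat \<Rightarrow> nat \<Rightarrow> nat" where
  "child v i = Suc (prod_encode (v, i))"

text \<open>The conditional law of the data at label \<open>n\<close>, given those at the smaller labels, one of which is
  the parent of \<open>n\<close>.\<close>

fun age_law :: "nat \<Rightarrow> configuration \<Rightarrow> real measure" where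
  "age_law 0 \<omega> = root_age_law"
| "age_law (Suc n) \<omega> = (case prod_decode n of
     (v, 0) \<Rightarrow> spinal_age_law (vertex_age \<omega> v)
   | (v, Suc i) \<Rightarrow> return borel (nonspinal_age \<omega> v i))"

lemma age_law_child:
  "age_law (child v 0) \<omega> = spinal_age_law (vertex_age \<omega> v)"
  "age_law (child v (Suc i)) \<omega> = return borel (nonspinal_age \<omega> v i)"
  by (simp_all add: child_def)

definition vertex_law :: "nat \<Rightarrow> configuration \<Rightarrow> (real \<times> nat \<times> (nat \<Rightarrow> real)) measure" where
  "vertex_law n \<omega> = do {
     b \<leftarrow> age_law n \<omega>;
     c \<leftarrow> poisson_process (offspring_intensity b);
     return vertex_space (b, c) }"

lemma measurable_age_law: "age_law n \<in> (\<Pi>\<^sub>M i\<in>{0..<n}. vertex_space) \<rightarrow>\<^sub>M prob_algebra borel"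
proof (cases n)
  case 0
  have "root_age_law \<in> space (prob_algebra borel)"
    by (simp add: space_prob_algebra prob_space_root_age_law) (simp add: root_age_law_def)
  then show ?thesis by (simp add: 0 age_law.simps[abs_def])
next
  case (Suc m)
  obtain v i where vi: "prod_decode m = (v, i)" by fastforce
  then have "v < n" using le_prod_encode_1[of v i] by (metis Suc le_imp_less_Suc prod_decode_inverse)
  then have v: "(\<lambda>\<omega>. \<omega> v) \<in> (\<Pi>\<^sub>M i\<in>{0..<n}. vertex_space) \<rightarrow>\<^sub>M borel \<Otimes>\<^sub>M (count_space UNIV \<Otimes>\<^sub>M (\<Pi>\<^sub>M i\<in>UNIV. borel))"
    using measurable_component_singleton[of v "{0..<n}" "\<lambda>_. vertex_space"] by (simp add: vertex_space_def)
  show ?thesis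
  proof (cases i)
    case 0
    have "(\<lambda>\<omega>. spinal_age_law (fst (\<omega> v))) \<in> (\<Pi>\<^sub>M i\<in>{0..<n}. vertex_space) \<rightarrow>\<^sub>M prob_algebra borel"
      by (intro measurable_compose[OF _ measurable_spinal_age_law] measurable_compose[OF v measurable_fst])
    then show ?thesis by (simp add: Suc vi 0 vertex_age_def cong: measurable_cong)
  next
    case (Suc j)
    have "(\<lambda>\<omega>. snd (snd (\<omega> v)) j) \<in> (\<Pi>\<^sub>M i\<in>{0..<n}. vertex_space) \<rightarrow>\<^sub>M borel"
      by (rule measurable_compose[OF v]) measurable
    then have "(\<lambda>\<omega>. return borel (snd (snd (\<omega> v)) j)) \<in> (\<Pi>\<^sub>M i\<in>{0..<n}. vertex_space) \<rightarrow>\<^sub>M prob_algebra borel"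
      by (rule measurable_compose[OF _ measurable_return_prob_space])
    then show ?thesis by (simp add: \<open>n = Suc m\<close> vi Suc nonspinal_age_def cong: measurable_cong)
  qed
qed

lemma measurable_vertex_law:
  "vertex_law n \<in> (\<Pi>\<^sub>M i\<in>{0..<n}. vertex_space) \<rightarrow>\<^sub>M prob_algebra vertex_space"
proof -
  let ?C = "count_space (UNIV::nat set) \<Otimes>\<^sub>M (\<Pi>\<^sub>M i\<in>(UNIV::nat set). (borel :: real measure))"
  have "(\<lambda>b. poisson_process (offspring_intensity b) \<bind> (\<lambda>c. return vertex_space (b, c))) \<in> borel \<rightarrow>\<^sub>M prob_algebra vertex_space"
    unfolding vertex_space_def
    by (rule measurable_bind_prob_space2[OF measurable_poisson_process_offspring]) measurable
  from measurable_bind_prob_space[OF measurable_age_law this, of n]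
  show ?thesis unfolding vertex_law_def .
qed

lemma prob_space_vertex_law:
  "x \<in> space (\<Pi>\<^sub>M i\<in>{0..<n}. vertex_space) \<Longrightarrow> prob_space (vertex_law n x)"
  using measurable_space[OF measurable_vertex_law, of x n] by (simp add: space_prob_algebra)

interpretation hat_H: Ionescu_Tulcea vertex_law "\<lambda>_. vertex_space"
  by (rule Ionescu_Tulcea.intro measurable_prob_algebraD measurable_vertex_law prob_space_vertex_law | assumption)+

text \<open>The unique law of a random configuration with these successive conditional laws.\<close>

definition configuration_law :: "configuration measure" where
  "configuration_law = hat_H.PF.lim"

lemma sets_configuration_law [measurable_cong]:
  "sets configuration_law = sets (\<Pi>\<^sub>M i\<in>UNIV. vertex_space)"
  by (simp add: configuration_law_def hat_H.PF.sets_lim)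

text \<open>Possibly infinite, locally finite rooted trees up to isomorphism, with an age and a
  spinal/non-spinal mark at every vertex.\<close>

codatatype aged_tree = Vertex (age: real) (spinal: bool) (children: "aged_tree multiset")

primcorec tree_at :: "configuration \<Rightarrow> bool \<Rightarrow> nat \<Rightarrow> aged_tree" where
  "tree_at \<omega> s v = Vertex (vertex_age \<omega> v) s
     (image_mset (\<lambda>(s', w). tree_at \<omega> s' w)
       ((if s then {#(True, child v 0)#} else {#}) +
        mset (map (\<lambda>i. (False, child v (Suc i))) [0..<num_nonspinal \<omega> v])))"

text \<open>Under \<open>configuration_law\<close>, this is the random tree \<open>H\<close>-hat with superscript \<open>(0)\<close>.\<close>

definition hat_H_tree :: "configuration \<Rightarrow> aged_tree" where
  "hat_H_tree \<omega> = tree_at \<omega> True 0"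

text \<open>The ball about the root as a rooted tree: ages and marks are forgotten.\<close>

primrec aged_ball :: "nat \<Rightarrow> aged_tree \<Rightarrow> rtree" where
  "aged_ball 0 = (\<lambda>t. Node {#})"
| "aged_ball (Suc r) = (\<lambda>t. Node (image_mset (aged_ball r) (children t)))"

lemma measurable_aged_ball_tree_at:
  "(\<lambda>\<omega>. aged_ball r (tree_at \<omega> s v)) \<in> (\<Pi>\<^sub>M i\<in>UNIV. vertex_space) \<rightarrow>\<^sub>M count_space UNIV"
proof (induction r arbitrary: s v)
  case (Suc r)
  let ?M = "\<Pi>\<^sub>M i\<in>(UNIV::nat set). vertex_space"
  note [measurable] = Suc.IH
  have n[measurable]: "(\<lambda>\<omega>. num_nonspinal \<omega> v) \<in> ?M \<rightarrow>\<^sub>M count_space UNIV"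
    unfolding num_nonspinal_def vertex_space_def by measurable
  define X where "X n \<omega> = (if s then {#aged_ball r (tree_at \<omega> True (child v 0))#} else {#}) +
    mset (map (\<lambda>i. aged_ball r (tree_at \<omega> False (child v (Suc i)))) [0..<n])" for n \<omega>
  have X: "X n \<in> ?M \<rightarrow>\<^sub>M count_space UNIV" for n
  proof (induction n)
    case 0
    show ?case unfolding X_def by (cases s) auto
  next
    case (Suc n)
    note [measurable] = Suc.IH
    have "X (Suc n) = (\<lambda>\<omega>. add_mset (aged_ball r (tree_at \<omega> False (child v (Suc n)))) (X n \<omega>))"
      by (auto simp: X_def)
    then show ?case by simp
  qed
  have "(\<lambda>\<omega>. Node (X (num_nonspinal \<omega> v) \<omega>)) \<in> ?M \<rightarrow>\<^sub>M count_space UNIV"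
    using measurable_compose_countable[OF X n] by measurable
  moreover have "aged_ball (Suc r) (tree_at \<omega> s v) = Node (X (num_nonspinal \<omega> v) \<omega>)" for \<omega>
    by (simp add: X_def multiset.map_comp comp_def)
  ultimately show ?case by (simp only:)
qed simp

lemma measurable_aged_ball [measurable]:
  "(\<lambda>\<omega>. aged_ball r (hat_H_tree \<omega>)) \<in> configuration_law \<rightarrow>\<^sub>M count_space UNIV"
  unfolding hat_H_tree_def using measurable_aged_ball_tree_at by measurable


section \<open>Convergence in distribution\<close>

text \<open>Convergence in distribution on a countable discrete space, where every function is continuous.\<close>

definition converges_in_distribution :: "(nat \<Rightarrow> 'a measure) \<Rightarrow> 'a measure \<Rightarrow> bool" where
  "converges_in_distribution M L \<longleftrightarrow>
     (\<forall>f :: 'a \<Rightarrow> real. bounded (range f) \<longrightarrow>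
        (\<lambda>k. integral\<^sup>L (M k) f) \<longlonglongrightarrow> integral\<^sup>L L f)"

end

theory Submission
  imports Defs "HOL-Combinatorics.Multiset_Permutations"
begin

text \<open>The idea is that ages turn both sides into explicit computations with the same family of weights.

  Let \<open>exp_age\<close> be the measure of density \<open>exp (- a) / 2\<close> on \<open>[0, \<infinity>)\<close>. Give a finite tree the weight
  obtained by putting an age on every vertex, taking the product of \<open>min a b\<close> over the edges with end
  points of ages \<open>a\<close>, \<open>b\<close>, and integrating over all ages against \<open>exp_age\<close> (isomorphic labellings being
  counted once). Up to a factor which depends on the age of the root only, this is the law of the branching
  tree formed by the non-spinal vertices. The first main step is \<open>pmf_steady_state_cluster\<close>: the
  total weight of a tree is its probability under the steady state law. Shift all ages
  simultaneously: on the factors \<open>exp (- a)\<close> this acts as multiplication by the number of vertices, and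
  on a factor \<open>min a b\<close> by replacing it with \<open>1\<close>, that is, by deleting an edge;
  this gives, for the weights, a splitting identity (\<open>total_weight_size\<close>), which is
  the steady state equation except that the two trees are joined at
  an arbitrary vertex of the one containing the root instead of at its root. Reversibility, that is, the symmetry of
  \<open>min\<close>, removes this difference (\<open>integral_graft_rate\<close>).

  Next, the size. Let \<open>p\<close> be the size distribution of the cluster and \<open>F\<close> its generating function, so that
  \<open>F\<^sup>2 = 2 F - z\<close>. If \<open>y = (1 - exp (- b)) / 2\<close>, then the trees with root age \<open>b\<close> have
  the generating function \<open>z / (1 - y F)\<^sup>2\<close> (\<open>size_weight_eq_profile\<close>). As \<open>p\<close> is
  subexponential, the \<open>k\<close>-th coefficient is asymptotic to an explicit multiple of \<open>p k\<close>
  (\<open>size_asymp_size_weight\<close>), and after normalisation that multiple is \<open>2 tanh (b / 2)\<close>, which is the density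
  between the root age of the non-spinal tree and that of the infinite tree.

  Prescribing the ball of radius \<open>r + 1\<close> about the root prescribes the multiset of the balls of
  radius \<open>r\<close> about its children, so that the weight of the event, as a function of the size, is a convolution
  product over the children. In a convolution of sequences asymptotic to multiples of \<open>p\<close>, exactly one factor is large
  (\<open>size_asymp_convolution\<close>). Hence exactly one child carries almost all of the mass: it is the
  spinal child. By induction on \<open>r\<close> and dominated convergence over the ages, the
  conditional probability of a given ball converges to the integral of \<open>ball_spine\<close>, which satisfies the
  derivation rule for this product (\<open>conditioned_ball_limit\<close>).

  Finally, \<open>ball_spine\<close> is identified with the infinite tree. The branching property of the random
  configuration (\<open>configuration_law_branching_step\<close>) gives a recursion for the law of its
  balls, and the Poisson law of the offspring makes it the recursion of \<open>ball_total\<close> and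
  \<open>ball_spine\<close> (\<open>age_op_nonspinal_kernel\<close>, \<open>ball_spine_eq\<close>); the density of the age of a spinal child
  is the one for which \<open>tanh (b / 2)\<close> is harmonic. The limits are therefore the point masses of a probability
  measure, and on a countable discrete space this is convergence in distribution.\<close>

section \<open>Weights of multisets\<close>

text \<open>For \<open>v\<close> nonnegative and summable, \<open>exp (- \<Sum>v)\<close> times this is the law of a multiset with
  independent Poisson multiplicities of means \<open>v\<close>.\<close>

definition multiset_weight :: "('a \<Rightarrow> real) \<Rightarrow> 'a multiset \<Rightarrow> real" where
  "multiset_weight v M = (\<Prod>u\<in>set_mset M. v u ^ count M u / fact (count M u))"

lemma multiset_weight_empty [simp]: "multiset_weight v {#} = 1"
  by (simp add: multiset_weight_def)

lemma multiset_weight_superset: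
  assumes "finite S" "set_mset M \<subseteq> S"
  shows "multiset_weight v M = (\<Prod>u\<in>S. v u ^ count M u / fact (count M u))"
  unfolding multiset_weight_def
  by (rule prod.mono_neutral_left) (use assms in \<open>auto simp: not_in_iff\<close>)

text \<open>All recursions for the weights are consequences of this one: marking one of the copies of \<open>c\<close> is the same
  as adding a marked copy.\<close>

lemma multiset_weight_add:
  "real (Suc (count M c)) * multiset_weight v (add_mset c M) = v c * multiset_weight v M"
proof -
  let ?S = "insert c (set_mset M)"
  have "multiset_weight v (add_mset c M) =
      v c ^ Suc (count M c) / fact (Suc (count M c)) *
      (\<Prod>u\<in>?S - {c}. v u ^ count M u / fact (count M u))"
    by (subst multiset_weight_superset[of ?S], simp, simp, subst prod.remove[of _ c])
      (auto intro!: prod.cong)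
  moreover have "multiset_weight v M = v c ^ count M c / fact (count M c) *
      (\<Prod>u\<in>?S - {c}. v u ^ count M u / fact (count M u))"
    by (subst multiset_weight_superset[of ?S], simp, blast, subst prod.remove[of _ c]) auto
  ultimately show ?thesis by simp
qed

lemma multiset_weight_remove:
  "c \<in># M \<Longrightarrow> real (count M c) * multiset_weight v M = v c * multiset_weight v (M - {#c#})"
  using multiset_weight_add[of "M - {#c#}" c v] by (auto dest!: multi_member_split)

lemma multiset_weight_nonneg: "(\<And>u. u \<in># M \<Longrightarrow> 0 \<le> v u) \<Longrightarrow> 0 \<le> multiset_weight v M"
  unfolding multiset_weight_def by (intro prod_nonneg) auto

lemma multiset_weight_cong:
  "(\<And>u. u \<in># M \<Longrightarrow> v u = v' u) \<Longrightarrow> multiset_weight v M = multiset_weight v' M"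
  unfolding multiset_weight_def by (intro prod.cong) auto

text \<open>The derivative of \<open>multiset_weight\<close> when \<open>v\<close> moves in the direction \<open>l\<close>: one element is singled out.
  It occurs with \<open>l\<close> the derivative of \<open>v\<close> in the age of the root, and with \<open>l\<close> the rate at which a branch
  becomes very large.\<close>

definition multiset_weight_deriv :: "('a \<Rightarrow> real) \<Rightarrow> ('a \<Rightarrow> real) \<Rightarrow> 'a multiset \<Rightarrow> real" where
  "multiset_weight_deriv v l M = (\<Sum>c\<in>set_mset M. l c * multiset_weight v (M - {#c#}))"

lemma multiset_weight_deriv_empty [simp]: "multiset_weight_deriv v l {#} = 0"
  by (simp add: multiset_weight_deriv_def)

text \<open>The product rule matching \<open>multiset_weight_add\<close>, which allows inductions over the multiset.\<close>

lemma multiset_weight_deriv_add: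
  "real (Suc (count M c)) * multiset_weight_deriv v l (add_mset c M) =
     l c * multiset_weight v M + v c * multiset_weight_deriv v l M"
proof -
  let ?S = "set_mset M - {c}"
  have 1: "real (Suc (count M c)) * (l d * multiset_weight v (add_mset c M - {#d#})) =
      v c * (l d * multiset_weight v (M - {#d#}))" if "d \<in> ?S" for d
    using that multiset_weight_add[of "M - {#d#}" c v] by (simp add: mult_ac)
  have c: "real (count M c) * multiset_weight v M =
      (if c \<in># M then v c * multiset_weight v (M - {#c#}) else 0)"
    by (auto simp: multiset_weight_remove not_in_iff)
  have D: "multiset_weight_deriv v l (add_mset c M) = l c * multiset_weight v M +
      (\<Sum>d\<in>?S. l d * multiset_weight v (add_mset c M - {#d#}))"
    unfolding multiset_weight_deriv_def by (subst sum.remove[of _ c]) auto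
  have "real (Suc (count M c)) * multiset_weight_deriv v l (add_mset c M) =
     l c * multiset_weight v M + l c * (real (count M c) * multiset_weight v M) +
     (\<Sum>d\<in>?S. real (Suc (count M c)) * (l d * multiset_weight v (add_mset c M - {#d#})))"
    unfolding D by (simp add: sum_distrib_left algebra_simps)
  also have "(\<Sum>d\<in>?S. real (Suc (count M c)) * (l d * multiset_weight v (add_mset c M - {#d#}))) =
      (\<Sum>d\<in>?S. v c * (l d * multiset_weight v (M - {#d#})))"
    by (rule sum.cong[OF refl 1])
  also have "(\<Sum>d\<in>?S. v c * (l d * multiset_weight v (M - {#d#}))) =
      v c * multiset_weight_deriv v l M - l c * (real (count M c) * multiset_weight v M)"
    unfolding c multiset_weight_deriv_def sum_distrib_left
    by (cases "c \<in># M") (simp_all add: sum.remove[of "set_mset M" c])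
  finally show ?thesis by (simp only: algebra_simps)
qed

lemma sum_remove_element:
  assumes "finite A"
  shows "(\<Sum>M\<in>A. \<Sum>c\<in>set_mset M. g (M - {#c#}) c) = (\<Sum>(N, c) | add_mset c N \<in> A. g N c)"
proof -
  have "(\<Sum>M\<in>A. \<Sum>c\<in>set_mset M. g (M - {#c#}) c) = (\<Sum>(M, c)\<in>Sigma A set_mset. g (M - {#c#}) c)"
    using assms by (subst sum.Sigma) auto
  also have "\<dots> = (\<Sum>(N, c) | add_mset c N \<in> A. g N c)"
    by (rule sum.reindex_bij_witness[of _ "\<lambda>(N, c). (add_mset c N, c)" "\<lambda>(M, c). (M - {#c#}, c)"]) auto
  finally show ?thesis .
qed

lemma sum_multiset_weight_element:
  assumes "finite A"
  shows "(\<Sum>M\<in>A. multiset_weight v M * (\<Sum>c\<in>set_mset M. real (count M c) * g (M - {#c#}) c)) =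
    (\<Sum>(N, c) | add_mset c N \<in> A. multiset_weight v N * (v c * g N c))"
proof -
  have "multiset_weight v M * (\<Sum>c\<in>set_mset M. real (count M c) * g (M - {#c#}) c) =
     (\<Sum>c\<in>set_mset M. multiset_weight v (M - {#c#}) * (v c * g (M - {#c#}) c))" for M
    unfolding sum_distrib_left
  proof (rule sum.cong[OF refl])
    fix c assume "c \<in> set_mset M"
    from multiset_weight_remove[OF this, of v]
    show "multiset_weight v M * (real (count M c) * g (M - {#c#}) c) =
        multiset_weight v (M - {#c#}) * (v c * g (M - {#c#}) c)"
      by (metis (no_types, lifting) mult.assoc mult.commute)
  qed
  then show ?thesis
    using sum_remove_element[OF assms, of "\<lambda>N c. multiset_weight v N * (v c * g N c)"] by simp
qed

section \<open>Finite trees and forests\<close>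

lemma finite_multisets_bounded_size:
  assumes "finite A" shows "finite {M. set_mset M \<subseteq> A \<and> size M \<le> n}"
proof (rule finite_subset)
  show "{M. set_mset M \<subseteq> A \<and> size M \<le> n} \<subseteq> mset ` {xs. set xs \<subseteq> A \<and> length xs \<le> n}"
  proof
    fix M assume M: "M \<in> {M. set_mset M \<subseteq> A \<and> size M \<le> n}"
    obtain xs where "mset xs = M" using ex_mset by blast
    with M show "M \<in> mset ` {xs. set xs \<subseteq> A \<and> length xs \<le> n}" by (force simp: image_iff)
  qed
qed (use finite_lists_length_le[OF assms] in simp)

abbreviation forest_size :: "rtree multiset \<Rightarrow> nat" where
  "forest_size M \<equiv> \<Sum>\<^sub># (image_mset num_vertices M)"

lemma num_vertices_pos: "num_vertices t > 0" by (cases t) simp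

lemma num_vertices_le_forest_size: "c \<in># M \<Longrightarrow> num_vertices c \<le> forest_size M"
  by (auto dest!: multi_member_split)

lemma size_le_forest_size: "size M \<le> forest_size M"
proof (induction M)
  case (add x M)
  then show ?case using num_vertices_pos[of x] by (simp only: size_add_mset image_mset_add_mset sum_mset.add_mset)
qed simp

lemma finite_trees_bounded_size: "finite {t. num_vertices t \<le> n}"
proof (induction n)
  case 0
  have "num_vertices t \<noteq> 0" for t using num_vertices_pos[of t] by simp
  then have "{t. num_vertices t \<le> 0} = {}" unfolding le_0_eq by blast
  then show ?case by (simp only: finite.emptyI)
next
  case (Suc n)
  have "{t. num_vertices t \<le> Suc n} \<subseteq> Node ` {M. set_mset M \<subseteq> {t. num_vertices t \<le> n} \<and> size M \<le> n}"
  proof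
    fix t assume t: "t \<in> {t. num_vertices t \<le> Suc n}"
    obtain M where M: "t = Node M" by (cases t)
    then have "forest_size M \<le> n" using t by simp
    then have "set_mset M \<subseteq> {t. num_vertices t \<le> n}"
      using num_vertices_le_forest_size le_trans by blast
    moreover have "size M \<le> n"
      using \<open>forest_size M \<le> n\<close> size_le_forest_size[of M] by linarith
    ultimately show "t \<in> Node ` {M. set_mset M \<subseteq> {t. num_vertices t \<le> n} \<and> size M \<le> n}"
      unfolding M by blast
  qed
  then show ?case
    by (rule finite_subset) (rule finite_imageI[OF finite_multisets_bounded_size[OF Suc.IH]])
qed

lemma finite_forests_bounded_size: "finite {M. forest_size M \<le> n}"
proof -
  have "finite (Node -` {t. num_vertices t \<le> Suc n})"
    by (rule finite_vimageI[OF finite_trees_bounded_size]) (simp add: inj_def)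
  moreover have "Node -` {t. num_vertices t \<le> Suc n} = {M. forest_size M \<le> n}" by auto
  ultimately show ?thesis by (simp only:)
qed

text \<open>Mark one of the elements of \<open>m\<close> equal to \<open>c\<close>, that is, one element of \<open>M\<close> which \<open>h\<close> maps to \<open>c\<close>, and
  remove it: the sizes of the removed tree and of the remaining forest add up, whence the convolution. It is used with \<open>h\<close>
  the ball of radius \<open>r\<close>.\<close>

lemma multiset_weight_fibre_recursion:
  fixes h :: "rtree \<Rightarrow> rtree" and v :: "rtree \<Rightarrow> real"
  assumes "c \<in># m"
  defines "S \<equiv> \<lambda>m k. \<Sum>M | image_mset h M = m \<and> forest_size M = k. multiset_weight v M"
  shows "real (count m c) * S m k =
    (\<Sum>j\<le>k. (\<Sum>u | h u = c \<and> num_vertices u = j. v u) * S (m - {#c#}) (k - j))"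
proof -
  define A where "A = {M. image_mset h M = m \<and> forest_size M = k}"
  have finA: "finite A"
    unfolding A_def by (rule finite_subset[OF _ finite_forests_bounded_size[of k]]) auto
  obtain m' where m': "m = add_mset c m'" using assms(1) by (metis insert_DiffM)
  let ?I = "\<lambda>u. if h u = c then 1 else (0::real)"
  let ?B = "\<lambda>j. {u. h u = c \<and> num_vertices u = j}"
  let ?C = "\<lambda>j. {N. image_mset h N = m - {#c#} \<and> forest_size N = k - j}"
  have finB: "finite (?B j)" for j
    by (rule finite_subset[OF _ finite_trees_bounded_size[of j]]) auto
  have finC: "finite (?C j)" for j
    by (rule finite_subset[OF _ finite_forests_bounded_size[of "k - j"]]) auto
  have cnt: "real (count m c) = (\<Sum>u\<in>set_mset M. real (count M u) * ?I u)" if "M \<in> A" for M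
  proof -
    have "m = image_mset h M" using that by (simp add: A_def)
    then have "real (count m c) = (\<Sum>u\<in>h -` {c} \<inter> set_mset M. real (count M u))"
      by (simp add: count_image_mset)
    also have "\<dots> = (\<Sum>u\<in>set_mset M. real (count M u) * ?I u)"
      by (rule sum.mono_neutral_cong_left) auto
    finally show ?thesis .
  qed
  have "real (count m c) * S m k = (\<Sum>M\<in>A. multiset_weight v M * real (count m c))"
    by (simp add: S_def A_def sum_distrib_left mult.commute)
  also have "\<dots> = (\<Sum>M\<in>A. multiset_weight v M * (\<Sum>u\<in>set_mset M. real (count M u) * ?I u))"
    by (intro sum.cong refl arg_cong2[where f="(*)"] cnt)
  also have "\<dots> = (\<Sum>(N, u) | add_mset u N \<in> A. multiset_weight v N * (v u * ?I u))"
    by (rule sum_multiset_weight_element[OF finA])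
  also have "\<dots> = (\<Sum>(N, u) | add_mset u N \<in> A \<and> h u = c. v u * multiset_weight v N)"
  proof (rule sum.mono_neutral_cong_right)
    have "{(N, u). add_mset u N \<in> A} \<subseteq> (\<lambda>(M, u). (M - {#u#}, u)) ` Sigma A set_mset"
    proof
      fix x assume "x \<in> {(N, u). add_mset u N \<in> A}"
      then have "x = (\<lambda>(M, u). (M - {#u#}, u)) (add_mset (snd x) (fst x), snd x)"
        "(add_mset (snd x) (fst x), snd x) \<in> Sigma A set_mset" by auto
      then show "x \<in> (\<lambda>(M, u). (M - {#u#}, u)) ` Sigma A set_mset" by (rule image_eqI)
    qed
    then show "finite {(N, u). add_mset u N \<in> A}"
      by (rule finite_subset) (use finA in auto)
  qed (auto split: if_splits)
  also have "\<dots> = (\<Sum>(j, u, N)\<in>(SIGMA j:{..k}. ?B j \<times> ?C j). v u * multiset_weight v N)"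
    by (rule sum.reindex_bij_witness[where i="\<lambda>(j, u, N). (N, u)" and j="\<lambda>(N, u). (num_vertices u, u, N)"])
      (simp_all only: mem_Collect_eq case_prod_beta mem_Sigma_iff A_def fst_conv snd_conv prod.collapse prod.inject,
       auto simp: m')
  also have "\<dots> = (\<Sum>j\<le>k. \<Sum>u\<in>?B j. \<Sum>N\<in>?C j. v u * multiset_weight v N)"
    unfolding sum.cartesian_product by (rule sum.Sigma[symmetric]) (use finB finC in auto)
  finally show ?thesis by (simp add: S_def sum_product)
qed

section \<open>Integration over the age of a vertex\<close>

text \<open>Its total mass is \<open>1/2\<close>. Multiplied by \<open>1 / (1 - age_param a)\<^sup>2\<close> it becomes the density
  \<open>sech\<^sup>2 (a / 2) / 2\<close> of the ages, see \<open>hyperbolic_age_param\<close>; that factor is the total weight of all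
  trees with root age \<open>a\<close>.\<close>

definition exp_age :: "real measure" where
  "exp_age = density lborel (\<lambda>a. ennreal (indicator {0..} a * (exp (- a) / 2)))"

lemma sets_exp_age [simp, measurable_cong]: "sets exp_age = sets borel"
  and space_exp_age [simp]: "space exp_age = UNIV"
  by (simp_all add: exp_age_def)

lemma emeasure_exp_age: "emeasure exp_age UNIV = ennreal (1/2)"
proof -
  have "(\<integral>\<^sup>+a. ennreal (exp (- a) / 2) * indicator {0..} a \<partial>lborel) = ennreal (0 - (- exp (-0) / 2))"
  proof (rule nn_integral_FTC_atLeast[where F="\<lambda>a. - exp (- a) / 2"])
    show "((\<lambda>a. - exp (- a) / 2 :: real) \<longlongrightarrow> 0) at_top" by real_asymp
  qed (auto intro!: derivative_eq_intros)
  then show ?thesis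
    by (simp add: exp_age_def emeasure_density mult.commute flip: ennreal_indicator ennreal_mult')
qed

lemma finite_measure_exp_age: "finite_measure exp_age"
  by standard (simp add: emeasure_exp_age)

interpretation exp_age: finite_measure exp_age
  by (rule finite_measure_exp_age)

lemma AE_exp_age_nonneg: "AE a in exp_age. 0 \<le> a"
  unfolding exp_age_def by (subst AE_density) (auto intro!: AE_I2 split: split_indicator)

lemma AE_exp_age_neq: "AE a in exp_age. a \<noteq> b"
  unfolding exp_age_def using AE_lborel_singleton[of b] by (subst AE_density) auto

lemma AE_exp_age_pos: "AE a in exp_age. 0 < a"
  using AE_exp_age_nonneg AE_exp_age_neq[of 0] by eventually_elim auto

lemma integral_exp_age:
  fixes f :: "real \<Rightarrow> real"
  assumes "f \<in> borel_measurable borel"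
  shows "(\<integral>a. f a \<partial>exp_age) = (\<integral>a. indicator {0..} a * (exp (- a) / 2) * f a \<partial>lborel)"
  unfolding exp_age_def using assms by (subst integral_density) auto

lemma integrable_exp_age:
  fixes f :: "real \<Rightarrow> real"
  assumes "f \<in> borel_measurable borel"
  shows "integrable exp_age f \<longleftrightarrow> integrable lborel (\<lambda>a. indicator {0..} a * (exp (- a) / 2) * f a)"
  unfolding exp_age_def using assms by (subst integrable_density) auto

lemma has_bochner_integral_age: "has_bochner_integral exp_age (\<lambda>a. a) (1/2)"
proof -
  have "(\<integral>\<^sup>+a. ennreal (a * exp (- a) / 2) * indicator {0..} a \<partial>lborel) = ennreal (0 - (- (0 + 1) * exp (-0) / 2))"
  proof (rule nn_integral_FTC_atLeast[where F="\<lambda>a. - (a + 1) * exp (- a) / 2"])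
    show "((\<lambda>a. - (a + 1) * exp (- a) / 2 :: real) \<longlongrightarrow> 0) at_top" by real_asymp
    show "((\<lambda>a. - (a + 1) * exp (- a) / 2) has_real_derivative a * exp (- a) / 2) (at a)" for a
      by (auto intro!: derivative_eq_intros simp: field_simps)
  qed auto
  moreover have "(\<integral>\<^sup>+a. ennreal a \<partial>exp_age) = (\<integral>\<^sup>+a. ennreal (a * exp (- a) / 2) * indicator {0..} a \<partial>lborel)"
    unfolding exp_age_def
    by (subst nn_integral_density) (auto intro!: nn_integral_cong split: split_indicator simp: ennreal_mult'[symmetric] mult_ac)
  ultimately have "(\<integral>\<^sup>+a. ennreal a \<partial>exp_age) = ennreal (1/2)" by simp
  then show ?thesis
    using AE_exp_age_nonneg by (intro has_bochner_integral_nn_integral) auto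
qed

named_theorems tempered_intros

text \<open>The functions of an age that occur below. Nothing is asked of their size at negative ages, to which \<open>exp_age\<close> gives
  no mass but at which they are defined, so that derivatives at \<open>0\<close> are two-sided.\<close>

definition tempered :: "(real \<Rightarrow> real) \<Rightarrow> bool" where
  "tempered f \<longleftrightarrow> f \<in> borel_measurable borel \<and> (\<exists>B. \<forall>a\<ge>0. \<bar>f a\<bar> \<le> B)"

lemma tempered_measurable [measurable_dest]: "tempered f \<Longrightarrow> f \<in> borel_measurable borel"
  by (simp add: tempered_def)

lemma tempered_bound:
  assumes "tempered f" shows "\<exists>B\<ge>0. \<forall>a\<ge>0. \<bar>f a\<bar> \<le> B"
proof -
  obtain B where B: "\<forall>a\<ge>0. \<bar>f a\<bar> \<le> B" using assms unfolding tempered_def by blast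
  then have "0 \<le> B" using abs_ge_zero[of "f 0"] by (meson order_refl order_trans)
  with B show ?thesis by blast
qed

lemma tempered_const [tempered_intros]: "tempered (\<lambda>a. c)"
  by (auto simp: tempered_def)

lemma tempered_add [tempered_intros]: "tempered f \<Longrightarrow> tempered g \<Longrightarrow> tempered (\<lambda>a. f a + g a)"
proof -
  assume f: "tempered f" and g: "tempered g"
  obtain B where "\<forall>a\<ge>0. \<bar>f a\<bar> \<le> B" using tempered_bound[OF f] by blast
  moreover obtain C where "\<forall>a\<ge>0. \<bar>g a\<bar> \<le> C" using tempered_bound[OF g] by blast
  ultimately have "\<forall>a\<ge>0. \<bar>f a + g a\<bar> \<le> B + C" by (meson abs_triangle_ineq add_mono order_trans)
  then show ?thesis using f g by (auto simp: tempered_def)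
qed

lemma tempered_mult [tempered_intros]: "tempered f \<Longrightarrow> tempered g \<Longrightarrow> tempered (\<lambda>a. f a * g a)"
proof -
  assume f: "tempered f" and g: "tempered g"
  obtain B where "B \<ge> 0" "\<forall>a\<ge>0. \<bar>f a\<bar> \<le> B" using tempered_bound[OF f] by blast
  moreover obtain C where "\<forall>a\<ge>0. \<bar>g a\<bar> \<le> C" using tempered_bound[OF g] by blast
  ultimately have "\<forall>a\<ge>0. \<bar>f a * g a\<bar> \<le> B * C" by (auto simp: abs_mult intro!: mult_mono)
  then show ?thesis using f g by (auto simp: tempered_def)
qed

lemma tempered_uminus [tempered_intros]: "tempered f \<Longrightarrow> tempered (\<lambda>a. - f a)"
  by (auto simp: tempered_def)

lemma tempered_diff [tempered_intros]: "tempered f \<Longrightarrow> tempered g \<Longrightarrow> tempered (\<lambda>a. f a - g a)"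
  using tempered_add[of f "\<lambda>a. - g a"] by (simp add: tempered_uminus)

lemma tempered_divide [tempered_intros]: "tempered f \<Longrightarrow> tempered (\<lambda>a. f a / c)"
  using tempered_mult[of f "\<lambda>a. 1 / c"] by (simp add: tempered_const)

lemma tempered_power [tempered_intros]: "tempered f \<Longrightarrow> tempered (\<lambda>a. f a ^ n)"
  by (induction n) (simp_all add: tempered_const tempered_mult)

lemma tempered_sum [tempered_intros]: "(\<And>i. i \<in> I \<Longrightarrow> tempered (f i)) \<Longrightarrow> tempered (\<lambda>a. \<Sum>i\<in>I. f i a)"
  by (induction I rule: infinite_finite_induct) (simp_all add: tempered_const tempered_add tempered_mult)

lemma tempered_prod [tempered_intros]: "(\<And>i. i \<in> I \<Longrightarrow> tempered (f i)) \<Longrightarrow> tempered (\<lambda>a. \<Prod>i\<in>I. f i a)"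
  by (induction I rule: infinite_finite_induct) (simp_all add: tempered_const tempered_add tempered_mult)

lemma tempered_multiset_weight [tempered_intros]:
  "(\<And>c. c \<in># m \<Longrightarrow> tempered (v c)) \<Longrightarrow> tempered (\<lambda>b. multiset_weight (\<lambda>c. v c b) m)"
  unfolding multiset_weight_def
  by (intro tempered_prod tempered_divide tempered_power) auto

lemma tempered_multiset_weight_deriv [tempered_intros]:
  "(\<And>c. c \<in># m \<Longrightarrow> tempered (v c)) \<Longrightarrow> (\<And>c. c \<in># m \<Longrightarrow> tempered (l c)) \<Longrightarrow>
    tempered (\<lambda>b. multiset_weight_deriv (\<lambda>c. v c b) (\<lambda>c. l c b) m)"
  unfolding multiset_weight_deriv_def
  by (intro tempered_sum tempered_mult tempered_multiset_weight) (auto dest: in_diffD)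

lemma integrable_tempered [simp]: 
  assumes "tempered f" shows "integrable exp_age f"
proof -
  obtain B where "\<forall>a\<ge>0. \<bar>f a\<bar> \<le> B" using tempered_bound[OF assms] by blast
  then show ?thesis using assms AE_exp_age_nonneg
    by (intro exp_age.integrable_const_bound[of _ B]) (auto simp: tempered_def elim!: eventually_mono)
qed

lemma tempered_min [tempered_intros]: "tempered (\<lambda>a. min b a)"
proof -
  have "\<bar>min b a\<bar> \<le> \<bar>b\<bar>" if "0 \<le> a" for a using that by (auto simp: min_def)
  then show ?thesis unfolding tempered_def by (auto intro!: exI[of _ "\<bar>b\<bar>"])
qed

lemma tempered_indicator [tempered_intros]: "tempered (indicator {b<..})"
  unfolding tempered_def by (auto intro!: exI[of _ 1] split: split_indicator)

text \<open>Attaching, below a vertex of age \<open>b\<close>, an edge and a branch whose weight depends on the age of its root.\<close>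

definition edge_op :: "(real \<Rightarrow> real) \<Rightarrow> real \<Rightarrow> real" where
  "edge_op f b = (\<integral>a. min b a * f a \<partial>exp_age)"

text \<open>The derivative of \<open>edge_op\<close>, because \<open>min b a\<close> grows with \<open>b\<close> exactly when \<open>b < a\<close>.\<close>

definition age_tail :: "(real \<Rightarrow> real) \<Rightarrow> real \<Rightarrow> real" where
  "age_tail f b = (\<integral>a. indicator {b<..} a * f a \<partial>exp_age)"

lemma tempered_integral_cong:
  assumes "\<And>a. 0 \<le> a \<Longrightarrow> f a = g a" and [measurable]: "tempered f" "tempered g"
  shows "(\<integral>a. f a \<partial>exp_age) = (\<integral>a. g a \<partial>exp_age)"
proof (rule integral_cong_AE)
  show "AE a in exp_age. f a = g a" using AE_exp_age_nonneg by eventually_elim (rule assms(1))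
qed measurable

lemma edge_op_cong:
  assumes "\<And>a. 0 \<le> a \<Longrightarrow> f a = g a" "tempered f" "tempered g"
  shows "edge_op f b = edge_op g b"
  unfolding edge_op_def using assms by (intro tempered_integral_cong tempered_mult tempered_min) auto

lemma edge_op_nonneg: "0 \<le> b \<Longrightarrow> (\<And>a. 0 \<le> a \<Longrightarrow> 0 \<le> f a) \<Longrightarrow> 0 \<le> edge_op f b"
  unfolding edge_op_def
proof (rule integral_nonneg_AE)
  assume "0 \<le> b" and f: "\<And>a. 0 \<le> a \<Longrightarrow> 0 \<le> f a"
  show "AE a in exp_age. 0 \<le> min b a * f a"
    using AE_exp_age_nonneg by eventually_elim (simp add: f \<open>0 \<le> b\<close>)
qed

lemma edge_op_0: "edge_op f 0 = 0"
proof -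
  have "AE a in exp_age. min 0 a * f a = 0"
    using AE_exp_age_nonneg by eventually_elim simp
  then show ?thesis unfolding edge_op_def by (rule integral_eq_zero_AE)
qed

text \<open>The difference quotients of \<open>min b a\<close> in \<open>b\<close> are bounded by \<open>1\<close> and converge except at \<open>a = b\<close>, so that
  dominated convergence applies.\<close>

lemma DERIV_edge_op:
  assumes f: "tempered f"
  shows "(edge_op f has_real_derivative age_tail f b) (at b)"
  unfolding DERIV_def tendsto_at_iff_sequentially
proof (intro allI impI)
  fix X :: "nat \<Rightarrow> real" assume X: "\<forall>i. X i \<in> UNIV - {0}" "X \<longlonglongrightarrow> 0"
  note [measurable] = f
  let ?s = "\<lambda>i a. (min (b + X i) a - min b a) / X i * f a"
  have "(\<lambda>i. \<integral>a. ?s i a \<partial>exp_age) \<longlonglongrightarrow> (\<integral>a. indicator {b<..} a * f a \<partial>exp_age)"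
  proof (rule integral_dominated_convergence[where w="\<lambda>a. norm (f a)"])
    show "integrable exp_age (\<lambda>a. norm (f a))" using f by (intro integrable_norm integrable_tempered)
    have "\<bar>min (b + h) a - min b a\<bar> \<le> \<bar>h\<bar>" for h a :: real by (auto simp: min_def)
    then have "\<bar>(min (b + X i) a - min b a) / X i\<bar> \<le> 1" for i a
      using X(1) by (auto simp: abs_divide divide_le_eq)
    then have "norm (?s i a) \<le> norm (f a)" for i a
      unfolding real_norm_def abs_mult by (intro mult_left_le_one_le) auto
    then show "AE a in exp_age. norm (?s i a) \<le> norm (f a)" for i by simp
    show "AE a in exp_age. (\<lambda>i. ?s i a) \<longlonglongrightarrow> indicator {b<..} a * f a"
      using AE_exp_age_neq[of b]
    proof eventually_elim
      case (elim a)
      have "\<forall>\<^sub>F i in sequentially. \<bar>X i\<bar> < \<bar>a - b\<bar>"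
        using X(2) elim by (auto simp: tendsto_iff dist_real_def dest!: spec[of _ "\<bar>a - b\<bar>"])
      then have "\<forall>\<^sub>F i in sequentially. ?s i a = indicator {b<..} a * f a"
        by eventually_elim (use X(1) in \<open>auto simp: min_def split: split_indicator\<close>)
      then show ?case by (rule tendsto_eventually)
    qed
  qed measurable
  moreover have "(\<integral>a. ?s i a \<partial>exp_age) = (edge_op f (b + X i) - edge_op f b) / X i" for i
  proof -
    have "(\<integral>a. ?s i a \<partial>exp_age) = (\<integral>a. (min (b + X i) a * f a - min b a * f a) / X i \<partial>exp_age)"
      by (simp add: algebra_simps diff_divide_distrib)
    also have "\<dots> = (edge_op f (b + X i) - edge_op f b) / X i"
      unfolding edge_op_def integral_divide_zero
      by (subst Bochner_Integration.integral_diff) (intro integrable_tempered tempered_mult tempered_min f refl)+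
    finally show ?thesis .
  qed
  ultimately show "((\<lambda>h. (edge_op f (b + h) - edge_op f b) / h) \<circ> X) \<longlonglongrightarrow> age_tail f b"
    unfolding comp_def age_tail_def by (simp only:)
qed

lemma tempered_edge_op [tempered_intros]:
  assumes "tempered f" shows "tempered (edge_op f)"
proof -
  obtain B where B: "B \<ge> 0" "\<forall>a\<ge>0. \<bar>f a\<bar> \<le> B" using tempered_bound[OF assms] by blast
  have "continuous_on UNIV (edge_op f)"
    using DERIV_edge_op[OF assms] by (meson DERIV_continuous continuous_at_imp_continuous_on)
  moreover have "\<bar>edge_op f b\<bar> \<le> B * (1/2)" if b: "0 \<le> b" for b
  proof -
    have "AE a in exp_age. norm (min b a * f a) \<le> B * a"
      using AE_exp_age_nonneg
    proof eventually_elim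
      case (elim a)
      then show ?case using b B mult_mono[of "min b a" a "\<bar>f a\<bar>" B] by (simp add: abs_mult mult.commute)
    qed
    then have "(\<integral>a. \<bar>min b a * f a\<bar> \<partial>exp_age) \<le> (\<integral>a. B * a \<partial>exp_age)"
      using integrable_mult_right[OF has_bochner_integral_age[THEN integrable.intros], of B] assms
      by (intro integral_mono_AE integrable_abs[OF integrable_tempered[OF tempered_mult[OF tempered_min]]]) simp_all
    then have "\<bar>edge_op f b\<bar> \<le> (\<integral>a. B * a \<partial>exp_age)"
      unfolding edge_op_def by (rule order_trans[OF integral_abs_bound])
    also have "\<dots> = B * (1/2)"
      using has_bochner_integral_integral_eq[OF has_bochner_integral_age] by simp
    finally show ?thesis by simp
  qed
  ultimately show ?thesis
    unfolding tempered_def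
    by (intro conjI borel_measurable_continuous_onI exI[of _ "B * (1/2)"] allI impI) auto
qed

lemma age_tail_eq_FTC:
  assumes b: "0 \<le> b" and f: "tempered f" "\<And>a. b < a \<Longrightarrow> isCont f a"
    and F: "\<And>a. b < a \<Longrightarrow> (F has_real_derivative - (exp (- a) / 2 * f a)) (at a)"
    and cont: "isCont F b" and lim: "(F \<longlongrightarrow> 0) at_top"
  shows "age_tail f b = F b"
proof -
  note [measurable] = f(1)
  let ?f = "\<lambda>a. exp (- a) / 2 * f a"
  have eq: "indicator {b<..} a * ?f a = indicator {0..} a * (exp (- a) / 2) * (indicator {b<..} a * f a)" for a
    using b by (auto split: split_indicator)
  have "integrable exp_age (\<lambda>a. indicator {b<..} a * f a)"
    by (intro integrable_tempered tempered_mult tempered_indicator f)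
  then have int: "set_integrable lborel {b<..} ?f"
    unfolding set_integrable_def real_scaleR_def eq by (subst (asm) integrable_exp_age) measurable
  have "(LBINT x=ereal b..\<infinity>. - ?f x) = 0 - F b"
  proof (rule interval_integral_FTC_integrable)
    show "(F has_vector_derivative - ?f a) (at a)" if "ereal b < ereal a" for a
      using F[of a] that by (simp add: has_real_derivative_iff_has_vector_derivative)
    show "isCont (\<lambda>a. - ?f a) a" if "ereal b < ereal a" for a
      using f(2)[of a] that by (intro continuous_intros) auto
    have "einterval (ereal b) \<infinity> = {b<..}" by (auto simp: einterval_def)
    then show "set_integrable lborel (einterval (ereal b) \<infinity>) (\<lambda>a. - ?f a)"
      using int by (simp add: set_integrable_def)
    show "((F \<circ> real_of_ereal) \<longlongrightarrow> F b) (at_right (ereal b))"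
      using cont by (simp add: ereal_tendsto_simps isCont_def tendsto_mono at_within_le_at filterlim_at_split)
    show "((F \<circ> real_of_ereal) \<longlongrightarrow> 0) (at_left \<infinity>)"
      using lim by (simp add: ereal_tendsto_simps)
  qed simp
  moreover have "(LBINT x=ereal b..\<infinity>. - ?f x) = - (\<integral>a. indicator {b<..} a * ?f a \<partial>lborel)"
    by (simp add: interval_integral_to_infinity_eq set_lebesgue_integral_def)
  moreover have "age_tail f b = (\<integral>a. indicator {b<..} a * ?f a \<partial>lborel)"
    unfolding age_tail_def eq by (rule integral_exp_age) measurable
  ultimately show ?thesis by simp
qed

lemma tempered_tendsto_0:
  assumes "tempered f" shows "((\<lambda>a. exp (- a) / 2 * f a) \<longlongrightarrow> 0) at_top"
proof -
  obtain B where B: "B \<ge> 0" "\<forall>a\<ge>0. \<bar>f a\<bar> \<le> B" using tempered_bound[OF assms] by blast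
  show ?thesis
  proof (rule Lim_null_comparison)
    show "\<forall>\<^sub>F a in at_top. norm (exp (- a) / 2 * f a) \<le> exp (- a) / 2 * B"
      using eventually_ge_at_top[of 0] by eventually_elim (use B in \<open>simp add: abs_mult mult_left_mono\<close>)
    have "((\<lambda>a::real. exp (- a) / 2) \<longlongrightarrow> 0) at_top" by real_asymp
    from tendsto_mult_right[OF this, of B] show "((\<lambda>a. exp (- a) / 2 * B) \<longlongrightarrow> 0) at_top" by simp
  qed
qed

lemma age_tail_derivative:
  assumes b: "0 \<le> b" and f: "tempered f" "tempered f'" "\<And>a. isCont f' a"
    and deriv: "\<And>a. (f has_real_derivative f' a) (at a)"
  shows "age_tail (\<lambda>a. f a - f' a) b = exp (- b) / 2 * f b"
proof (rule age_tail_eq_FTC[OF b])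
  show "((\<lambda>b. exp (- b) / 2 * f b) has_real_derivative - (exp (- a) / 2 * (f a - f' a))) (at a)" for a
    by (auto intro!: derivative_eq_intros deriv simp: field_simps)
  show "isCont (\<lambda>a. f a - f' a) a" for a
    by (intro continuous_intros f DERIV_isCont[OF deriv])
  show "isCont (\<lambda>b. exp (- b) / 2 * f b) b"
    by (intro continuous_intros DERIV_isCont[OF deriv]) auto
qed (intro tempered_diff tempered_tendsto_0 f)+

text \<open>Integration by parts: moving \<open>a\<close> and \<open>b\<close> together changes \<open>min b a\<close> at rate \<open>1\<close>, which deletes the edge
  and leaves the full integral of \<open>f\<close>.\<close>

lemma edge_op_derivative:
  assumes b: "0 \<le> b" and f: "tempered f" "tempered f'" "\<And>a. isCont f' a"
    and deriv: "\<And>a. (f has_real_derivative f' a) (at a)"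
  shows "edge_op (\<lambda>a. f' a - f a) b = age_tail f b - (\<integral>a. f a \<partial>exp_age)"
proof -
  note [measurable] = f(1,2)
  let ?F = "\<lambda>a. a * (exp (- a) / 2 * f a)" and ?J = "\<lambda>a. indicator {..b} a :: real"
  let ?F' = "\<lambda>a. exp (- a) / 2 * (a * (f' a - f a) + f a)"
  have tJ: "tempered ?J" unfolding tempered_def by (auto intro!: exI[of _ 1] split: split_indicator)
  have tJa: "tempered (\<lambda>a. ?J a * a)"
    unfolding tempered_def using b by (auto intro!: exI[of _ b] split: split_indicator)
  \<comment> \<open>On \<open>[0, b]\<close> the factor \<open>min b a\<close> is \<open>a\<close>, and \<open>?F'\<close> is the derivative of \<open>a * exp (- a) / 2 * f a\<close>.\<close>
  have "has_bochner_integral lborel (\<lambda>a. ?F' a * indicator {0..b} a) (?F b - ?F 0)"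
  proof (rule has_bochner_integral_FTC_Icc_real[OF b])
    show "(?F has_real_derivative ?F' a) (at a)" for a
      by (auto intro!: derivative_eq_intros deriv simp: field_simps)
    show "isCont ?F' a" for a
      by (intro continuous_intros f DERIV_isCont[OF deriv]) auto
  qed
  then have "(\<integral>a. ?F' a * indicator {0..b} a \<partial>lborel) = ?F b"
    by (simp add: has_bochner_integral_iff)
  moreover have "(\<integral>a. ?J a * (a * (f' a - f a) + f a) \<partial>exp_age) = (\<integral>a. ?F' a * indicator {0..b} a \<partial>lborel)"
    by (subst integral_exp_age) (auto intro!: Bochner_Integration.integral_cong split: split_indicator)
  moreover have "(\<integral>a. ?J a * (a * (f' a - f a) + f a) \<partial>exp_age) =
      (\<integral>a. ?J a * a * (f' a - f a) \<partial>exp_age) + (\<integral>a. ?J a * f a \<partial>exp_age)"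
  proof -
    have "?J a * (a * (f' a - f a) + f a) = ?J a * a * (f' a - f a) + ?J a * f a" for a
      by (simp add: distrib_left)
    then show ?thesis
      by (simp only:) (intro Bochner_Integration.integral_add integrable_tempered tempered_mult[OF tJa] tempered_mult[OF tJ] tempered_diff f)
  qed
  moreover have "edge_op (\<lambda>a. f' a - f a) b =
      (\<integral>a. ?J a * a * (f' a - f a) \<partial>exp_age) + (\<integral>a. b * (indicator {b<..} a * (f' a - f a)) \<partial>exp_age)"
    unfolding edge_op_def
    by (subst Bochner_Integration.integral_add[symmetric])
      (auto intro!: Bochner_Integration.integral_cong integrable_tempered tempered_mult[OF tJa] tempered_mult[OF tempered_indicator]
         tempered_mult[OF tempered_const] tempered_diff f split: split_indicator simp: min_def)
  moreover have "(\<integral>a. b * (indicator {b<..} a * (f' a - f a)) \<partial>exp_age) = - b * age_tail (\<lambda>a. f a - f' a) b"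
    unfolding age_tail_def integral_mult_right_zero[symmetric] by (simp add: algebra_simps)
  moreover have "(\<integral>a. f a \<partial>exp_age) = (\<integral>a. ?J a * f a \<partial>exp_age) + age_tail f b"
    unfolding age_tail_def
    by (subst Bochner_Integration.integral_add[symmetric])
      (auto intro!: Bochner_Integration.integral_cong integrable_tempered tempered_mult[OF tJ] tempered_mult[OF tempered_indicator] f
        split: split_indicator)
  ultimately show ?thesis
    using age_tail_derivative[OF b f deriv] by simp
qed

lemma isCont_age_tail:
  assumes f: "tempered f" shows "isCont (age_tail f) b"
  unfolding continuous_at_sequentially
proof (intro allI impI)
  fix X assume X: "X \<longlonglongrightarrow> b"
  note [measurable] = f
  show "(age_tail f \<circ> X) \<longlonglongrightarrow> age_tail f b"
    unfolding age_tail_def comp_def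
  proof (rule integral_dominated_convergence[where w="\<lambda>a. norm (f a)"])
    show "integrable exp_age (\<lambda>a. norm (f a))" using f by (intro integrable_norm integrable_tempered)
    show "AE a in exp_age. (\<lambda>i. indicator {X i<..} a * f a) \<longlonglongrightarrow> indicator {b<..} a * f a"
      using AE_exp_age_neq[of b]
    proof eventually_elim
      case (elim a)
      have "\<forall>\<^sub>F i in sequentially. \<bar>X i - b\<bar> < \<bar>a - b\<bar>"
        using X elim by (auto simp: tendsto_iff dist_real_def dest!: spec[of _ "\<bar>a - b\<bar>"])
      then have "\<forall>\<^sub>F i in sequentially. indicator {X i<..} a * f a = indicator {b<..} a * f a"
        by eventually_elim (auto split: split_indicator)
      then show ?case by (rule tendsto_eventually)
    qed
  qed (auto split: split_indicator)
qed

lemma tempered_age_tail [tempered_intros]: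
  assumes "tempered f" shows "tempered (age_tail f)"
proof -
  have "continuous_on UNIV (age_tail f)"
    using isCont_age_tail[OF assms] by (simp add: continuous_at_imp_continuous_on)
  moreover have "\<bar>age_tail f b\<bar> \<le> (\<integral>a. \<bar>f a\<bar> \<partial>exp_age)" for b
  proof -
    have "\<bar>age_tail f b\<bar> \<le> (\<integral>a. \<bar>indicator {b<..} a * f a\<bar> \<partial>exp_age)"
      unfolding age_tail_def by (rule integral_abs_bound)
    also have "\<dots> \<le> (\<integral>a. \<bar>f a\<bar> \<partial>exp_age)"
      using assms by (intro integral_mono integrable_abs integrable_tempered tempered_mult tempered_indicator)
        (auto split: split_indicator)
    finally show ?thesis .
  qed
  ultimately show ?thesis
    unfolding tempered_def
    by (intro conjI borel_measurable_continuous_onI exI[of _ "\<integral>a. \<bar>f a\<bar> \<partial>exp_age"] allI impI) auto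
qed

section \<open>Weights of finite trees\<close>

lemma DERIV_multiset_weight:
  assumes "\<And>c. c \<in># m \<Longrightarrow> (v c has_real_derivative l c) (at b)"
  shows "((\<lambda>b. multiset_weight (\<lambda>c. v c b) m) has_real_derivative
    multiset_weight_deriv (\<lambda>c. v c b) l m) (at b)"
  using assms
proof (induction m)
  case (add c m)
  have eq: "multiset_weight (\<lambda>c. v c b) (add_mset c m) = v c b * multiset_weight (\<lambda>c. v c b) m / real (Suc (count m c))" for b
    using multiset_weight_add[of m c "\<lambda>c. v c b"] by (simp add: field_simps)
  have "((\<lambda>b. v c b * multiset_weight (\<lambda>c. v c b) m / real (Suc (count m c))) has_real_derivative
      (l c * multiset_weight (\<lambda>c. v c b) m + multiset_weight_deriv (\<lambda>c. v c b) l m * v c b) / real (Suc (count m c))) (at b)"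
    by (intro DERIV_cdivide DERIV_mult add) auto
  also have "(l c * multiset_weight (\<lambda>c. v c b) m + multiset_weight_deriv (\<lambda>c. v c b) l m * v c b) / real (Suc (count m c)) =
      multiset_weight_deriv (\<lambda>c. v c b) l (add_mset c m)"
    using multiset_weight_deriv_add[of m c "\<lambda>c. v c b" l] by (simp add: field_simps)
  finally show ?case unfolding eq .
qed simp

lemma multiset_weight_fundef_cong [fundef_cong]:
  "M = N \<Longrightarrow> (\<And>u. u \<in># N \<Longrightarrow> v u = v' u) \<Longrightarrow> multiset_weight v M = multiset_weight v' N"
  by (auto intro: multiset_weight_cong)

lemma multiset_weight_deriv_cong [fundef_cong]:
  "M = N \<Longrightarrow> (\<And>u. u \<in># N \<Longrightarrow> v u = v' u) \<Longrightarrow> (\<And>u. u \<in># N \<Longrightarrow> l u = l' u) \<Longrightarrow>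
    multiset_weight_deriv v l M = multiset_weight_deriv v' l' N"
  unfolding multiset_weight_deriv_def
  by (auto intro!: sum.cong arg_cong2[where f="(*)"] multiset_weight_cong dest: in_diffD)

text \<open>Each child contributes an edge to the root, and its age is integrated out; the factorials divide by the symmetries
  which permute isomorphic branches. The factor of the root itself is not included.\<close>

fun tree_weight :: "rtree \<Rightarrow> real \<Rightarrow> real" where
  "tree_weight (Node M) = (\<lambda>b. multiset_weight (\<lambda>c. edge_op (tree_weight c) b) M)"

definition total_weight :: "rtree \<Rightarrow> real" where
  "total_weight t = (\<integral>a. tree_weight t a \<partial>exp_age)"

text \<open>The sum over the edges of the tree of the weight of the part containing the root times the total weight of
  the other part. Equivalently, the rate at which the tree arises when independent clusters are grafted onto the vertices of
  a cluster which contains a vertex of age \<open>b\<close>, taken as the root.\<close>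

fun graft_rate :: "rtree \<Rightarrow> real \<Rightarrow> real" where
  "graft_rate (Node M) = (\<lambda>b. multiset_weight_deriv (\<lambda>c. edge_op (tree_weight c) b)
     (\<lambda>c. total_weight c + edge_op (graft_rate c) b) M)"

declare tree_weight.simps [simp del] graft_rate.simps [simp del]

lemma tempered_tree_weight [tempered_intros]: "tempered (tree_weight t)"
proof (induction t rule: tree_weight.induct)
  case (1 M)
  then show ?case
    unfolding tree_weight.simps by (intro tempered_multiset_weight tempered_edge_op)
qed

lemma tempered_graft_rate [tempered_intros]: "tempered (graft_rate t)"
proof (induction t rule: tree_weight.induct)
  case (1 M)
  then show ?case
    unfolding graft_rate.simps
    by (intro tempered_multiset_weight_deriv tempered_add tempered_const tempered_edge_op tempered_tree_weight)
qed

lemma tree_weight_nonneg: "0 \<le> b \<Longrightarrow> 0 \<le> tree_weight t b"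
proof (induction t arbitrary: b rule: tree_weight.induct)
  case (1 M)
  then show ?case
    unfolding tree_weight.simps by (intro multiset_weight_nonneg edge_op_nonneg) auto
qed

definition tree_weight_deriv :: "rtree \<Rightarrow> real \<Rightarrow> real" where
  "tree_weight_deriv t b = multiset_weight_deriv (\<lambda>c. edge_op (tree_weight c) b)
     (\<lambda>c. age_tail (tree_weight c) b) (subtrees t)"

lemma DERIV_tree_weight: "(tree_weight t has_real_derivative tree_weight_deriv t b) (at b)"
proof (cases t)
  case (Node M)
  have "((\<lambda>b. multiset_weight (\<lambda>c. edge_op (tree_weight c) b) M) has_real_derivative
      tree_weight_deriv t b) (at b)"
    unfolding tree_weight_deriv_def Node rtree.sel
    by (rule DERIV_multiset_weight) (intro DERIV_edge_op tempered_tree_weight)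
  then show ?thesis unfolding Node tree_weight.simps .
qed

lemma isCont_edge_op: "tempered f \<Longrightarrow> isCont (edge_op f) b"
  by (rule DERIV_isCont[OF DERIV_edge_op])

lemma isCont_tree_weight_deriv: "isCont (tree_weight_deriv t) b"
  unfolding tree_weight_deriv_def multiset_weight_deriv_def multiset_weight_def
  by (intro continuous_intros isCont_edge_op isCont_age_tail tempered_tree_weight) auto

lemma tempered_tree_weight_deriv [tempered_intros]: "tempered (tree_weight_deriv t)"
  unfolding tree_weight_deriv_def
  by (intro tempered_multiset_weight_deriv tempered_edge_op tempered_age_tail tempered_tree_weight)

lemma edge_op_lin: 
  assumes "tempered f" "tempered g"
  shows "edge_op (\<lambda>a. f a - r * g a) b = edge_op f b - r * edge_op g b"
proof -
  have "edge_op (\<lambda>a. f a - r * g a) b = (\<integral>a. min b a * f a - r * (min b a * g a) \<partial>exp_age)"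
    unfolding edge_op_def by (simp add: algebra_simps)
  also have "\<dots> = edge_op f b - r * edge_op g b"
    unfolding edge_op_def
    by (subst Bochner_Integration.integral_diff)
      (use assms in \<open>auto intro!: integrable_tempered tempered_mult tempered_min tempered_const\<close>)
  finally show ?thesis .
qed

lemma multiset_weight_deriv_size:
  "multiset_weight_deriv v (\<lambda>c. g c * v c) M = sum_mset (image_mset g M) * multiset_weight v M"
proof (induction M)
  case (add c M)
  have "real (Suc (count M c)) * multiset_weight_deriv v (\<lambda>c. g c * v c) (add_mset c M) =
      sum_mset (image_mset g (add_mset c M)) * (v c * multiset_weight v M)"
    unfolding multiset_weight_deriv_add add by (simp add: algebra_simps)
  also have "v c * multiset_weight v M = real (Suc (count M c)) * multiset_weight v (add_mset c M)"
    by (rule multiset_weight_add[symmetric])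
  finally show ?case by (simp del: of_nat_Suc)
qed simp

text \<open>Shift all ages simultaneously. Each vertex other than the root brings its factor \<open>exp (- a)\<close>, hence a
  factor \<open>-1\<close>, and each edge is deleted in turn. The induction follows the branches, where \<open>edge_op_derivative\<close> carries
  out the shift of the age of the child.\<close>

lemma tree_weight_deriv_eq:
  "0 \<le> b \<Longrightarrow> tree_weight_deriv t b = graft_rate t b - (real (num_vertices t) - 1) * tree_weight t b"
proof (induction t arbitrary: b rule: tree_weight.induct)
  case (1 M)
  let ?V = "\<lambda>c. edge_op (tree_weight c) b"
  have T: "age_tail (tree_weight c) b = (total_weight c + edge_op (graft_rate c) b) - real (num_vertices c) * ?V c"
    if c: "c \<in># M" for c
  proof -
    have "age_tail (tree_weight c) b - total_weight c = edge_op (\<lambda>a. tree_weight_deriv c a - tree_weight c a) b"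
      unfolding total_weight_def
      by (rule edge_op_derivative[symmetric, OF 1(2)]) (intro tempered_intros isCont_tree_weight_deriv DERIV_tree_weight)+
    also have "\<dots> = edge_op (\<lambda>a. graft_rate c a - real (num_vertices c) * tree_weight c a) b"
      by (rule edge_op_cong) (use 1(1)[OF c] in \<open>auto simp: algebra_simps intro!: tempered_diff tempered_mult tempered_const tempered_intros\<close>)
    also have "\<dots> = edge_op (graft_rate c) b - real (num_vertices c) * ?V c"
      by (intro edge_op_lin tempered_intros)
    finally show ?thesis by simp
  qed
  have "tree_weight_deriv (Node M) b =
      multiset_weight_deriv ?V (\<lambda>c. (total_weight c + edge_op (graft_rate c) b) - real (num_vertices c) * ?V c) M"
    unfolding tree_weight_deriv_def rtree.sel by (rule multiset_weight_deriv_cong) (auto simp: T)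
  also have "\<dots> = graft_rate (Node M) b - multiset_weight_deriv ?V (\<lambda>c. real (num_vertices c) * ?V c) M"
    unfolding graft_rate.simps multiset_weight_deriv_def by (simp add: algebra_simps sum_subtractf)
  also have "multiset_weight_deriv ?V (\<lambda>c. real (num_vertices c) * ?V c) M = real (forest_size M) * tree_weight (Node M) b"
    by (simp add: multiset_weight_deriv_size tree_weight.simps of_nat_sum_mset multiset.map_comp comp_def)
  finally show ?case by simp
qed

lemma tree_weight_0: "tree_weight t 0 = (if t = Node {#} then 1 else 0)"
proof (cases t)
  case (Node M)
  have "multiset_weight (\<lambda>c. 0) M = (if M = {#} then 1 else 0)"
    by (auto simp: multiset_weight_def)
  then show ?thesis by (simp add: Node tree_weight.simps edge_op_0)
qed

text \<open>The shift of the ages integrated over the age of the root; the boundary term at age \<open>0\<close> survives only for a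
  single vertex, since every edge at the root contributes the factor \<open>min 0 a = 0\<close>.\<close>

lemma total_weight_size:
  "real (num_vertices t) * total_weight t = (if t = Node {#} then 1/2 else 0) + (\<integral>a. graft_rate t a \<partial>exp_age)"
proof -
  have "age_tail (\<lambda>a. tree_weight t a - tree_weight_deriv t a) 0 = exp (- 0) / 2 * tree_weight t 0"
    by (rule age_tail_derivative) (intro order_refl tempered_intros isCont_tree_weight_deriv DERIV_tree_weight)+
  moreover have "age_tail (\<lambda>a. tree_weight t a - tree_weight_deriv t a) 0 =
      (\<integral>a. tree_weight t a - tree_weight_deriv t a \<partial>exp_age)"
    unfolding age_tail_def
  proof (rule integral_cong_AE)
    show "AE a in exp_age. indicator {0<..} a * (tree_weight t a - tree_weight_deriv t a) = tree_weight t a - tree_weight_deriv t a"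
      using AE_exp_age_pos by eventually_elim simp
  qed (intro borel_measurable_integrable integrable_tempered tempered_mult tempered_indicator tempered_diff
      tempered_tree_weight tempered_tree_weight_deriv)+
  moreover have "(\<integral>a. tree_weight t a - tree_weight_deriv t a \<partial>exp_age) =
      (\<integral>a. real (num_vertices t) * tree_weight t a - graft_rate t a \<partial>exp_age)"
    by (rule tempered_integral_cong)
      (auto simp: tree_weight_deriv_eq algebra_simps intro!: tempered_diff tempered_mult tempered_const tempered_tree_weight tempered_tree_weight_deriv tempered_graft_rate)
  moreover have "\<dots> = real (num_vertices t) * total_weight t - (\<integral>a. graft_rate t a \<partial>exp_age)"
    unfolding total_weight_def
    by (subst Bochner_Integration.integral_diff)
      (auto intro!: integrable_tempered tempered_mult tempered_const tempered_tree_weight tempered_graft_rate)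
  ultimately have "real (num_vertices t) * total_weight t - (\<integral>a. graft_rate t a \<partial>exp_age) = exp (- 0) / 2 * tree_weight t 0"
    by (simp only:)
  then show ?thesis unfolding tree_weight_0 by (cases "t = Node {#}") simp_all
qed

section \<open>The law of the steady state cluster\<close>

lemma tempered_abs: "tempered f \<Longrightarrow> tempered (\<lambda>a. \<bar>f a\<bar>)"
  by (auto simp: tempered_def)

text \<open>Reversibility of the edge factor. This is what makes the weights insensitive to the choice of the root.\<close>

lemma edge_op_symmetric:
  assumes f: "tempered f" and g: "tempered g"
  shows "(\<integral>b. edge_op f b * g b \<partial>exp_age) = (\<integral>b. f b * edge_op g b \<partial>exp_age)"
proof -
  interpret E: pair_sigma_finite exp_age exp_age ..
  note [measurable] = tempered_measurable[OF f] tempered_measurable[OF g]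
  let ?k = "\<lambda>(b, a). min b a * f a * g b"
  have af: "tempered (\<lambda>a. \<bar>f a\<bar>)" and ag: "tempered (\<lambda>a. \<bar>g a\<bar>)"
    by (intro tempered_abs f g)+
  have [measurable]: "edge_op (\<lambda>a. \<bar>f a\<bar>) \<in> borel_measurable borel"
    by (intro tempered_measurable tempered_edge_op af)
  have int: "integrable (exp_age \<Otimes>\<^sub>M exp_age) ?k"
  proof (rule E.Fubini_integrable)
    show "?k \<in> borel_measurable (exp_age \<Otimes>\<^sub>M exp_age)" by measurable
    have "AE b in exp_age. edge_op (\<lambda>a. \<bar>f a\<bar>) b * \<bar>g b\<bar> = (\<integral>a. norm (?k (b, a)) \<partial>exp_age)"
      using AE_exp_age_nonneg
    proof eventually_elim
      case (elim b)
      have "(\<integral>a. norm (min b a * f a * g b) \<partial>exp_age) = (\<integral>a. min b a * \<bar>f a\<bar> * \<bar>g b\<bar> \<partial>exp_age)"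
        by (rule tempered_integral_cong)
          (use elim in \<open>auto simp: abs_mult intro!: tempered_mult tempered_abs tempered_min af f tempered_const\<close>)
      then show ?case by (simp add: edge_op_def)
    qed
    moreover have "integrable exp_age (\<lambda>b. edge_op (\<lambda>a. \<bar>f a\<bar>) b * \<bar>g b\<bar>)"
      by (intro integrable_tempered tempered_mult tempered_edge_op af ag)
    ultimately show "integrable exp_age (\<lambda>b. \<integral>a. norm (?k (b, a)) \<partial>exp_age)"
      by (subst integrable_cong_AE[where g="\<lambda>b. edge_op (\<lambda>a. \<bar>f a\<bar>) b * \<bar>g b\<bar>"]) auto
    show "AE b in exp_age. integrable exp_age (\<lambda>a. ?k (b, a))"
      by (intro AE_I2) (auto intro!: integrable_tempered tempered_mult tempered_min f tempered_const)
  qed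
  have "(\<integral>b. edge_op f b * g b \<partial>exp_age) = (\<integral>b. \<integral>a. min b a * f a * g b \<partial>exp_age \<partial>exp_age)"
    by (simp add: edge_op_def)
  also have "\<dots> = (\<integral>a. \<integral>b. min b a * f a * g b \<partial>exp_age \<partial>exp_age)"
    using E.Fubini_integral[of "\<lambda>b a. min b a * f a * g b"] int by simp
  also have "\<dots> = (\<integral>a. f a * edge_op g a \<partial>exp_age)"
    by (simp add: edge_op_def min.commute mult_ac flip: integral_mult_right_zero)
  finally show ?thesis .
qed

lemma sum_mset_image_eq_sum: "(\<Sum>\<^sub># (image_mset f M) :: nat) = (\<Sum>x\<in>set_mset M. count M x * f x)"
proof (induction M)
  case (add x M)
  have "(\<Sum>y\<in>set_mset (add_mset x M). count (add_mset x M) y * f y) =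
      (\<Sum>y\<in>insert x (set_mset M). count M y * f y) + (\<Sum>y\<in>insert x (set_mset M). if y = x then f x else 0)"
    unfolding sum.distrib[symmetric] by (auto intro!: sum.cong)
  also have "(\<Sum>y\<in>insert x (set_mset M). count M y * f y) = (\<Sum>y\<in>set_mset M. count M y * f y)"
    by (rule sum.mono_neutral_right) (auto simp: not_in_iff)
  finally show ?case using add by simp
qed simp

lemma count_sum_mset_image: "count (\<Sum>\<^sub># (image_mset f M)) x = \<Sum>\<^sub># (image_mset (\<lambda>y. count (f y) x) M)"
  by (induction M) auto

lemma count_rerootings_below:
  "real (count (rerootings_below {#c#} (Node M)) t) = (if Node (add_mset c M) = t then 1 else 0) +
     (\<Sum>d\<in>set_mset M. real (count M d) * real (count (rerootings_below {#Node (add_mset c (M - {#d#}))#} d) t))"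
  by (simp add: count_sum_mset_image sum_mset_image_eq_sum)

lemma count_rerootings_below_eq_0:
  "num_vertices t \<noteq> num_vertices s + num_vertices c \<Longrightarrow> count (rerootings_below {#c#} s) t = 0"
  using num_vertices_rerootings_below[of t "{#c#}" s] by (metis add.right_neutral image_mset_single image_mset_empty image_mset_add_mset sum_mset.add_mset sum_mset.empty not_in_iff)

abbreviation small_trees :: "nat \<Rightarrow> rtree set" where
  "small_trees n \<equiv> {t. num_vertices t \<le> n}"

text \<open>Trees \<open>s\<close> with root age \<open>a\<close> and with the branch \<open>c\<close> attached to their root, weighted also with the number of
  vertices of \<open>s\<close> such that moving the root there yields \<open>t\<close>. As \<open>num_vertices s \<le> num_vertices t\<close> is automatic, the sum is finite.\<close>

definition reroot_weight :: "rtree \<Rightarrow> rtree \<Rightarrow> real \<Rightarrow> real" where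
  "reroot_weight t c a = (\<Sum>s\<in>small_trees (num_vertices t). real (count (rerootings_below {#c#} s) t) * tree_weight s a)"

lemma tempered_reroot_weight [tempered_intros]: "tempered (reroot_weight t c)"
  unfolding reroot_weight_def by (intro tempered_sum tempered_mult tempered_const tempered_tree_weight)

lemma edge_op_sum:
  assumes "\<And>i. i \<in> I \<Longrightarrow> tempered (f i)"
  shows "edge_op (\<lambda>a. \<Sum>i\<in>I. c i * f i a) b = (\<Sum>i\<in>I. c i * edge_op (f i) b)"
proof -
  have "edge_op (\<lambda>a. \<Sum>i\<in>I. c i * f i a) b = (\<integral>a. (\<Sum>i\<in>I. c i * (min b a * f i a)) \<partial>exp_age)"
    unfolding edge_op_def by (simp add: sum_distrib_left mult_ac)
  also have "\<dots> = (\<Sum>i\<in>I. c i * edge_op (f i) b)"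
    unfolding edge_op_def
    by (subst Bochner_Integration.integral_sum)
      (auto intro!: integrable_tempered tempered_mult tempered_min tempered_const assms)
  finally show ?thesis .
qed

lemma sum_small_trees: "(\<Sum>s\<in>small_trees n. f s) = (\<Sum>M | forest_size M < n. f (Node M))"
  by (rule sum.reindex_bij_witness[of _ Node subtrees]) (auto simp: Suc_le_eq elim!: rtree.exhaust_sel, metis num_vertices.simps rtree.collapse Suc_le_eq)

lemma finite_small_forests: "finite {M. forest_size M < n}"
  by (rule finite_subset[OF _ finite_forests_bounded_size[of n]]) auto

lemma reroot_weight_large: "num_vertices t \<le> num_vertices c \<Longrightarrow> reroot_weight t c = (\<lambda>a. 0)"
  unfolding reroot_weight_def
proof (rule ext, rule sum.neutral, rule ballI)
  fix a s assume "num_vertices t \<le> num_vertices c"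
  then have "num_vertices t \<noteq> num_vertices s + num_vertices c" using num_vertices_pos[of s] by linarith
  then show "real (count (rerootings_below {#c#} s) t) * tree_weight s a = 0"
    by (simp add: count_rerootings_below_eq_0)
qed

text \<open>Replaces a sum over forests with a marked tree by a double sum over a rectangle, on which the order
  of summation can be exchanged; all additional terms vanish for reasons of size.\<close>

lemma sum_pairs_bounded:
  assumes "\<And>N d. num_vertices d + forest_size N \<ge> n \<Longrightarrow> f N d = (0::real)"
  shows "(\<Sum>(N, d) | add_mset d N \<in> {M. forest_size M < n}. f N d) =
    (\<Sum>N | forest_size N < n. \<Sum>d\<in>small_trees n. f N d)"
proof -
  have "(\<Sum>N | forest_size N < n. \<Sum>d\<in>small_trees n. f N d) =
      (\<Sum>(N, d)\<in>{N. forest_size N < n} \<times> small_trees n. f N d)"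
    by (simp add: sum.cartesian_product)
  also have "\<dots> = (\<Sum>(N, d) | add_mset d N \<in> {M. forest_size M < n}. f N d)"
  proof (rule sum.mono_neutral_right)
    show "finite ({N. forest_size N < n} \<times> small_trees n)"
      using finite_small_forests finite_trees_bounded_size by blast
    show "{(N, d). add_mset d N \<in> {M. forest_size M < n}} \<subseteq> {N. forest_size N < n} \<times> small_trees n"
      by auto
    show "\<forall>i\<in>({N. forest_size N < n} \<times> small_trees n) - {(N, d). add_mset d N \<in> {M. forest_size M < n}}.
        (case i of (N, d) \<Rightarrow> f N d) = 0"
      by (auto simp: not_less intro!: assms)
  qed
  finally show ?thesis ..
qed

text \<open>Decompose according to the first step of the path from the old root to the new one: either the old root stays the
  root, or the path enters a branch \<open>d\<close> and everything outside \<open>d\<close> becomes a branch at the root of \<open>d\<close>.\<close>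

lemma reroot_weight_backward:
  "reroot_weight t c a = (\<Sum>M | forest_size M < num_vertices t. tree_weight (Node M) a *
     ((if Node (add_mset c M) = t then 1 else 0) + edge_op (reroot_weight t (Node (add_mset c M))) a))"
proof -
  let ?n = "num_vertices t"
  let ?V = "\<lambda>d. edge_op (tree_weight d) a"
  let ?c = "\<lambda>N d. real (count (rerootings_below {#Node (add_mset c N)#} d) t)"
  let ?I = "\<lambda>M. if Node (add_mset c M) = t then 1 else (0::real)"
  have "reroot_weight t c a = (\<Sum>M | forest_size M < ?n. tree_weight (Node M) a * ?I M +
      tree_weight (Node M) a * (\<Sum>d\<in>set_mset M. real (count M d) * ?c (M - {#d#}) d))"
    unfolding reroot_weight_def sum_small_trees count_rerootings_below by (simp add: algebra_simps)
  also have "\<dots> = (\<Sum>M | forest_size M < ?n. tree_weight (Node M) a * ?I M) +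
      (\<Sum>M | forest_size M < ?n. multiset_weight ?V M * (\<Sum>d\<in>set_mset M. real (count M d) * ?c (M - {#d#}) d))"
    by (simp add: sum.distrib tree_weight.simps)
  also have "(\<Sum>M | forest_size M < ?n. multiset_weight ?V M * (\<Sum>d\<in>set_mset M. real (count M d) * ?c (M - {#d#}) d)) =
     (\<Sum>(N, d) | add_mset d N \<in> {M. forest_size M < ?n}. multiset_weight ?V N * (?V d * ?c N d))"
    by (rule sum_multiset_weight_element[OF finite_small_forests])
  also have "\<dots> = (\<Sum>N | forest_size N < ?n. \<Sum>d\<in>small_trees ?n. multiset_weight ?V N * (?V d * ?c N d))"
    by (rule sum_pairs_bounded) (simp add: count_rerootings_below_eq_0)
  also have "\<dots> = (\<Sum>N | forest_size N < ?n. tree_weight (Node N) a * edge_op (reroot_weight t (Node (add_mset c N))) a)"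
  proof -
    have "(\<Sum>d\<in>small_trees ?n. multiset_weight ?V N * (?V d * ?c N d)) =
        tree_weight (Node N) a * edge_op (reroot_weight t (Node (add_mset c N))) a" for N
      unfolding reroot_weight_def by (subst edge_op_sum, rule tempered_tree_weight) (simp add: sum_distrib_left tree_weight.simps mult_ac)
    then show ?thesis by simp
  qed
  finally show ?thesis by (simp add: sum.distrib[symmetric] distrib_left)
qed

text \<open>Decompose according to the branch at the root which contains the grafted cluster, or is the grafted cluster itself.
  In terms of the operator that attaches the tree \<open>c\<close> to a random root this equation is the adjoint of
  \<open>reroot_weight_backward\<close>.\<close>

lemma graft_rate_forward:
  fixes Z :: "rtree \<Rightarrow> real"
  assumes Z: "\<And>t. n < num_vertices t \<Longrightarrow> Z t = 0"
  shows "(\<Sum>t\<in>small_trees n. Z t * graft_rate t b) =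
    (\<Sum>c\<in>small_trees n. (total_weight c + edge_op (graft_rate c) b) *
       (\<Sum>M | forest_size M < n. tree_weight (Node M) b * Z (Node (add_mset c M))))"
proof -
  let ?Y = "\<lambda>c. total_weight c + edge_op (graft_rate c) b"
  let ?f = "\<lambda>N c. ?Y c * (tree_weight (Node N) b * Z (Node (add_mset c N)))"
  have "(\<Sum>t\<in>small_trees n. Z t * graft_rate t b) = (\<Sum>M | forest_size M < n. \<Sum>c\<in>set_mset M. ?f (M - {#c#}) c)"
    unfolding sum_small_trees graft_rate.simps multiset_weight_deriv_def tree_weight.simps
    by (auto simp: sum_distrib_left mult_ac intro!: sum.cong)
  also have "\<dots> = (\<Sum>(N, c) | add_mset c N \<in> {M. forest_size M < n}. ?f N c)"
    by (rule sum_remove_element[OF finite_small_forests])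
  also have "\<dots> = (\<Sum>N | forest_size N < n. \<Sum>c\<in>small_trees n. ?f N c)"
    by (rule sum_pairs_bounded) (simp add: Z)
  also have "\<dots> = (\<Sum>c\<in>small_trees n. \<Sum>N | forest_size N < n. ?f N c)"
    by (rule sum.swap)
  finally show ?thesis by (simp add: sum_distrib_left)
qed

text \<open>Write \<open>S\<close> for the operator which makes a branch part of a larger tree, \<open>K\<close> for \<open>edge_op\<close>, \<open>\<pi>\<close> for the total
  weights and \<open>\<delta>\<close> for the indicator of \<open>t\<close>. Then the graft rate \<open>X\<close> and the rerooting weight \<open>R\<close> satisfy
  \<open>X = S (\<pi> + K X)\<close> and \<open>R = S* (\<delta> + K R)\<close>. Hence
  \<open><X, \<delta>> + <X, K R> = <\<pi> + K X, R> = <\<pi>, R> + <K X, R>\<close>, and the symmetry of \<open>K\<close> leaves \<open><X, \<delta>> = <\<pi>, R>\<close>. In words,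
  grafting at a random vertex and keeping the root is the same as joining at the root and moving it.\<close>

lemma integral_graft_rate:
  "(\<integral>b. graft_rate t b \<partial>exp_age) =
     (\<Sum>c\<in>small_trees (num_vertices t). total_weight c * (\<integral>b. reroot_weight t c b \<partial>exp_age))"
proof -
  let ?T = "small_trees (num_vertices t)"
  have fin: "finite ?T" by (rule finite_trees_bounded_size)
  have "graft_rate t b + (\<Sum>s\<in>?T. edge_op (reroot_weight t s) b * graft_rate s b) =
      (\<Sum>c\<in>?T. total_weight c * reroot_weight t c b) + (\<Sum>c\<in>?T. edge_op (graft_rate c) b * reroot_weight t c b)" for b
  proof -
    \<comment> \<open>The function \<open>\<delta> + K R\<close>; it vanishes on trees larger than \<open>t\<close>.\<close>
    let ?Z = "\<lambda>s. (if s = t then 1 else 0) + edge_op (reroot_weight t s) b"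
    have "?Z s = 0" if "num_vertices t < num_vertices s" for s
      using that by (auto simp: reroot_weight_large edge_op_def)
    from graft_rate_forward[of "num_vertices t" ?Z b, OF this]
    have "(\<Sum>s\<in>?T. ?Z s * graft_rate s b) =
      (\<Sum>c\<in>?T. (total_weight c + edge_op (graft_rate c) b) * reroot_weight t c b)"
      by (simp flip: reroot_weight_backward)
    moreover have "(\<Sum>s\<in>?T. (if s = t then 1 else 0) * graft_rate s b) = graft_rate t b"
      using fin by (simp add: if_distrib if_distribR sum.delta' cong: if_cong)
    ultimately show ?thesis by (simp add: distrib_right sum.distrib)
  qed
  then have "(\<integral>b. graft_rate t b + (\<Sum>s\<in>?T. edge_op (reroot_weight t s) b * graft_rate s b) \<partial>exp_age) =
      (\<integral>b. (\<Sum>c\<in>?T. total_weight c * reroot_weight t c b) + (\<Sum>c\<in>?T. edge_op (graft_rate c) b * reroot_weight t c b) \<partial>exp_age)"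
    by simp
  also have "\<dots> = (\<Sum>c\<in>?T. total_weight c * (\<integral>b. reroot_weight t c b \<partial>exp_age)) +
      (\<Sum>c\<in>?T. \<integral>b. edge_op (graft_rate c) b * reroot_weight t c b \<partial>exp_age)"
    by (subst Bochner_Integration.integral_add;
        (subst Bochner_Integration.integral_sum)?; (subst Bochner_Integration.integral_sum)?;
        (intro integrable_tempered tempered_sum tempered_mult tempered_const tempered_edge_op tempered_reroot_weight tempered_graft_rate)?) simp
  also have "(\<integral>b. graft_rate t b + (\<Sum>s\<in>?T. edge_op (reroot_weight t s) b * graft_rate s b) \<partial>exp_age) =
      (\<integral>b. graft_rate t b \<partial>exp_age) + (\<Sum>s\<in>?T. \<integral>b. edge_op (reroot_weight t s) b * graft_rate s b \<partial>exp_age)"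
    by (subst Bochner_Integration.integral_add;
        (subst Bochner_Integration.integral_sum)?; (subst Bochner_Integration.integral_sum)?;
        (intro integrable_tempered tempered_sum tempered_mult tempered_const tempered_edge_op tempered_reroot_weight tempered_graft_rate)?) simp
  also have "(\<Sum>s\<in>?T. \<integral>b. edge_op (reroot_weight t s) b * graft_rate s b \<partial>exp_age) =
      (\<Sum>c\<in>?T. \<integral>b. edge_op (graft_rate c) b * reroot_weight t c b \<partial>exp_age)"
    by (intro sum.cong refl, subst edge_op_symmetric) (auto intro: tempered_reroot_weight tempered_graft_rate simp: mult.commute)
  finally show ?thesis by simp
qed

lemma integral_graft_rate_eq_sum:
  "(\<integral>b. graft_rate t b \<partial>exp_age) =
     (\<Sum>c\<in>small_trees (num_vertices t). \<Sum>s\<in>small_trees (num_vertices t).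
        total_weight c * total_weight s * real (count (rerootings_below {#c#} s) t))"
  unfolding integral_graft_rate reroot_weight_def total_weight_def
  by (intro sum.cong refl, subst Bochner_Integration.integral_sum)
    (auto intro!: integrable_tempered tempered_mult tempered_const tempered_tree_weight simp: sum_distrib_left mult_ac)

text \<open>The new root lies in one of the two trees, and seen from it the other tree is a branch at the old root.\<close>

lemma rerootings_join_roots:
  "rerootings (join_roots s t) = rerootings_below {#t#} s + rerootings_below {#s#} t"
proof -
  obtain M where s: "s = Node M" by (cases s)
  have "image_mset (\<lambda>c. rerootings_below {#Node (add_mset t M - {#c#})#} c) M =
      image_mset (\<lambda>c. rerootings_below {#Node (add_mset t (M - {#c#}))#} c) M"
    by (rule image_mset_cong) simp
  then show ?thesis by (simp add: rerootings_def s)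
qed

text \<open>The steady state equation at one tree, after multiplication by the number of its vertices. The two summands of
  \<open>rerootings_join_roots\<close> have the same expectation, which cancels the probability \<open>1/2\<close>.\<close>

lemma pmf_steady_state_cluster_recursion:
  "real (num_vertices t) * pmf steady_state_cluster t = (if t = Node {#} then 1/2 else 0) +
    (\<Sum>u\<in>small_trees (num_vertices t). \<Sum>s\<in>small_trees (num_vertices t).
       pmf steady_state_cluster u * pmf steady_state_cluster s * real (count (rerootings_below {#u#} s) t))"
proof -
  let ?C = steady_state_cluster and ?n = "num_vertices t" and ?T = "small_trees (num_vertices t)"
  have fin: "finite ?T" by (rule finite_trees_bounded_size)
  let ?r = "\<lambda>s u. real (count (rerootings (join_roots s u)) t)"
  have pr: "pmf (random_rerooting (join_roots s u)) t = ?r s u / ?n" for s u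
  proof -
    have ne: "rerootings (join_roots s u) \<noteq> {#}"
      using size_rerootings[of "join_roots s u"] num_vertices_pos[of "join_roots s u"] by auto
    have "?r s u = 0" if "num_vertices s + num_vertices u \<noteq> ?n"
      using that count_rerootings_below_eq_0[of t s u] count_rerootings_below_eq_0[of t u s]
      by (auto simp: rerootings_join_roots)
    then show ?thesis
      by (cases "num_vertices s + num_vertices u = ?n")
        (simp_all add: random_rerooting_def pmf_of_multiset[OF ne] size_rerootings num_vertices_join_roots)
  qed
  have supp: "s \<in> ?T \<and> u \<in> ?T" if "?r s u \<noteq> 0" for s u
  proof -
    have "num_vertices s + num_vertices u = ?n"
      using that count_rerootings_below_eq_0[of t s u] count_rerootings_below_eq_0[of t u s]
      by (auto simp: rerootings_join_roots intro: ccontr)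
    then show ?thesis by auto
  qed
  have "pmf (bind_pmf ?C (\<lambda>s. bind_pmf ?C (\<lambda>u. random_rerooting (join_roots s u)))) t =
      measure_pmf.expectation ?C (\<lambda>s. measure_pmf.expectation ?C (\<lambda>u. ?r s u / ?n))"
    by (simp add: pmf_bind pr)
  also have "(\<lambda>s. measure_pmf.expectation ?C (\<lambda>u. ?r s u / ?n)) = (\<lambda>s. \<Sum>u\<in>?T. ?r s u / ?n * pmf ?C u)"
    by (rule ext, rule integral_measure_pmf_real[OF fin]) (use supp in auto)
  also have "measure_pmf.expectation ?C (\<lambda>s. \<Sum>u\<in>?T. ?r s u / ?n * pmf ?C u) =
      (\<Sum>s\<in>?T. (\<Sum>u\<in>?T. ?r s u / ?n * pmf ?C u) * pmf ?C s)"
  proof (rule integral_measure_pmf_real[OF fin])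
    fix s assume "(\<Sum>u\<in>?T. ?r s u / ?n * pmf ?C u) \<noteq> 0"
    then obtain u where "?r s u / ?n * pmf ?C u \<noteq> 0" by (meson sum.neutral)
    then show "s \<in> ?T" using supp[of s u] by auto
  qed
  finally have B: "pmf (bind_pmf ?C (\<lambda>s. bind_pmf ?C (\<lambda>u. random_rerooting (join_roots s u)))) t =
      (\<Sum>s\<in>?T. \<Sum>u\<in>?T. pmf ?C s * pmf ?C u * ?r s u) / ?n"
    unfolding sum_divide_distrib sum_distrib_right by (simp add: mult_ac)
  have sym: "(\<Sum>s\<in>?T. \<Sum>u\<in>?T. pmf ?C s * pmf ?C u * ?r s u) =
      2 * (\<Sum>u\<in>?T. \<Sum>s\<in>?T. pmf ?C u * pmf ?C s * real (count (rerootings_below {#u#} s) t))"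
  proof -
    have "(\<Sum>s\<in>?T. \<Sum>u\<in>?T. pmf ?C s * pmf ?C u * ?r s u) =
      (\<Sum>s\<in>?T. \<Sum>u\<in>?T. pmf ?C s * pmf ?C u * real (count (rerootings_below {#u#} s) t)) +
      (\<Sum>s\<in>?T. \<Sum>u\<in>?T. pmf ?C s * pmf ?C u * real (count (rerootings_below {#s#} u) t))"
      by (simp add: rerootings_join_roots sum.distrib algebra_simps)
    also have "(\<Sum>s\<in>?T. \<Sum>u\<in>?T. pmf ?C s * pmf ?C u * real (count (rerootings_below {#u#} s) t)) =
        (\<Sum>u\<in>?T. \<Sum>s\<in>?T. pmf ?C u * pmf ?C s * real (count (rerootings_below {#u#} s) t))"
      by (subst sum.swap) (simp add: mult.commute)
    finally show ?thesis by simp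
  qed
  have "pmf ?C t = 1/2 * indicator {Node {#}} t +
      1/2 * pmf (bind_pmf ?C (\<lambda>s. bind_pmf ?C (\<lambda>u. random_rerooting (join_roots s u)))) t"
    by (subst (1) steady_state_equation_cluster[unfolded steady_state_equation_def])
      (simp add: pmf_bind[of "bernoulli_pmf (1/2)"] integral_bernoulli_pmf indicator_def)
  then show ?thesis
    unfolding B sym using num_vertices_pos[of t] by (auto simp: field_simps)
qed

text \<open>Both sides satisfy the same recursion, in which only smaller trees occur on the right.\<close>

lemma pmf_steady_state_cluster: "pmf steady_state_cluster t = total_weight t"
proof (induction "num_vertices t" arbitrary: t rule: less_induct)
  case less
  let ?T = "small_trees (num_vertices t)"
  have "pmf steady_state_cluster u * pmf steady_state_cluster s * real (count (rerootings_below {#u#} s) t) =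
      total_weight u * total_weight s * real (count (rerootings_below {#u#} s) t)" for u s
  proof (cases "num_vertices t = num_vertices s + num_vertices u")
    case True
    then show ?thesis using less[of u] less[of s] num_vertices_pos[of s] num_vertices_pos[of u] by simp
  qed (simp add: count_rerootings_below_eq_0)
  then have "real (num_vertices t) * pmf steady_state_cluster t = real (num_vertices t) * total_weight t"
    unfolding pmf_steady_state_cluster_recursion total_weight_size integral_graft_rate_eq_sum by (simp only:)
  then show ?case using num_vertices_pos[of t] by simp
qed

section \<open>The size of the cluster\<close>

definition size_pmf :: "nat pmf" where
  "size_pmf = map_pmf num_vertices steady_state_cluster"

abbreviation size_prob :: "nat \<Rightarrow> real" where
  "size_prob \<equiv> pmf size_pmf"

lemma size_prob_eq_sum: "size_prob k = (\<Sum>t | num_vertices t = k. pmf steady_state_cluster t)"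
proof -
  have "finite {t. num_vertices t = k}"
    by (rule finite_subset[OF _ finite_trees_bounded_size[of k]]) auto
  then show ?thesis
    by (simp add: size_pmf_def pmf_map vimage_def measure_measure_pmf_finite)
qed

lemma map_num_vertices_random_rerooting:
  "map_pmf num_vertices (random_rerooting t) = return_pmf (num_vertices t)"
proof -
  have "rerootings t \<noteq> {#}" using size_rerootings[of t] num_vertices_pos[of t] by auto
  then have "map_pmf num_vertices (random_rerooting t) = map_pmf (\<lambda>_. num_vertices t) (random_rerooting t)"
    unfolding random_rerooting_def
    by (intro map_pmf_cong refl) (auto simp: rerootings_def dest!: num_vertices_rerootings_below)
  then show ?thesis by (simp add: map_pmf_const)
qed

lemma size_pmf_equation:
  "size_pmf = bind_pmf (bernoulli_pmf (1/2)) (\<lambda>b. if b then return_pmf 1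
     else bind_pmf size_pmf (\<lambda>i. bind_pmf size_pmf (\<lambda>j. return_pmf (i + j))))"
proof -
  have "size_pmf = map_pmf num_vertices (bind_pmf (bernoulli_pmf (1/2)) (\<lambda>b. if b then return_pmf (Node {#})
       else bind_pmf steady_state_cluster (\<lambda>s. bind_pmf steady_state_cluster (\<lambda>t. random_rerooting (join_roots s t)))))"
    unfolding size_pmf_def
    by (rule arg_cong[OF steady_state_equation_cluster[unfolded steady_state_equation_def]])
  also have "\<dots> = bind_pmf (bernoulli_pmf (1/2)) (\<lambda>b. if b then return_pmf 1
     else bind_pmf size_pmf (\<lambda>i. bind_pmf size_pmf (\<lambda>j. return_pmf (i + j))))"
    unfolding size_pmf_def map_bind_pmf bind_map_pmf
    by (intro bind_pmf_cong refl)
      (simp add: map_bind_pmf map_num_vertices_random_rerooting num_vertices_join_roots)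
  finally show ?thesis .
qed

lemma size_prob_convolution:
  "size_prob k = (if k = 1 then 1/2 else 0) + 1/2 * (\<Sum>i\<le>k. size_prob i * size_prob (k - i))"
proof -
  have "pmf (bind_pmf size_pmf (\<lambda>i. bind_pmf size_pmf (\<lambda>j. return_pmf (i + j)))) k =
      measure_pmf.expectation size_pmf (\<lambda>i. measure_pmf.expectation size_pmf (\<lambda>j. indicator {k} (i + j)))"
    by (simp add: pmf_bind)
  also have "(\<lambda>i. measure_pmf.expectation size_pmf (\<lambda>j. indicator {k} (i + j) :: real)) =
      (\<lambda>i. \<Sum>j\<le>k. indicator {k} (i + j) * size_prob j)"
    by (rule ext, rule integral_measure_pmf_real) (auto split: split_indicator_asm)
  also have "measure_pmf.expectation size_pmf \<dots> = (\<Sum>i\<le>k. (\<Sum>j\<le>k. indicator {k} (i + j) * size_prob j) * size_prob i)"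
  proof (rule integral_measure_pmf_real)
    fix i assume ne: "(\<Sum>j\<le>k. indicator {k} (i + j) * size_prob j) \<noteq> 0"
    show "i \<in> {..k}"
    proof (rule ccontr)
      assume "i \<notin> {..k}"
      then have "(\<Sum>j\<le>k. indicator {k} (i + j) * size_prob j) = 0" by (intro sum.neutral) auto
      with ne show False by simp
    qed
  qed simp
  also have "\<dots> = (\<Sum>i\<le>k. size_prob i * size_prob (k - i))"
  proof (rule sum.cong[OF refl])
    fix i assume i: "i \<in> {..k}"
    have "(\<Sum>j\<le>k. indicator {k} (i + j) * size_prob j) = (\<Sum>j\<in>{k - i}. size_prob j)"
      using i by (intro sum.mono_neutral_cong_right) (auto simp: indicator_def)
    then show "(\<Sum>j\<le>k. indicator {k} (i + j) * size_prob j) * size_prob i = size_prob i * size_prob (k - i)" by simp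
  qed
  finally show ?thesis
    by (subst size_pmf_equation) (simp add: pmf_bind[of "bernoulli_pmf (1/2)"] indicator_def)
qed

definition size_fps :: "real fps" where
  "size_fps = Abs_fps size_prob"

lemma size_prob_0: "size_prob 0 = 0"
proof -
  have "{t. num_vertices t = 0} = {}" using num_vertices_pos by (metis (mono_tags, lifting) empty_Collect_eq less_irrefl)
  then show ?thesis by (simp only: size_prob_eq_sum sum.empty)
qed

lemma size_fps_0: "fps_nth size_fps 0 = 0"
  by (simp add: size_fps_def size_prob_0)

text \<open>Equivalently \<open>(1 - F)\<^sup>2 = 1 - z\<close>, where \<open>F\<close> is the generating function of the size.\<close>

lemma size_fps_square: "size_fps * size_fps = 2 * size_fps - fps_X"
proof (rule fps_ext)
  fix k
  have "(\<Sum>i=0..k. size_prob i * size_prob (k - i)) = 2 * size_prob k - (if k = 1 then 1 else 0)"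
    by (subst (3) size_prob_convolution) (auto simp: atLeast0AtMost)
  then show "fps_nth (size_fps * size_fps) k = fps_nth (2 * size_fps - fps_X) k"
    unfolding mult_2[of size_fps] fps_sub_nth fps_add_nth by (simp add: size_fps_def fps_mult_nth fps_X_def)
qed

text \<open>From \<open>(1 - F)\<^sup>2 = 1 - z\<close> follows \<open>2 (1 - z) F' = 1 - F\<close>; compare coefficients. The regularity of the size
  distribution is read off from this recursion, without an explicit formula.\<close>

lemma size_prob_Suc: "k \<ge> 1 \<Longrightarrow> size_prob (Suc k) * (2 * real k + 2) = size_prob k * (2 * real k - 1)"
proof -
  assume k: "k \<ge> 1"
  let ?D = "fps_deriv size_fps"
  have "fps_deriv (size_fps * size_fps) = fps_deriv (2 * size_fps - fps_X)" by (simp only: size_fps_square)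
  then have 1: "2 * (1 - size_fps) * ?D = 1"
    by (simp add: algebra_simps fps_deriv_mult)
  have "(1 - size_fps) * (1 - size_fps) = 1 - 2 * size_fps + size_fps * size_fps" by (simp add: algebra_simps)
  then have 2: "(1 - size_fps) * (1 - size_fps) = 1 - fps_X" unfolding size_fps_square by (simp add: algebra_simps)
  have "2 * (1 - fps_X) * ?D = (1 - size_fps) * (2 * (1 - size_fps) * ?D)"
    unfolding 2[symmetric] by (simp add: mult_ac)
  then have "2 * (?D - fps_X * ?D) = 1 - size_fps" unfolding 1 by (simp add: algebra_simps)
  then have "fps_nth (2 * (?D - fps_X * ?D)) k = fps_nth (1 - size_fps) k" by simp
  then have "2 * (real (k + 1) * size_prob (k + 1) - real k * size_prob k) = - size_prob k"
    using k by (cases k) (auto simp: numeral_fps_const size_fps_def)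
  then show ?thesis by (simp add: algebra_simps)
qed

lemma size_prob_1: "size_prob 1 = 1/2"
  by (subst size_prob_convolution) (simp add: size_prob_0)

lemma size_prob_Suc': "k \<ge> 1 \<Longrightarrow> size_prob (Suc k) = size_prob k * ((2 * real k - 1) / (2 * real k + 2))"
  using size_prob_Suc[of k] by (simp add: field_simps)

lemma size_prob_pos: "k \<ge> 1 \<Longrightarrow> 0 < size_prob k"
proof (induction k rule: dec_induct)
  case (step k)
  then show ?case by (subst size_prob_Suc') (auto intro!: mult_pos_pos divide_pos_pos)
qed (use size_prob_1 in simp)

lemma size_prob_decreasing: "k \<ge> 1 \<Longrightarrow> size_prob (Suc k) \<le> size_prob k"
  unfolding size_prob_Suc' by (intro mult_left_le pmf_nonneg) (simp add: divide_le_eq)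

lemma size_prob_square_increasing:
  assumes "1 \<le> j" "j \<le> k"
  shows "real j ^ 2 * size_prob j \<le> real k ^ 2 * size_prob k"
  using assms(2)
proof (induction k rule: dec_induct)
  case (step k)
  have k: "k \<ge> 1" using step assms(1) by simp
  have "real k ^ 2 * size_prob k \<le> real (Suc k) ^ 2 * size_prob (Suc k)"
  proof -
    \<comment> \<open>The difference of the two sides is \<open>k\<^sup>2 - 1\<close>.\<close>
    have "real k ^ 2 * (2 * real k + 2) \<le> real (Suc k) ^ 2 * (2 * real k - 1)"
    proof -
      have "real (Suc k) ^ 2 * (2 * real k - 1) - real k ^ 2 * (2 * real k + 2) = real k ^ 2 - 1"
        by (simp add: power2_eq_square algebra_simps)
      moreover have "1 \<le> real k ^ 2" using k by simp
      ultimately show ?thesis by linarith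
    qed
    then have "real k ^ 2 \<le> real (Suc k) ^ 2 * ((2 * real k - 1) / (2 * real k + 2))"
      by (simp add: pos_le_divide_eq)
    from mult_right_mono[OF this, of "size_prob k"] show ?thesis
      by (simp only: size_prob_Suc'[OF k] pmf_nonneg mult_ac)
  qed
  then show ?case using step by simp
qed simp

text \<open>The regularity needed for subexponential behaviour. Halving the index costs a bounded factor because \<open>k\<^sup>2 p\<^sub>k\<close> is
  increasing (the true exponent is \<open>3/2\<close>).\<close>

lemma size_prob_half:
  assumes "1 \<le> k" "k \<le> 2 * j" "j \<le> k" shows "size_prob j \<le> 4 * size_prob k"
proof -
  have j: "1 \<le> j" using assms by linarith
  have "real j ^ 2 * size_prob j \<le> real k ^ 2 * size_prob k" using j assms by (intro size_prob_square_increasing)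
  also have "\<dots> \<le> (2 * real j) ^ 2 * size_prob k" using assms by (intro mult_right_mono power_mono) auto
  also have "\<dots> = real j ^ 2 * (4 * size_prob k)" by (simp add: power_mult_distrib)
  finally show ?thesis using j by (simp add: mult_le_cancel_left_pos)
qed

lemma size_prob_ratio: "(\<lambda>k. size_prob (k + j) / size_prob k) \<longlonglongrightarrow> 1"
proof (induction j)
  case 0
  have "\<forall>\<^sub>F k in sequentially. 1 = size_prob (k + 0) / size_prob k"
    using eventually_ge_at_top[of 1] by eventually_elim (use size_prob_pos in force)
  then show ?case by (rule Lim_transform_eventually[OF tendsto_const])
next
  case (Suc j)
  have "(\<lambda>k. (2 * real (k + j) - 1) / (2 * real (k + j) + 2)) \<longlonglongrightarrow> 1" by real_asymp
  from tendsto_mult[OF Suc this]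
  have "(\<lambda>k. size_prob (k + j) / size_prob k * ((2 * real (k + j) - 1) / (2 * real (k + j) + 2))) \<longlonglongrightarrow> 1" by simp
  moreover have "\<forall>\<^sub>F k in sequentially. size_prob (k + j) / size_prob k * ((2 * real (k + j) - 1) / (2 * real (k + j) + 2)) =
      size_prob (k + Suc j) / size_prob k"
    using eventually_ge_at_top[of 1]
  proof eventually_elim
    case (elim k)
    then show ?case using size_prob_Suc'[of "k + j"] by simp
  qed
  ultimately show ?case by (rule Lim_transform_eventually)
qed

lemma size_prob_ratio_back: "(\<lambda>k. size_prob (k - j) / size_prob k) \<longlonglongrightarrow> 1"
proof (rule LIMSEQ_offset[where k=j])
  from tendsto_inverse[OF size_prob_ratio[of j]]
  show "(\<lambda>k. size_prob (k + j - j) / size_prob (k + j)) \<longlonglongrightarrow> 1" by (simp add: field_simps)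
qed

lemma size_prob_sums: "size_prob sums 1"
proof -
  have "(\<lambda>k. measure_pmf.prob size_pmf {k}) sums measure_pmf.prob size_pmf (\<Union>k. {k})"
    by (rule measure_pmf.finite_measure_UNION) (auto simp: disjoint_family_on_def)
  then show ?thesis by (simp add: measure_pmf_single)
qed

section \<open>Sequences asymptotic to the size distribution\<close>

text \<open>The sequence \<open>a\<close> has sum \<open>A\<close> and its \<open>k\<close>-th term is asymptotic to \<open>l\<close> times the probability of size \<open>k\<close>.\<close>

definition size_asymp :: "(nat \<Rightarrow> real) \<Rightarrow> real \<Rightarrow> real \<Rightarrow> bool" where
  "size_asymp a l A \<longleftrightarrow> (\<forall>k. 0 \<le> a k) \<and> a sums A \<and> (\<lambda>k. a k / size_prob k) \<longlonglongrightarrow> l"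

lemma size_asymp_bound:
  assumes "size_asymp a l A" shows "\<exists>B\<ge>0. \<forall>k\<ge>1. a k \<le> B * size_prob k"
proof -
  have "Bseq (\<lambda>k. a k / size_prob k)"
    using assms by (auto simp: size_asymp_def intro!: convergent_imp_Bseq convergentI)
  then obtain B where B: "B > 0" "\<And>k. norm (a k / size_prob k) \<le> B" by (auto simp: Bseq_def)
  have "a k \<le> B * size_prob k" if "k \<ge> 1" for k
    using B(2)[of k] size_prob_pos[OF that] by (auto simp: abs_divide divide_le_eq)
  with B(1) show ?thesis by (intro exI[of _ B]) auto
qed

text \<open>When the first index is the smaller one, \<open>size_prob_half\<close> bounds the other factor by a multiple of \<open>size_prob k\<close>
  uniformly, so the limit may be taken term by term.\<close>

lemma size_asymp_half_convolution:
  assumes a: "size_asymp a l A" and b: "size_asymp b m B"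
    and Q: "\<And>k j. Q k j \<Longrightarrow> 2 * j \<le> k" "\<And>j. \<forall>\<^sub>F k in sequentially. Q k j"
  shows "(\<lambda>k. (\<Sum>j | Q k j. a j * b (k - j)) / size_prob k) \<longlonglongrightarrow> m * A"
proof -
  obtain D where D: "D \<ge> 0" "\<And>k. k \<ge> 1 \<Longrightarrow> b k \<le> D * size_prob k"
    using size_asymp_bound[OF b] by blast
  have an: "0 \<le> a k" and bn: "0 \<le> b k" for k using a b by (auto simp: size_asymp_def)
  have as: "a sums A" and bl: "(\<lambda>k. b k / size_prob k) \<longlonglongrightarrow> m" using a b by (auto simp: size_asymp_def)
  \<comment> \<open>Zero outside the range of summation, so that the sum becomes a series with a fixed index set.\<close>
  let ?g = "\<lambda>j k. if Q k j then a j * b (k - j) / size_prob k else 0"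
  have "(\<lambda>k. ?g j k) \<longlonglongrightarrow> a j * m" for j
  proof -
    have "(\<lambda>k. b (k - j) / size_prob (k - j)) \<longlonglongrightarrow> m"
      by (rule LIMSEQ_offset[where k=j]) (simp add: bl)
    from tendsto_mult[OF tendsto_const[of "a j"] tendsto_mult[OF this size_prob_ratio_back[of j]]]
    have "(\<lambda>k. a j * (b (k - j) / size_prob (k - j) * (size_prob (k - j) / size_prob k))) \<longlonglongrightarrow> a j * m" by simp
    moreover have "\<forall>\<^sub>F k in sequentially. a j * (b (k - j) / size_prob (k - j) * (size_prob (k - j) / size_prob k)) = ?g j k"
      using Q(2)[of j] eventually_gt_at_top[of j]
    proof eventually_elim
      case (elim k)
      then have "0 < size_prob (k - j)" by (intro size_prob_pos) simp
      then show ?case using elim by simp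
    qed
    ultimately show ?thesis by (rule Lim_transform_eventually)
  qed
  moreover have "norm (?g j k) \<le> a j * (4 * D)" for j k
  proof (cases "Q k j \<and> 1 \<le> k")
    case True
    then have "2 * j \<le> k" "1 \<le> k" using Q(1) by auto
    then have "b (k - j) \<le> D * (4 * size_prob k)"
      using D size_prob_half[of k "k - j"] by (intro order_trans[OF D(2)] mult_left_mono) auto
    then have "a j * b (k - j) \<le> a j * (4 * D) * size_prob k"
      using an[of j] mult_left_mono[of "b (k - j)" "D * (4 * size_prob k)" "a j"] by (simp add: mult_ac)
    then show ?thesis using True size_prob_pos[of k] an[of j] bn[of "k - j"] by (simp add: divide_le_eq)
  next
    case False
    then have "?g j k = 0" by (cases "Q k j") (auto simp: size_prob_0 not_le)
    then show ?thesis using an[of j] D(1) by simp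
  qed
  then have "\<forall>\<^sub>F x in at_top \<times>\<^sub>F sequentially. (case x of (j, k) \<Rightarrow> norm (?g j k) \<le> a j * (4 * D))"
    by (intro always_eventually) auto
  moreover have "summable (\<lambda>j. a j * (4 * D))" using as by (intro summable_mult2) (rule sums_summable)
  ultimately have "(\<lambda>k. \<Sum>j. ?g j k) \<longlonglongrightarrow> (\<Sum>j. a j * m)"
    using tannerys_theorem[of ?g "\<lambda>j. a j * m" sequentially "\<lambda>j. a j * (4 * D)"] by simp
  moreover have "(\<Sum>j. ?g j k) = (\<Sum>j | Q k j. a j * b (k - j)) / size_prob k" for k
  proof -
    have "finite {j. Q k j}" by (rule finite_subset[of _ "{..k}"]) (use Q(1) in force)+
    then have "(\<Sum>j. ?g j k) = (\<Sum>j | Q k j. ?g j k)" by (intro suminf_finite) auto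
    then show ?thesis by (simp add: sum_divide_distrib)
  qed
  moreover have "(\<Sum>j. a j * m) = m * A" using as by (metis mult.commute sums_mult2 sums_unique)
  ultimately show ?thesis by simp
qed

text \<open>The principle of a single large summand: one of the two indices is at least \<open>k / 2\<close> and then takes
  the whole size, while the other contributes its sum.\<close>

lemma size_asymp_convolution:
  assumes a: "size_asymp a l A" and b: "size_asymp b m B"
  shows "size_asymp (\<lambda>k. \<Sum>j\<le>k. a j * b (k - j)) (l * B + m * A) (A * B)"
proof -
  have an: "0 \<le> a k" and bn: "0 \<le> b k" for k using a b by (auto simp: size_asymp_def)
  have as: "a sums A" and bs: "b sums B" using a b by (auto simp: size_asymp_def)
  have "(\<lambda>k. \<Sum>j\<le>k. a j * b (k - j)) sums ((\<Sum>k. a k) * (\<Sum>k. b k))"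
    using an bn sums_summable[OF as] sums_summable[OF bs] by (intro Cauchy_product_sums) auto
  then have "(\<lambda>k. \<Sum>j\<le>k. a j * b (k - j)) sums (A * B)"
    using as bs by (simp add: sums_iff)
  moreover have "(\<lambda>k. (\<Sum>j\<le>k. a j * b (k - j)) / size_prob k) \<longlonglongrightarrow> l * B + m * A"
  proof -
    have 1: "(\<lambda>k. (\<Sum>j | 2 * j \<le> k. a j * b (k - j)) / size_prob k) \<longlonglongrightarrow> m * A"
      by (rule size_asymp_half_convolution[OF a b, where Q="\<lambda>k j. 2 * j \<le> k"]) (auto intro: eventually_ge_at_top)
    have 2: "(\<lambda>k. (\<Sum>j | 2 * j < k. b j * a (k - j)) / size_prob k) \<longlonglongrightarrow> l * B"
      by (rule size_asymp_half_convolution[OF b a, where Q="\<lambda>k j. 2 * j < k"]) (auto intro: eventually_gt_at_top)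
    have "(\<Sum>j\<le>k. a j * b (k - j)) = (\<Sum>j | 2 * j < k. b j * a (k - j)) + (\<Sum>j | 2 * j \<le> k. a j * b (k - j))" for k
    proof -
      have "{..k} = {j. 2 * j \<le> k} \<union> {j. k < 2 * j \<and> j \<le> k}" by auto
      moreover have f: "finite {j. 2 * j \<le> k}" by (rule finite_subset[of _ "{..k}"]) auto
      ultimately have "(\<Sum>j\<le>k. a j * b (k - j)) = (\<Sum>j | 2 * j \<le> k. a j * b (k - j)) + (\<Sum>j | k < 2 * j \<and> j \<le> k. a j * b (k - j))"
        by (simp only:) (rule sum.union_disjoint, auto)
      also have "(\<Sum>j | k < 2 * j \<and> j \<le> k. a j * b (k - j)) = (\<Sum>j | 2 * j < k. b j * a (k - j))"
        by (rule sum.reindex_bij_witness[of _ "\<lambda>j. k - j" "\<lambda>j. k - j"]) (auto simp: mult.commute)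
      finally show ?thesis by simp
    qed
    with tendsto_add[OF 2 1] show ?thesis by (simp add: add_divide_distrib)
  qed
  ultimately show ?thesis
    unfolding size_asymp_def using an bn by (auto intro!: sum_nonneg mult_nonneg_nonneg)
qed

lemma size_asymp_mult: "size_asymp a l A \<Longrightarrow> 0 \<le> c \<Longrightarrow> size_asymp (\<lambda>k. c * a k) (c * l) (c * A)"
  unfolding size_asymp_def by (auto intro: sums_mult tendsto_mult_left simp flip: times_divide_eq_right)

lemma size_asymp_shift:
  assumes a: "size_asymp a l A"
  shows "size_asymp (\<lambda>k. case k of 0 \<Rightarrow> 0 | Suc j \<Rightarrow> a j) l A"
proof -
  let ?b = "\<lambda>k. case k of 0 \<Rightarrow> 0 | Suc j \<Rightarrow> a j"
  have "?b sums A" using a sums_Suc_iff[of ?b A] by (simp add: size_asymp_def)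
  moreover have "(\<lambda>k. ?b k / size_prob k) \<longlonglongrightarrow> l"
  proof (rule LIMSEQ_offset[where k=1])
    have "(\<lambda>k. a k / size_prob k) \<longlonglongrightarrow> l" using a by (simp add: size_asymp_def)
    from tendsto_divide[OF this size_prob_ratio[of 1]]
    have "(\<lambda>k. a k / size_prob k / (size_prob (k + 1) / size_prob k)) \<longlonglongrightarrow> l" by simp
    moreover have "\<forall>\<^sub>F k in sequentially. a k / size_prob k / (size_prob (k + 1) / size_prob k) = ?b (k + 1) / size_prob (k + 1)"
      using eventually_ge_at_top[of 1] by eventually_elim (use size_prob_pos in force)
    ultimately show "(\<lambda>k. ?b (k + 1) / size_prob (k + 1)) \<longlonglongrightarrow> l" by (rule Lim_transform_eventually)
  qed
  ultimately show ?thesis using a by (auto simp: size_asymp_def split: nat.split)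
qed

text \<open>The value at \<open>k = 0\<close> does not disturb the limit: \<open>size_prob 0 = 0\<close>.\<close>

lemma size_asymp_delta: "size_asymp (\<lambda>k. if k = 0 then 1 else 0) 0 1"
proof -
  have "(\<lambda>k. (if k = 0 then 1 else 0) / size_prob k) = (\<lambda>k. 0)"
    by (auto simp: size_prob_0)
  moreover have "(\<lambda>k::nat. if k = 0 then 1 else 0 :: real) sums 1"
    using sums_single[of 0 "\<lambda>_. 1::real"] by simp
  ultimately show ?thesis by (simp add: size_asymp_def)
qed

lemma size_asymp_size_prob: "size_asymp size_prob 1 1"
  using size_prob_sums size_prob_ratio[of 0] by (simp add: size_asymp_def)

section \<open>The size of a branching tree with given root age\<close>

lemma size_fps_nth: "fps_nth size_fps k = size_prob k"
  by (simp add: size_fps_def)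

text \<open>With \<open>b\<close> fixed this is, up to a factor depending on \<open>b\<close>, the probability that the branching tree with root age \<open>b\<close>
  has \<open>k\<close> vertices.\<close>

definition size_weight :: "nat \<Rightarrow> real \<Rightarrow> real" where
  "size_weight k b = (\<Sum>t | num_vertices t = k. tree_weight t b)"

lemma finite_trees_size [simp]: "finite {t. num_vertices t = k}"
  by (rule finite_subset[OF _ finite_trees_bounded_size[of k]]) auto

lemma finite_forests_size [simp]: "finite {M. forest_size M = k}"
  by (rule finite_subset[OF _ finite_forests_bounded_size[of k]]) auto

lemma tempered_size_weight [tempered_intros]: "tempered (size_weight k)"
  unfolding size_weight_def by (intro tempered_sum tempered_tree_weight)

lemma size_weight_0: "size_weight 0 b = 0"
proof -
  have "{t. num_vertices t = 0} = {}" using num_vertices_pos by (metis (mono_tags, lifting) empty_Collect_eq less_irrefl)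
  then show ?thesis by (simp only: size_weight_def sum.empty)
qed

lemma sum_trees_Suc: "(\<Sum>t | num_vertices t = Suc k. f t) = (\<Sum>M | forest_size M = k. f (Node M))"
  by (rule sum.reindex_bij_witness[of _ Node subtrees]) (auto elim!: rtree.exhaust_sel, metis num_vertices.simps rtree.collapse nat.inject)

lemma size_weight_1: "size_weight 1 b = 1"
proof -
  have "{M. forest_size M = 0} = {{#}}"
  proof -
    have "M = {#}" if "forest_size M = 0" for M
      using size_le_forest_size[of M] that by (metis le_zero_eq size_eq_0_iff_empty)
    then show ?thesis by auto
  qed
  then show ?thesis
    by (simp only: size_weight_def One_nat_def sum_trees_Suc) (simp add: tree_weight.simps)
qed

lemma edge_op_size_weight:
  "edge_op (size_weight k) b = (\<Sum>t | num_vertices t = k. edge_op (tree_weight t) b)"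
  using edge_op_sum[of "{t. num_vertices t = k}" tree_weight "\<lambda>_. 1" b] tempered_tree_weight
  by (simp add: size_weight_def[abs_def])

text \<open>Mark a vertex other than the root and remove the branch at the root which contains it. Together with the value at
  \<open>k = 1\<close> this recursion determines all size weights. On generating functions it says that \<open>Q = z exp H\<close>, where \<open>H\<close> is
  \<open>edge_op\<close> applied to \<open>Q\<close>.\<close>

lemma size_weight_recursion:
  "(real k - 1) * size_weight k b = (\<Sum>j\<le>k. (real j * edge_op (size_weight j) b) * size_weight (k - j) b)"
proof (cases k)
  case 0
  then show ?thesis by (simp add: size_weight_0)
next
  case (Suc n)
  let ?V = "\<lambda>c. edge_op (tree_weight c) b"
  let ?A = "{M. forest_size M = n}"
  have fs: "real n = (\<Sum>d\<in>set_mset M. real (count M d) * real (num_vertices d))" if "M \<in> ?A" for M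
  proof -
    have "n = (\<Sum>d\<in>set_mset M. count M d * num_vertices d)" using that sum_mset_image_eq_sum[of num_vertices M] by simp
    then show ?thesis by (metis (mono_tags, lifting) of_nat_mult of_nat_sum sum.cong)
  qed
  have "(real k - 1) * size_weight k b = (\<Sum>M\<in>?A. multiset_weight ?V M * real n)"
    by (simp add: Suc size_weight_def sum_trees_Suc tree_weight.simps sum_distrib_left mult.commute)
  also have "\<dots> = (\<Sum>M\<in>?A. multiset_weight ?V M * (\<Sum>d\<in>set_mset M. real (count M d) * real (num_vertices d)))"
    by (intro sum.cong refl arg_cong2[where f="(*)"] fs)
  also have "\<dots> = (\<Sum>(N, d) | add_mset d N \<in> ?A. multiset_weight ?V N * (?V d * real (num_vertices d)))"
    by (rule sum_multiset_weight_element) simp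
  also have "\<dots> = (\<Sum>(j, d, s)\<in>(SIGMA j:{..k}. {d. num_vertices d = j} \<times> {s. num_vertices s = k - j}).
      (real j * ?V d) * tree_weight s b)"
  proof (rule sum.reindex_bij_witness[where i="\<lambda>(j, d, s). (subtrees s, d)" and j="\<lambda>(N, d). (num_vertices d, d, Node N)"])
    fix x assume "x \<in> (SIGMA j:{..k}. {d. num_vertices d = j} \<times> {s. num_vertices s = k - j})"
    then obtain d s where x: "x = (num_vertices d, d, s)" "num_vertices d \<le> k" "num_vertices s = k - num_vertices d" by auto
    obtain N where s: "s = Node N" by (cases s)
    show "(case case x of (j, d, s) \<Rightarrow> (subtrees s, d) of (N, d) \<Rightarrow> (num_vertices d, d, Node N)) = x"
      by (simp add: x s)
    show "(case x of (j, d, s) \<Rightarrow> (subtrees s, d)) \<in> {(N, d). add_mset d N \<in> ?A}"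
      using x s Suc by auto
  next
    fix x assume "x \<in> {(N, d). add_mset d N \<in> ?A}"
    then obtain N d where x: "x = (N, d)" "num_vertices d + forest_size N = n" by auto
    then show "(case x of (N, d) \<Rightarrow> (num_vertices d, d, Node N)) \<in> (SIGMA j:{..k}. {d. num_vertices d = j} \<times> {s. num_vertices s = k - j})"
      using Suc by auto
  qed (auto simp: tree_weight.simps)
  also have "\<dots> = (\<Sum>j\<le>k. \<Sum>d | num_vertices d = j. \<Sum>s | num_vertices s = k - j. (real j * ?V d) * tree_weight s b)"
    unfolding sum.cartesian_product by (rule sum.Sigma[symmetric]) auto
  finally show ?thesis
    unfolding edge_op_size_weight size_weight_def sum_product[symmetric] sum_distrib_left[symmetric] sum_distrib_right[symmetric] .
qed

text \<open>The parameter in which the generating function of the size is algebraic. It increases from \<open>0\<close> to \<open>1/2\<close>, and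
  \<open>tanh (b / 2) = y / (1 - y)\<close>.\<close>

definition age_param :: "real \<Rightarrow> real" where
  "age_param b = (1 - exp (- b)) / 2"

definition geometric_fps :: "real \<Rightarrow> real fps" where
  "geometric_fps y = Abs_fps (\<lambda>n. y ^ n)"

text \<open>The series of \<open>- 2 ln (1 - y z)\<close>; the coefficient at \<open>0\<close> is \<open>0\<close> by division by zero.\<close>

definition log_fps :: "real \<Rightarrow> real fps" where
  "log_fps y = Abs_fps (\<lambda>n. 2 * y ^ n / real n)"

lemma geometric_fps_mult: "geometric_fps y * (1 - fps_const y * fps_X) = 1"
proof (rule fps_ext)
  show "fps_nth (geometric_fps y * (1 - fps_const y * fps_X)) n = fps_nth 1 n" for n
    by (cases n) (auto simp: geometric_fps_def algebra_simps)
qed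

lemma fps_deriv_geometric: "fps_deriv (geometric_fps y) = fps_const y * (geometric_fps y * geometric_fps y)"
proof -
  let ?g = "geometric_fps y" and ?d = "fps_deriv (geometric_fps y)" and ?l = "1 - fps_const y * fps_X"
  have "fps_deriv (?g * ?l) = 0" by (simp add: geometric_fps_mult)
  then have "?d * ?l = fps_const y * ?g"
    by (simp add: fps_deriv_mult algebra_simps)
  then have "?d * (?g * ?l) = fps_const y * (?g * ?g)" by (simp add: mult_ac)
  then show ?thesis by (simp add: geometric_fps_mult)
qed

lemma fps_deriv_log: "fps_deriv (log_fps y) = 2 * fps_const y * geometric_fps y"
  by (rule fps_ext) (simp add: log_fps_def geometric_fps_def mult.assoc numeral_fps_const)

text \<open>The series \<open>z / (1 - y F)\<^sup>2\<close>. As an age varies, \<open>edge_op\<close> maps its coefficients to those of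
  \<open>- 2 ln (1 - y F)\<close>, whose exponential is \<open>profile y / z\<close>; this is the fixed point equation of the size weights.\<close>

definition profile :: "real \<Rightarrow> real fps" where
  "profile y = fps_X * ((geometric_fps y * geometric_fps y) oo size_fps)"

text \<open>Logarithmic differentiation of \<open>profile y = z exp (- 2 ln (1 - y F))\<close>.\<close>

lemma profile_recursion:
  "(real k - 1) * fps_nth (profile y) k =
    (\<Sum>j\<le>k. (real j * fps_nth (log_fps y oo size_fps) j) * fps_nth (profile y) (k - j))"
proof -
  let ?g = "geometric_fps y" and ?F = size_fps
  let ?G = "(?g * ?g) oo ?F" and ?H = "log_fps y oo ?F"
  have "fps_deriv (?g * ?g) = (?g * ?g) * fps_deriv (log_fps y)"
    by (simp add: fps_deriv_mult fps_deriv_geometric fps_deriv_log algebra_simps)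
  then have "fps_deriv ?G = ?G * fps_deriv ?H"
    by (simp only: fps_compose_deriv[OF size_fps_0, of "?g * ?g"] fps_compose_deriv[OF size_fps_0, of "log_fps y"]
        fps_compose_mult_distrib[OF size_fps_0, of "?g * ?g"] mult.assoc[of ?G])
  then have "fps_X * fps_deriv (profile y) - profile y = (fps_X * fps_deriv ?H) * profile y"
    by (simp add: profile_def fps_deriv_mult algebra_simps)
  then have "fps_nth (fps_X * fps_deriv (profile y) - profile y) k = fps_nth ((fps_X * fps_deriv ?H) * profile y) k"
    by simp
  moreover have X: "fps_nth (fps_X * fps_deriv f) j = real j * fps_nth f j" for f :: "real fps" and j
    by (cases j) auto
  ultimately show ?thesis
    unfolding fps_sub_nth X fps_mult_nth[of "fps_X * fps_deriv ?H"] by (simp add: algebra_simps atLeast0AtMost)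
qed

lemma age_param_bounds: "0 \<le> b \<Longrightarrow> 0 \<le> age_param b" "age_param b < 1/2"
  by (auto simp: age_param_def)

lemma DERIV_age_param: "(age_param has_real_derivative exp (- b) / 2) (at b)"
  unfolding age_param_def[abs_def] by (auto intro!: derivative_eq_intros)

lemma tempered_age_param [tempered_intros]: "tempered age_param"
proof -
  have "\<bar>age_param a\<bar> \<le> 1/2" if "0 \<le> a" for a using age_param_bounds[of a] that by auto
  moreover have "age_param \<in> borel_measurable borel" unfolding age_param_def[abs_def] by measurable
  ultimately show ?thesis unfolding tempered_def by blast
qed

text \<open>\<open>edge_op f\<close> is the solution of \<open>H'' (b) = - f b * exp (- b) / 2\<close> with \<open>H 0 = 0\<close> and \<open>H' \<longlongrightarrow> 0\<close> at infinity.\<close>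

lemma edge_op_eqI:
  assumes H: "H 0 = 0" "\<And>b. (H has_real_derivative T b) (at b)"
    and T: "\<And>b. (T has_real_derivative - (exp (- b) / 2 * f b)) (at b)" "(T \<longlongrightarrow> 0) at_top"
    and f: "tempered f" "\<And>b. isCont f b" and b: "0 \<le> b"
  shows "edge_op f b = H b"
proof (cases "b = 0")
  case False
  have tail: "age_tail f x = T x" if "0 \<le> x" for x
    by (rule age_tail_eq_FTC) (use that f T DERIV_isCont[OF T(1)] in auto)
  let ?d = "\<lambda>x. H x - edge_op f x"
  have D: "(?d has_real_derivative T x - age_tail f x) (at x)" for x
    by (intro DERIV_diff H(2) DERIV_edge_op f)
  have "?d b = ?d 0"
  proof (rule DERIV_isconst_end[where f="?d"])
    show "continuous_on {0..b} ?d"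
      by (intro continuous_at_imp_continuous_on ballI DERIV_isCont[OF D])
    show "(?d has_real_derivative 0) (at x)" if "0 < x" "x < b" for x
      using D[of x] tail[of x] that by simp
  qed (use b False in auto)
  then show ?thesis by (simp add: H edge_op_0)
qed (simp add: H edge_op_0)

text \<open>\<open>d1\<close> and \<open>d2\<close> are the first two derivatives of \<open>log_fps\<close> in \<open>y\<close>. With \<open>g = 1 / (1 - y z)\<close> they are \<open>2 z g\<close> and
  \<open>2 z\<^sup>2 g\<^sup>2\<close>, and the third claim is \<open>2 z g - (1 - 2 y) z\<^sup>2 g\<^sup>2 = (2 z - z\<^sup>2) g\<^sup>2\<close> evaluated at \<open>z = F\<close>, where
  \<open>2 F - F\<^sup>2\<close> is the variable itself.\<close>

lemma profile_log_derivatives: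
  defines "d1 \<equiv> \<lambda>y. Abs_fps (\<lambda>n. if n = 0 then 0 else 2 * y ^ (n - 1)) :: real fps"
    and "d2 \<equiv> \<lambda>y. Abs_fps (\<lambda>n. 2 * (real (n - 1) * y ^ (n - 2))) :: real fps"
  shows "((\<lambda>y. fps_nth (log_fps y oo size_fps) k) has_real_derivative fps_nth (d1 y oo size_fps) k) (at y)"
    and "((\<lambda>y. fps_nth (d1 y oo size_fps) k) has_real_derivative fps_nth (d2 y oo size_fps) k) (at y)"
    and "fps_nth (profile y) k = fps_nth (d1 y oo size_fps) k - (1/2 - y) * fps_nth (d2 y oo size_fps) k"
proof -
  show "((\<lambda>y. fps_nth (log_fps y oo size_fps) k) has_real_derivative fps_nth (d1 y oo size_fps) k) (at y)"
  proof -
    have "((\<lambda>y. 2 * y ^ n / real n) has_real_derivative (if n = 0 then 0 else 2 * y ^ (n - 1))) (at y)" for n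
    proof (cases "n = 0")
      case False
      have "((\<lambda>y. 2 / real n * y ^ n) has_real_derivative 2 / real n * (real n * y ^ (n - Suc 0))) (at y)"
        by (intro DERIV_cmult DERIV_pow)
      then show ?thesis using False by simp
    qed simp
    then show ?thesis
      unfolding fps_compose_nth log_fps_def d1_def fps_nth_Abs_fps by (intro DERIV_sum DERIV_cmult_right)
  qed
  show "((\<lambda>y. fps_nth (d1 y oo size_fps) k) has_real_derivative fps_nth (d2 y oo size_fps) k) (at y)"
  proof -
    have "((\<lambda>y. if n = 0 then 0 else 2 * y ^ (n - 1)) has_real_derivative 2 * (real (n - 1) * y ^ (n - 2))) (at y)" for n
      by (cases n) (auto intro!: derivative_eq_intros simp: numeral_2_eq_2)
    then show ?thesis
      unfolding fps_compose_nth d1_def d2_def fps_nth_Abs_fps by (intro DERIV_sum DERIV_cmult_right)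
  qed
  let ?g = "geometric_fps y" and ?l = "1 - fps_const y * fps_X"
  have d1: "d1 y = 2 * fps_X * ?g"
    by (rule fps_ext) (auto simp: d1_def geometric_fps_def numeral_fps_const mult.assoc)
  have gg: "?g * ?g = Abs_fps (\<lambda>n. real (n + 1) * y ^ n)"
    by (rule fps_ext) (simp add: fps_mult_nth geometric_fps_def flip: power_add)
  have d2: "d2 y = 2 * fps_X * fps_X * (?g * ?g)"
    unfolding gg
  proof (rule fps_ext)
    fix n
    consider "n = 0" | "n = 1" | m where "n = Suc (Suc m)" by (metis One_nat_def not0_implies_Suc)
    then show "fps_nth (d2 y) n = fps_nth (2 * fps_X * fps_X * Abs_fps (\<lambda>n. real (n + 1) * y ^ n)) n"
      by cases (auto simp: d2_def numeral_fps_const mult.assoc)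
  qed
  have half: "fps_const (1/2) * (2 * fps_X) = (fps_X :: real fps)"
    by (simp add: numeral_fps_const flip: mult.assoc)
  have "d1 y - fps_const (1/2 - y) * d2 y = 2 * fps_X * ?g * (?g * ?l) - (fps_const (1/2) - fps_const y) * (2 * fps_X * fps_X * (?g * ?g))"
    by (simp only: d1 d2 geometric_fps_mult fps_const_sub mult_1_right)
  also have "\<dots> = (?g * ?g) * (2 * fps_X - (fps_const (1/2) * (2 * fps_X)) * fps_X)"
  proof -
    have "2 * x * g * (g * (1 - b * x)) - (a - b) * (2 * x * x * (g * g)) = (g * g) * (2 * x - (a * (2 * x)) * x)"
      for a b g x :: "real fps" by (simp add: algebra_simps)
    then show ?thesis .
  qed
  also have "\<dots> = (?g * ?g) * (2 * fps_X - fps_X * fps_X)" unfolding half ..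
  finally have "(d1 y - fps_const (1/2 - y) * d2 y) oo size_fps = ((?g * ?g) * (2 * fps_X - fps_X * fps_X)) oo size_fps"
    by simp
  also have "\<dots> = ((?g * ?g) oo size_fps) * (2 * size_fps - size_fps * size_fps)"
    by (simp add: fps_compose_mult_distrib size_fps_0 fps_compose_sub_distrib numeral_fps_const)
  also have "\<dots> = profile y" by (simp add: size_fps_square profile_def mult.commute)
  finally have P: "profile y = (d1 y oo size_fps) - fps_const (1/2 - y) * (d2 y oo size_fps)"
    by (simp add: fps_compose_sub_distrib fps_compose_mult_distrib size_fps_0)
  show "fps_nth (profile y) k = fps_nth (d1 y oo size_fps) k - (1/2 - y) * fps_nth (d2 y oo size_fps) k"
    by (simp only: P fps_sub_nth fps_mult_left_const_nth)
qed

lemma tempered_compose_nth: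
  assumes "\<And>n. tempered (\<lambda>b. fps_nth (f b) n)" shows "tempered (\<lambda>b. fps_nth (f b oo size_fps) k)"
  unfolding fps_compose_nth using assms by (intro tempered_sum tempered_mult tempered_const)

lemma fps_nth_profile: "fps_nth (profile y) k = (if k = 0 then 0 else \<Sum>n=0..k-1. real (n + 1) * y ^ n * fps_nth (size_fps ^ n) (k - 1))"
proof -
  have gg: "geometric_fps y * geometric_fps y = Abs_fps (\<lambda>n. real (n + 1) * y ^ n)"
    by (rule fps_ext) (simp add: fps_mult_nth geometric_fps_def flip: power_add)
  show ?thesis by (simp add: profile_def gg fps_compose_nth)
qed

lemma tempered_profile: "tempered (\<lambda>b. fps_nth (profile (age_param b)) k)"
  unfolding fps_nth_profile
  by (cases "k = 0") (simp_all add: tempered_const, intro tempered_sum tempered_mult tempered_const tempered_power tempered_age_param)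

lemma isCont_profile: "isCont (\<lambda>b. fps_nth (profile (age_param b)) k) b"
  unfolding fps_nth_profile
  by (cases "k = 0") (auto intro!: continuous_intros DERIV_isCont[OF DERIV_age_param])

text \<open>As \<open>age_param\<close> satisfies \<open>y' = 1/2 - y = exp (- b) / 2\<close>, the previous identities are the differential equation
  required by \<open>edge_op_eqI\<close>.\<close>

lemma edge_op_profile:
  assumes b: "0 \<le> b"
  shows "edge_op (\<lambda>a. fps_nth (profile (age_param a)) k) b = fps_nth (log_fps (age_param b) oo size_fps) k"
proof -
  let ?d1 = "\<lambda>y. Abs_fps (\<lambda>n. if n = 0 then 0 else 2 * y ^ (n - 1)) :: real fps"
  let ?d2 = "\<lambda>y. Abs_fps (\<lambda>n. 2 * (real (n - 1) * y ^ (n - 2))) :: real fps"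
  let ?D1 = "\<lambda>b. fps_nth (?d1 (age_param b) oo size_fps) k"
  show ?thesis
  proof (rule edge_op_eqI[OF _ _ _ _ tempered_profile isCont_profile b])
    show "fps_nth (log_fps (age_param 0) oo size_fps) k = 0"
      by (auto simp: fps_compose_nth log_fps_def age_param_def intro!: sum.neutral)
    show "((\<lambda>b. fps_nth (log_fps (age_param b) oo size_fps) k) has_real_derivative
        exp (- b) / 2 * ?D1 b) (at b)" for b
      using DERIV_chain2[OF profile_log_derivatives(1) DERIV_age_param] by (simp add: mult.commute)
    show "((\<lambda>b. exp (- b) / 2 * ?D1 b) has_real_derivative
        - (exp (- b) / 2 * fps_nth (profile (age_param b)) k)) (at b)" for b
    proof -
      have "(?D1 has_real_derivative fps_nth (?d2 (age_param b) oo size_fps) k * (exp (- b) / 2)) (at b)"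
        by (rule DERIV_chain2[OF profile_log_derivatives(2) DERIV_age_param])
      moreover have "((\<lambda>b. exp (- b) / 2) has_real_derivative - (exp (- b) / 2)) (at b)"
        by (auto intro!: derivative_eq_intros)
      ultimately have "((\<lambda>b. exp (- b) / 2 * ?D1 b) has_real_derivative
          (- (exp (- b) / 2)) * ?D1 b + fps_nth (?d2 (age_param b) oo size_fps) k * (exp (- b) / 2) * (exp (- b) / 2)) (at b)"
        by (intro DERIV_mult)
      moreover have e: "1/2 - age_param b = exp (- b) / 2" by (simp add: age_param_def field_simps)
      have "- (exp (- b) / 2 * fps_nth (profile (age_param b)) k) = (- (exp (- b) / 2)) * ?D1 b +
          fps_nth (?d2 (age_param b) oo size_fps) k * (exp (- b) / 2) * (exp (- b) / 2)"
        unfolding profile_log_derivatives(3) e by (simp add: right_diff_distrib mult_ac)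
      ultimately show ?thesis by (simp only:)
    qed
    show "((\<lambda>b. exp (- b) / 2 * ?D1 b) \<longlongrightarrow> 0) at_top"
    proof (rule tempered_tendsto_0, rule tempered_compose_nth)
      show "tempered (\<lambda>b. fps_nth (?d1 (age_param b)) n)" for n
        by (cases "n = 0") (simp_all add: tempered_const, intro tempered_mult tempered_const tempered_power tempered_age_param)
    qed
  qed
qed

lemma size_weight_eq_profile:
  "0 \<le> b \<Longrightarrow> size_weight k b = fps_nth (profile (age_param b)) k"
proof (induction k arbitrary: b rule: less_induct)
  case (less k)
  consider "k = 0" | "k = 1" | "k \<ge> 2" by linarith
  then show ?case
  proof cases
    case 3
    have "(real j * edge_op (size_weight j) b) * size_weight (k - j) b =
        (real j * fps_nth (log_fps (age_param b) oo size_fps) j) * fps_nth (profile (age_param b)) (k - j)" if "j \<le> k" for j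
    proof (cases "j = 0 \<or> j = k")
      case False
      then have j: "j < k" "k - j < k" using that by auto
      have "edge_op (size_weight j) b = edge_op (\<lambda>a. fps_nth (profile (age_param a)) j) b"
        by (rule edge_op_cong) (use less.IH[OF j(1)] in \<open>auto intro: tempered_size_weight tempered_profile\<close>)
      then show ?thesis using less.IH[OF j(2) less.prems] edge_op_profile[OF less.prems] by simp
    qed (auto simp: size_weight_0 fps_nth_profile)
    then have "(real k - 1) * size_weight k b = (real k - 1) * fps_nth (profile (age_param b)) k"
      unfolding size_weight_recursion profile_recursion by (intro sum.cong) auto
    then show ?thesis using 3 by simp
  qed (use size_weight_1[of b] in \<open>auto simp: size_weight_0 fps_nth_profile\<close>)
qed

lemma size_asymp_power: "size_asymp (\<lambda>k. fps_nth (size_fps ^ n) k) (real n) 1"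
proof (induction n)
  case 0
  then show ?case using size_asymp_delta by simp
next
  case (Suc n)
  have "(\<lambda>k. fps_nth (size_fps ^ Suc n) k) = (\<lambda>k. \<Sum>j\<le>k. size_prob j * fps_nth (size_fps ^ n) (k - j))"
    by (simp add: fps_mult_nth size_fps_def atLeast0AtMost)
  then show ?case
    using size_asymp_convolution[OF size_asymp_size_prob Suc] by (simp add: add.commute)
qed

lemma size_fps_power_nonneg: "0 \<le> fps_nth (size_fps ^ n) k"
  using size_asymp_power[of n] by (simp add: size_asymp_def)

text \<open>At \<open>y = 1/2\<close> the series \<open>1 / (1 - y F)\<close> is rational in \<open>F\<close> and \<open>z\<close>, because \<open>2 F - F\<^sup>2 = z\<close>. It dominates all
  other values of \<open>y\<close>, which yields the bounds uniform in the age.\<close>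

lemma geometric_compose_half: "fps_X * (geometric_fps (1/2) oo size_fps) = 2 * size_fps"
proof -
  let ?A = "geometric_fps (1/2) oo size_fps"
  have "(geometric_fps (1/2) * (1 - fps_const (1/2) * fps_X)) oo size_fps = 1 oo size_fps"
    by (simp only: geometric_fps_mult)
  then have A: "?A * (1 - fps_const (1/2) * size_fps) = 1"
    by (simp add: fps_compose_mult_distrib fps_compose_sub_distrib size_fps_0)
  have half: "2 * (fps_const (1/2) * size_fps) = size_fps"
    by (simp add: numeral_fps_const flip: mult.assoc)
  have "fps_X * ?A = (2 * size_fps - size_fps * (2 * (fps_const (1/2) * size_fps))) * ?A"
    unfolding half by (simp add: size_fps_square)
  also have "\<dots> = 2 * size_fps * (?A * (1 - fps_const (1/2) * size_fps))" by (simp add: algebra_simps)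
  finally show ?thesis by (simp add: A)
qed

lemma fps_nth_geometric_compose: "fps_nth (geometric_fps y oo size_fps) k = (\<Sum>n=0..k. y ^ n * fps_nth (size_fps ^ n) k)"
  by (simp add: fps_compose_nth geometric_fps_def)

lemma fps_nth_geometric_compose_half: "fps_nth (geometric_fps (1/2) oo size_fps) k = 2 * size_prob (Suc k)"
proof -
  have "fps_nth (fps_X * (geometric_fps (1/2) oo size_fps)) (Suc k) = fps_nth (2 * size_fps) (Suc k)"
    by (simp only: geometric_compose_half)
  then show ?thesis by (simp add: numeral_fps_const size_fps_def)
qed

lemma geometric_compose_mono:
  "0 \<le> y \<Longrightarrow> y \<le> z \<Longrightarrow> fps_nth (geometric_fps y oo size_fps) k \<le> fps_nth (geometric_fps z oo size_fps) k"
  unfolding fps_nth_geometric_compose by (intro sum_mono mult_right_mono power_mono size_fps_power_nonneg)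

lemma geometric_compose_nonneg: "0 \<le> y \<Longrightarrow> 0 \<le> fps_nth (geometric_fps y oo size_fps) k"
  unfolding fps_nth_geometric_compose by (intro sum_nonneg mult_nonneg_nonneg size_fps_power_nonneg) auto

text \<open>The coefficients are \<open>\<Sum>n. y ^ n * c n k\<close> with \<open>c n k\<close> the probability that \<open>n\<close> independent clusters have total size \<open>k\<close>, and
  \<open>c n k\<close> is asymptotic to \<open>n\<close> times \<open>size_prob k\<close>. The bound by the value at \<open>y = 1/2\<close> supplies the
  geometric majorant \<open>(2 y) ^ n\<close>.\<close>

lemma size_asymp_geometric:
  assumes y: "0 \<le> y" "y < 1/2"
  shows "size_asymp (\<lambda>k. fps_nth (geometric_fps y oo size_fps) k) (y / (1 - y)^2) (1 / (1 - y))"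
proof -
  let ?A = "\<lambda>k. fps_nth (geometric_fps y oo size_fps) k"
  let ?a = "\<lambda>n k. fps_nth (size_fps ^ n) k"
  have le: "?A k \<le> 2 * size_prob (Suc k)" for k
    using geometric_compose_mono[of y "1/2" k] y by (simp add: fps_nth_geometric_compose_half)
  have nn: "0 \<le> ?A k" for k using y by (simp add: geometric_compose_nonneg)
  have "summable (\<lambda>k. 2 * size_prob (Suc k))"
    using sums_summable[OF size_prob_sums] by (intro summable_mult) (simp add: summable_Suc_iff)
  then have summ: "summable ?A"
    by (rule summable_comparison_test') (use le nn in auto)
  have eq: "?A k = (if k = 0 then 1 else 0) + y * (\<Sum>j\<le>k. size_prob j * ?A (k - j))" for k
  proof -
    have "(geometric_fps y * (1 - fps_const y * fps_X)) oo size_fps = 1 oo size_fps"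
      by (simp only: geometric_fps_mult)
    then have "geometric_fps y oo size_fps = 1 + fps_const y * (size_fps * (geometric_fps y oo size_fps))"
      by (simp add: fps_compose_mult_distrib fps_compose_sub_distrib size_fps_0 algebra_simps)
    then have "?A k = fps_nth (1 + fps_const y * (size_fps * (geometric_fps y oo size_fps))) k" by simp
    then show ?thesis
      by (simp add: fps_mult_nth[of size_fps "geometric_fps y oo size_fps"] size_fps_nth atLeast0AtMost)
  qed
  have "(\<lambda>k. \<Sum>j\<le>k. size_prob j * ?A (k - j)) sums ((\<Sum>k. size_prob k) * (\<Sum>k. ?A k))"
    using summ nn sums_summable[OF size_prob_sums] by (intro Cauchy_product_sums) auto
  then have "(\<lambda>k. \<Sum>j\<le>k. size_prob j * ?A (k - j)) sums (\<Sum>k. ?A k)"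
    using size_prob_sums by (simp add: sums_iff)
  moreover have "(\<lambda>k::nat. if k = 0 then 1 else 0 :: real) sums 1"
    using size_asymp_delta by (simp add: size_asymp_def)
  ultimately have "(\<lambda>k. (if k = 0 then 1 else 0) + y * (\<Sum>j\<le>k. size_prob j * ?A (k - j))) sums (1 + y * (\<Sum>k. ?A k))"
    by (intro sums_add sums_mult)
  then have "?A sums (1 + y * (\<Sum>k. ?A k))" unfolding eq[symmetric] .
  then have "suminf ?A = 1 + y * suminf ?A" by (rule sums_unique[symmetric])
  moreover have "s = 1 / (1 - y)" if "s = 1 + y * s" for s
    using that y by (simp add: eq_divide_eq) (simp add: algebra_simps)
  ultimately have "suminf ?A = 1 / (1 - y)" by blast
  then have S: "?A sums (1 / (1 - y))" using summ by (simp add: sums_iff)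
  have "(\<lambda>k. \<Sum>n. y ^ n * ?a n k / size_prob k) \<longlonglongrightarrow> (\<Sum>n. y ^ n * real n)"
  proof -
    have lim: "(\<lambda>k. y ^ n * ?a n k / size_prob k) \<longlonglongrightarrow> y ^ n * real n" for n
    proof -
      have "(\<lambda>k. ?a n k / size_prob k) \<longlonglongrightarrow> real n" using size_asymp_power[of n] by (simp add: size_asymp_def)
      from tendsto_mult_left[OF this, of "y ^ n"] show ?thesis by simp
    qed
    have bd: "norm (y ^ n * ?a n k / size_prob k) \<le> 2 * (2 * y) ^ n" for n k
    proof (cases "k = 0")
      case False
      have "(1/2) ^ n * ?a n k \<le> 2 * size_prob (Suc k)"
      proof (cases "n \<le> k")
        case True
        have "(1/2) ^ n * ?a n k \<le> (\<Sum>n=0..k. (1/2) ^ n * ?a n k)"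
          using True by (intro member_le_sum) (auto intro: mult_nonneg_nonneg size_fps_power_nonneg)
        then show ?thesis by (simp flip: fps_nth_geometric_compose add: fps_nth_geometric_compose_half)
      next
        case False
        then have "?a n k = 0" using startsby_zero_power_prefix[OF size_fps_0, of n] by auto
        then show ?thesis by simp
      qed
      also have "\<dots> \<le> 2 * size_prob k" using size_prob_decreasing[of k] False by simp
      finally have "(2 * y) ^ n * ((1/2) ^ n * ?a n k) \<le> (2 * y) ^ n * (2 * size_prob k)"
        using y by (intro mult_left_mono) auto
      moreover have "(2 * y) ^ n * ((1/2) ^ n * ?a n k) = y ^ n * ?a n k"
      proof -
        have "(2 * y) ^ n * (1/2) ^ n = y ^ n" unfolding power_mult_distrib[symmetric] by simp
        then show ?thesis by (metis mult.assoc)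
      qed
      ultimately have "y ^ n * ?a n k \<le> (2 * y) ^ n * (2 * size_prob k)" by (simp only:)
      moreover have "0 < size_prob k" using False by (intro size_prob_pos) simp
      moreover have "0 \<le> y ^ n * ?a n k" using y by (intro mult_nonneg_nonneg size_fps_power_nonneg) auto
      ultimately show ?thesis by (simp add: divide_le_eq mult_ac)
    qed (use y in \<open>simp add: size_prob_0\<close>)
    have "summable (\<lambda>n. 2 * (2 * y) ^ n)" using y by (intro summable_mult summable_geometric) auto
    then show ?thesis
      using tannerys_theorem[of "\<lambda>n k. y ^ n * ?a n k / size_prob k" "\<lambda>n. y ^ n * real n" sequentially "\<lambda>n. 2 * (2 * y) ^ n"] lim bd
      by (simp add: always_eventually)
  qed
  moreover have "(\<Sum>n. y ^ n * ?a n k / size_prob k) = ?A k / size_prob k" for k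
  proof -
    have "(\<Sum>n. y ^ n * ?a n k / size_prob k) = (\<Sum>n=0..k. y ^ n * ?a n k / size_prob k)"
    proof (rule suminf_finite)
      fix n assume "n \<notin> {0..k}"
      then show "y ^ n * ?a n k / size_prob k = 0"
        using startsby_zero_power_prefix[OF size_fps_0, of n] by auto
    qed simp
    then show ?thesis by (simp add: fps_nth_geometric_compose sum_divide_distrib)
  qed
  moreover have "(\<Sum>n. y ^ n * real n) = y / (1 - y)^2"
  proof -
    have "(\<lambda>n. of_nat (Suc n) * y ^ n - y ^ n) sums (1 / (1 - y)^2 - 1 / (1 - y))"
      using y by (intro sums_diff geometric_deriv_sums geometric_sums) auto
    moreover have "1 / (1 - y)^2 - 1 / (1 - y) = y / (1 - y)^2"
    proof -
      have "1 / (1 - y) = (1 - y) / (1 - y)^2" using y by (simp add: power2_eq_square)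
      then show ?thesis by (simp only: diff_divide_distrib[symmetric]) simp
    qed
    ultimately show ?thesis by (simp add: sums_iff algebra_simps)
  qed
  ultimately show ?thesis using nn S by (simp add: size_asymp_def)
qed

lemma profile_eq_square: "profile y = fps_X * ((geometric_fps y oo size_fps) * (geometric_fps y oo size_fps))"
  by (simp add: profile_def fps_compose_mult_distrib size_fps_0)

lemma size_asymp_size_weight:
  assumes b: "0 \<le> b"
  defines "y \<equiv> age_param b"
  shows "size_asymp (\<lambda>k. size_weight k b) (2 * y / (1 - y)^3) (1 / (1 - y)^2)"
proof -
  have y: "0 \<le> y" "y < 1/2" using age_param_bounds b by (auto simp: y_def)
  let ?A = "\<lambda>k. fps_nth (geometric_fps y oo size_fps) k"
  have "(\<lambda>k. size_weight k b) = (\<lambda>k. case k of 0 \<Rightarrow> 0 | Suc k \<Rightarrow> (\<Sum>j\<le>k. ?A j * ?A (k - j)))"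
    using size_weight_eq_profile[OF b] unfolding profile_eq_square y_def[symmetric]
    by (auto simp: fun_eq_iff fps_mult_nth[of "geometric_fps y oo size_fps"] atLeast0AtMost split: nat.split)
  moreover have "2 * y / (1 - y)^3 = y / (1 - y)^2 * (1 / (1 - y)) + y / (1 - y)^2 * (1 / (1 - y))"
    by (simp add: power2_eq_square power3_eq_cube)
  moreover have "1 / (1 - y)^2 = 1 / (1 - y) * (1 / (1 - y))" by (simp add: power2_eq_square)
  ultimately show ?thesis
    using size_asymp_shift[OF size_asymp_convolution[OF size_asymp_geometric[OF y] size_asymp_geometric[OF y]]]
    by (simp only:)
qed

lemma size_weight_le:
  assumes b: "0 \<le> b" shows "size_weight k b \<le> 8 * size_prob k"
proof (cases k)
  case (Suc m)
  let ?y = "age_param b"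
  let ?A = "\<lambda>y. geometric_fps y oo size_fps"
  have y: "0 \<le> ?y" "?y \<le> 1/2" using age_param_bounds[of b] b by auto
  have "size_weight k b = fps_nth (?A ?y * ?A ?y) m"
    using size_weight_eq_profile[OF b] by (simp add: profile_eq_square Suc)
  also have "\<dots> \<le> fps_nth (?A (1/2) * ?A (1/2)) m"
    unfolding fps_mult_nth using y by (intro sum_mono mult_mono geometric_compose_mono geometric_compose_nonneg) auto
  also have "\<dots> = fps_nth ((fps_X * ?A (1/2)) * (fps_X * ?A (1/2))) (Suc (Suc m))"
  proof -
    have eq: "(fps_X * ?A (1/2)) * (fps_X * ?A (1/2)) = fps_X * (fps_X * (?A (1/2) * ?A (1/2)))" by (simp only: mult_ac)
    show ?thesis unfolding eq fps_X_mult_nth by simp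
  qed
  also have "(fps_X * ?A (1/2)) * (fps_X * ?A (1/2)) = fps_const 4 * (size_fps * size_fps)"
    unfolding geometric_compose_half by (simp add: numeral_fps_const)
  also have "fps_nth (fps_const 4 * (size_fps * size_fps)) (Suc (Suc m)) = 8 * size_prob (Suc k)"
    unfolding size_fps_square by (simp add: numeral_fps_const size_fps_def Suc fps_X_def)
  also have "\<dots> \<le> 8 * size_prob k" using size_prob_decreasing[of k] Suc by simp
  finally show ?thesis .
qed (simp add: size_weight_0)

section \<open>Balls in the conditioned cluster\<close>

text \<open>The trees of size \<open>k\<close> whose ball of radius \<open>r\<close> is \<open>t\<close>, weighted with root age \<open>b\<close>.\<close>

definition ball_weight :: "nat \<Rightarrow> rtree \<Rightarrow> nat \<Rightarrow> real \<Rightarrow> real" where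
  "ball_weight r t k b = (\<Sum>u | rtree_ball r u = t \<and> num_vertices u = k. tree_weight u b)"

text \<open>The sum of \<open>ball_weight\<close> over all sizes, computed recursively.\<close>

fun ball_total :: "nat \<Rightarrow> rtree \<Rightarrow> real \<Rightarrow> real" where
  "ball_total 0 t b = (if t = Node {#} then 1 / (1 - age_param b)^2 else 0)"
| "ball_total (Suc r) t b = multiset_weight (\<lambda>c. edge_op (ball_total r c) b) (subtrees t)"

text \<open>The limit of \<open>ball_weight r t k b / size_prob k\<close>: the same recursion, except that one of the branches is very large.\<close>

fun ball_spine :: "nat \<Rightarrow> rtree \<Rightarrow> real \<Rightarrow> real" where
  "ball_spine 0 t b = (if t = Node {#} then 2 * age_param b / (1 - age_param b)^3 else 0)"
| "ball_spine (Suc r) t b = multiset_weight_deriv (\<lambda>c. edge_op (ball_total r c) b)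
     (\<lambda>c. edge_op (ball_spine r c) b) (subtrees t)"

declare ball_total.simps(2) [simp del] ball_spine.simps(2) [simp del]

lemma finite_trees_ball [simp]: "finite {u. rtree_ball r u = t \<and> num_vertices u = k}"
  by (rule finite_subset[OF _ finite_trees_bounded_size[of k]]) auto

lemma tempered_ball_weight [tempered_intros]: "tempered (ball_weight r t k)"
  unfolding ball_weight_def by (intro tempered_sum tempered_tree_weight)

lemma tempered_age_param_power: "tempered (\<lambda>b. 1 / (1 - age_param b) ^ n)"
proof -
  have "\<bar>1 / (1 - age_param a)\<bar> \<le> 2" for a
    using age_param_bounds(2)[of a] by (simp add: abs_divide divide_le_eq)
  moreover have "(\<lambda>b. 1 / (1 - age_param b)) \<in> borel_measurable borel"
    unfolding age_param_def by measurable
  ultimately have "tempered (\<lambda>b. 1 / (1 - age_param b))" unfolding tempered_def by blast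
  from tempered_power[OF this, of n] show ?thesis by (simp add: power_divide)
qed

lemma tempered_ball_total [tempered_intros]: "tempered (ball_total r t)"
proof (induction r arbitrary: t)
  case 0
  show ?case by (cases "t = Node {#}") (simp_all add: tempered_const tempered_age_param_power)
next
  case (Suc r)
  then show ?case unfolding ball_total.simps(2)[abs_def] by (intro tempered_multiset_weight tempered_edge_op)
qed

lemma tempered_ball_spine [tempered_intros]: "tempered (ball_spine r t)"
proof (induction r arbitrary: t)
  case 0
  have "tempered (\<lambda>b. (2 * age_param b) * (1 / (1 - age_param b)^3))"
    by (intro tempered_mult tempered_const tempered_age_param tempered_age_param_power)
  then show ?case by (cases "t = Node {#}") (simp_all add: tempered_const)
next
  case (Suc r)
  then show ?case unfolding ball_spine.simps(2)[abs_def]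
    by (intro tempered_multiset_weight_deriv tempered_edge_op tempered_ball_total)
qed

lemma ball_weight_nonneg: "0 \<le> b \<Longrightarrow> 0 \<le> ball_weight r t k b"
  unfolding ball_weight_def by (intro sum_nonneg tree_weight_nonneg)

lemma ball_weight_le:
  assumes "0 \<le> b" shows "ball_weight r t k b \<le> 8 * size_prob k"
proof -
  have "ball_weight r t k b \<le> size_weight k b"
    unfolding ball_weight_def size_weight_def using assms by (intro sum_mono2 tree_weight_nonneg) auto
  also have "\<dots> \<le> 8 * size_prob k" by (rule size_weight_le[OF assms])
  finally show ?thesis .
qed

text \<open>Asymptotics may be integrated over the age, by dominated convergence: the bound by a multiple of \<open>size_prob k\<close> is
  uniform in the age.\<close>

lemma size_asymp_integral:
  assumes f: "\<And>k. tempered (f k)" "\<And>k a. 0 \<le> a \<Longrightarrow> f k a \<le> C * size_prob k"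
    and asy: "\<And>a. 0 \<le> a \<Longrightarrow> size_asymp (\<lambda>k. f k a) (l a) (A a)"
    and lA: "tempered l" "tempered A" and w: "tempered w" "\<And>a. 0 \<le> a \<Longrightarrow> 0 \<le> w a"
  shows "size_asymp (\<lambda>k. \<integral>a. w a * f k a \<partial>exp_age) (\<integral>a. w a * l a \<partial>exp_age) (\<integral>a. w a * A a \<partial>exp_age)"
proof -
  note [measurable] = f(1)[THEN tempered_measurable] lA[THEN tempered_measurable] w(1)[THEN tempered_measurable]
  have fn: "0 \<le> f k a" if "0 \<le> a" for k a using asy[OF that] by (simp add: size_asymp_def)
  have C: "0 \<le> C"
  proof -
    have "0 \<le> C * size_prob 1" using fn[of 0 1] f(2)[of 0 1] by linarith
    then show ?thesis using size_prob_pos[of 1] by (simp add: zero_le_mult_iff)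
  qed
  have wC: "integrable exp_age (\<lambda>a. w a * C)" by (intro integrable_tempered tempered_mult tempered_const w)
  have nn: "0 \<le> (\<integral>a. w a * f k a \<partial>exp_age)" for k
  proof (rule integral_nonneg_AE)
    show "AE a in exp_age. 0 \<le> w a * f k a"
      using AE_exp_age_nonneg by eventually_elim (use fn w in simp)
  qed
  have int: "integrable exp_age (\<lambda>a. w a * f k a)" for k by (intro integrable_tempered tempered_mult f w)
  have "(\<lambda>k. \<integral>a. w a * f k a / size_prob k \<partial>exp_age) \<longlonglongrightarrow> (\<integral>a. w a * l a \<partial>exp_age)"
  proof (rule integral_dominated_convergence[OF _ _ wC])
    show "AE a in exp_age. (\<lambda>k. w a * f k a / size_prob k) \<longlonglongrightarrow> w a * l a"
      using AE_exp_age_nonneg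
    proof eventually_elim
      case (elim a)
      then have "(\<lambda>k. f k a / size_prob k) \<longlonglongrightarrow> l a" using asy by (simp add: size_asymp_def)
      from tendsto_mult_left[OF this, of "w a"] show ?case by simp
    qed
    show "AE a in exp_age. norm (w a * f k a / size_prob k) \<le> w a * C" for k
      using AE_exp_age_nonneg
    proof eventually_elim
      case (elim a)
      show ?case
      proof (cases "k = 0")
        case False
        then have "0 < size_prob k" by (intro size_prob_pos) simp
        moreover have "w a * f k a \<le> w a * (C * size_prob k)" using f(2)[OF elim] w(2)[OF elim] by (rule mult_left_mono)
        ultimately show ?thesis using fn[OF elim] w(2)[OF elim] by (simp add: divide_le_eq mult.assoc)
      qed (use w elim C in \<open>simp add: size_prob_0\<close>)
    qed
  qed measurable
  then have lim: "(\<lambda>k. (\<integral>a. w a * f k a \<partial>exp_age) / size_prob k) \<longlonglongrightarrow> (\<integral>a. w a * l a \<partial>exp_age)"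
    by simp
  have "(\<lambda>k. \<integral>a. w a * f k a \<partial>exp_age) sums (\<integral>a. (\<Sum>k. w a * f k a) \<partial>exp_age)"
  proof (rule sums_integral[OF int])
    show "AE a in exp_age. summable (\<lambda>k. norm (w a * f k a))"
      using AE_exp_age_nonneg
    proof eventually_elim
      case (elim a)
      have "summable (\<lambda>k. f k a)" using asy[OF elim] by (auto simp: size_asymp_def sums_iff)
      then show ?case using elim fn w(2) by (simp add: abs_mult summable_mult)
    qed
    show "summable (\<lambda>k. \<integral>a. norm (w a * f k a) \<partial>exp_age)"
    proof (rule summable_comparison_test')
      show "summable (\<lambda>k. (\<integral>a. w a * C \<partial>exp_age) * size_prob k)"
        by (intro summable_mult sums_summable[OF size_prob_sums])
      fix k :: nat
      have "(\<integral>a. norm (w a * f k a) \<partial>exp_age) \<le> (\<integral>a. w a * C * size_prob k \<partial>exp_age)"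
      proof (rule integral_mono_AE)
        show "AE a in exp_age. norm (w a * f k a) \<le> w a * C * size_prob k"
          using AE_exp_age_nonneg
        proof eventually_elim
          case (elim a)
          have "w a * f k a \<le> w a * (C * size_prob k)" using f(2)[OF elim] w(2)[OF elim] by (rule mult_left_mono)
          then show ?case using fn[OF elim] w(2)[OF elim] by (simp add: abs_mult mult.assoc)
        qed
      qed (intro integrable_norm int integrable_mult_left wC)+
      then show "norm (\<integral>a. norm (w a * f k a) \<partial>exp_age) \<le> (\<integral>a. w a * C \<partial>exp_age) * size_prob k" by simp
    qed
  qed
  also have "(\<integral>a. (\<Sum>k. w a * f k a) \<partial>exp_age) = (\<integral>a. w a * A a \<partial>exp_age)"
  proof (rule integral_cong_AE)
    show "AE a in exp_age. (\<Sum>k. w a * f k a) = w a * A a"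
      using AE_exp_age_nonneg
    proof eventually_elim
      case (elim a)
      then have "(\<lambda>k. w a * f k a) sums (w a * A a)" using asy by (intro sums_mult) (simp add: size_asymp_def)
      then show ?case by (rule sums_unique[symmetric])
    qed
  qed measurable
  finally show ?thesis using lim nn by (simp add: size_asymp_def)
qed

text \<open>A forest is built from its trees by convolution, so exactly one tree is large and the limit obeys the product rule.\<close>

lemma size_asymp_forest:
  fixes h :: "rtree \<Rightarrow> rtree"
  assumes "\<And>c. c \<in># m \<Longrightarrow> size_asymp (\<lambda>j. \<Sum>u | h u = c \<and> num_vertices u = j. v u) (L c) (V c)"
  shows "size_asymp (\<lambda>k. \<Sum>M | image_mset h M = m \<and> forest_size M = k. multiset_weight v M)
    (multiset_weight_deriv V L m) (multiset_weight V m)"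
  using assms
proof (induction m)
  case empty
  have "(\<Sum>M | image_mset h M = {#} \<and> forest_size M = k. multiset_weight v M) = (if k = 0 then 1 else 0)" for k
  proof (cases "k = 0")
    case True
    then have "{M. image_mset h M = {#} \<and> forest_size M = k} = {{#}}" by auto
    then show ?thesis using True by (simp only:) simp
  next
    case False
    then have "{M. image_mset h M = {#} \<and> forest_size M = k} = {}" by auto
    then show ?thesis using False by (simp only:) simp
  qed
  then show ?case using size_asymp_delta by (simp del: image_mset_is_empty_iff)
next
  case (add c m)
  let ?S = "\<lambda>m k. \<Sum>M | image_mset h M = m \<and> forest_size M = k. multiset_weight v M"
  let ?U = "\<lambda>j. \<Sum>u | h u = c \<and> num_vertices u = j. v u"
  let ?n = "real (Suc (count m c))"
  have "?n * ?S (add_mset c m) k = (\<Sum>j\<le>k. ?U j * ?S m (k - j))" for k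
    using multiset_weight_fibre_recursion[of c "add_mset c m", where h=h and v=v and k=k] by simp
  then have S: "?S (add_mset c m) k = 1 / ?n * (\<Sum>j\<le>k. ?U j * ?S m (k - j))" for k
    by (simp add: eq_divide_eq mult.commute del: of_nat_Suc)
  have "size_asymp (\<lambda>k. \<Sum>j\<le>k. ?U j * ?S m (k - j))
      (L c * multiset_weight V m + multiset_weight_deriv V L m * V c) (V c * multiset_weight V m)"
    by (intro size_asymp_convolution add) auto
  also have "L c * multiset_weight V m + multiset_weight_deriv V L m * V c = ?n * multiset_weight_deriv V L (add_mset c m)"
    by (simp only: multiset_weight_deriv_add mult.commute)
  also have "V c * multiset_weight V m = ?n * multiset_weight V (add_mset c m)"
    by (rule multiset_weight_add[symmetric])
  finally have "size_asymp (\<lambda>k. 1 / ?n * (\<Sum>j\<le>k. ?U j * ?S m (k - j)))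
      (1 / ?n * (?n * multiset_weight_deriv V L (add_mset c m))) (1 / ?n * (?n * multiset_weight V (add_mset c m)))"
    by (rule size_asymp_mult) simp
  then show ?case unfolding S by (simp del: of_nat_Suc)
qed

lemma edge_op_ball_weight:
  "edge_op (ball_weight r t k) b = (\<Sum>u | rtree_ball r u = t \<and> num_vertices u = k. edge_op (tree_weight u) b)"
  using edge_op_sum[of "{u. rtree_ball r u = t \<and> num_vertices u = k}" tree_weight "\<lambda>_. 1" b] tempered_tree_weight
  by (simp add: ball_weight_def[abs_def])

lemma size_asymp_ball_weight:
  "0 \<le> b \<Longrightarrow> size_asymp (\<lambda>k. ball_weight r t k b) (ball_spine r t b) (ball_total r t b)"
proof (induction r arbitrary: t b)
  case 0
  have "(\<lambda>k. ball_weight 0 t k b) = (if t = Node {#} then (\<lambda>k. size_weight k b) else (\<lambda>k. 0))"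
    by (auto simp: ball_weight_def size_weight_def)
  moreover have "size_asymp (\<lambda>k. 0) 0 0" by (simp add: size_asymp_def)
  ultimately show ?case using size_asymp_size_weight[OF 0] by simp
next
  case (Suc r)
  obtain m where t: "t = Node m" by (cases t)
  let ?v = "\<lambda>u. edge_op (tree_weight u) b"
  have "size_asymp (\<lambda>j. edge_op (ball_weight r c j) b) (edge_op (ball_spine r c) b) (edge_op (ball_total r c) b)" for c
    unfolding edge_op_def
    by (rule size_asymp_integral[where C=8])
      (use Suc in \<open>auto intro: tempered_ball_weight tempered_ball_spine tempered_ball_total tempered_min ball_weight_le\<close>)
  then have "size_asymp (\<lambda>k. \<Sum>M | image_mset (rtree_ball r) M = m \<and> forest_size M = k. multiset_weight ?v M)
     (ball_spine (Suc r) t b) (ball_total (Suc r) t b)"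
    unfolding ball_spine.simps(2) ball_total.simps(2) t rtree.sel edge_op_ball_weight by (rule size_asymp_forest)
  from size_asymp_shift[OF this] show ?case
  proof (rule back_subst[of "\<lambda>f. size_asymp f _ _"])
    show "(\<lambda>k. case k of 0 \<Rightarrow> 0 | Suc j \<Rightarrow> \<Sum>M | image_mset (rtree_ball r) M = m \<and> forest_size M = j. multiset_weight ?v M) =
        (\<lambda>k. ball_weight (Suc r) t k b)"
    proof (rule ext)
      fix k
      show "(case k of 0 \<Rightarrow> 0 | Suc j \<Rightarrow> \<Sum>M | image_mset (rtree_ball r) M = m \<and> forest_size M = j. multiset_weight ?v M) =
          ball_weight (Suc r) t k b"
      proof (cases k)
        case 0
        have "{u. rtree_ball (Suc r) u = t \<and> num_vertices u = 0} = {}"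
          using num_vertices_pos by (metis (mono_tags, lifting) empty_Collect_eq less_irrefl)
        then show ?thesis unfolding 0 ball_weight_def by (simp only:) simp
      next
        case (Suc j)
        have "ball_weight (Suc r) t k b = (\<Sum>M | image_mset (rtree_ball r) M = m \<and> forest_size M = j. tree_weight (Node M) b)"
          unfolding ball_weight_def
        proof (rule sum.reindex_bij_witness[of _ Node subtrees])
          fix u assume u: "u \<in> {u. rtree_ball (Suc r) u = t \<and> num_vertices u = k}"
          obtain M where "u = Node M" by (cases u)
          then show "Node (subtrees u) = u" "subtrees u \<in> {M. image_mset (rtree_ball r) M = m \<and> forest_size M = j}"
            "tree_weight (Node (subtrees u)) b = tree_weight u b"
            using u by (auto simp: t Suc)
        qed (auto simp: t Suc)
        then show ?thesis by (simp add: Suc tree_weight.simps)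
      qed
    qed
  qed
qed

lemma pmf_conditioned_ball:
  assumes "1 \<le> k"
  shows "pmf (map_pmf (rtree_ball r) (cond_pmf steady_state_cluster {t. num_vertices t = k})) t =
    (\<integral>a. ball_weight r t k a \<partial>exp_age) / size_prob k"
proof -
  let ?B = "{t. num_vertices t = k}" and ?C = steady_state_cluster
  let ?A = "{u. rtree_ball r u = t \<and> num_vertices u = k}"
  have ne: "set_pmf ?C \<inter> ?B \<noteq> {}" using steady_state_cluster_size_pos[of "k - 1"] assms by simp
  have p: "measure ?C ?B = size_prob k" by (simp add: size_pmf_def pmf_map vimage_def)
  have "pmf (map_pmf (rtree_ball r) (cond_pmf ?C ?B)) t = measure (cond_pmf ?C ?B) ((rtree_ball r -` {t}) \<inter> set_pmf (cond_pmf ?C ?B))"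
    by (simp add: pmf_map measure_Int_set_pmf)
  also have "(rtree_ball r -` {t}) \<inter> set_pmf (cond_pmf ?C ?B) = ?A \<inter> set_pmf (cond_pmf ?C ?B)"
    using ne by (auto simp: set_cond_pmf)
  also have "measure (cond_pmf ?C ?B) \<dots> = (\<Sum>u\<in>?A. pmf (cond_pmf ?C ?B) u)"
    by (simp add: measure_Int_set_pmf measure_measure_pmf_finite)
  also have "\<dots> = (\<Sum>u\<in>?A. total_weight u / size_prob k)"
    using ne by (intro sum.cong refl) (simp add: pmf_cond p pmf_steady_state_cluster)
  also have "\<dots> = (\<integral>a. ball_weight r t k a \<partial>exp_age) / size_prob k"
    unfolding ball_weight_def
    by (subst Bochner_Integration.integral_sum)
      (auto simp: total_weight_def sum_divide_distrib intro: integrable_tempered tempered_tree_weight)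
  finally show ?thesis .
qed

lemma conditioned_ball_limit:
  "(\<lambda>k. pmf (map_pmf (rtree_ball r) (cond_pmf steady_state_cluster {t. num_vertices t = k})) t)
     \<longlonglongrightarrow> (\<integral>a. ball_spine r t a \<partial>exp_age)"
proof -
  have "size_asymp (\<lambda>k. \<integral>a. 1 * ball_weight r t k a \<partial>exp_age)
      (\<integral>a. 1 * ball_spine r t a \<partial>exp_age) (\<integral>a. 1 * ball_total r t a \<partial>exp_age)"
    by (rule size_asymp_integral[where C=8])
      (auto intro: tempered_ball_weight tempered_ball_spine tempered_ball_total tempered_const ball_weight_le size_asymp_ball_weight)
  then have "(\<lambda>k. (\<integral>a. ball_weight r t k a \<partial>exp_age) / size_prob k) \<longlonglongrightarrow> (\<integral>a. ball_spine r t a \<partial>exp_age)"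
    by (simp add: size_asymp_def)
  moreover have "\<forall>\<^sub>F k in sequentially. (\<integral>a. ball_weight r t k a \<partial>exp_age) / size_prob k =
      pmf (map_pmf (rtree_ball r) (cond_pmf steady_state_cluster {t. num_vertices t = k})) t"
    using eventually_ge_at_top[of 1] by eventually_elim (simp add: pmf_conditioned_ball)
  ultimately show ?thesis by (rule Lim_transform_eventually)
qed

section \<open>The Markov structure of the configuration\<close>

abbreviation config_space :: "configuration measure" where
  "config_space \<equiv> \<Pi>\<^sub>M i\<in>UNIV. vertex_space"

lemma space_vertex_space [simp]: "space vertex_space = UNIV"
  by (simp add: vertex_space_def space_pair_measure space_PiM)

lemma space_configuration_law [simp]: "space configuration_law = UNIV"
  using sets_eq_imp_space_eq[OF sets_configuration_law] by (simp add: space_PiM)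

lemma measurable_vertex [measurable]: "(\<lambda>\<omega>. \<omega> n) \<in> config_space \<rightarrow>\<^sub>M vertex_space"
  by (rule measurable_component_singleton) simp

definition vertex_given_age :: "real measure \<Rightarrow> (real \<times> nat \<times> (nat \<Rightarrow> real)) measure" where
  "vertex_given_age \<mu> = \<mu> \<bind> (\<lambda>b. poisson_process (offspring_intensity b) \<bind> (\<lambda>c. return vertex_space (b, c)))"

definition child_age_law :: "nat \<Rightarrow> real \<times> nat \<times> (nat \<Rightarrow> real) \<Rightarrow> real measure" where
  "child_age_law i x = (case i of 0 \<Rightarrow> spinal_age_law (fst x) | Suc j \<Rightarrow> return borel (snd (snd x) j))"

text \<open>The law of a vertex depends on the past only through its parent.\<close>

lemma vertex_law_child: "vertex_law (child v i) \<omega> = vertex_given_age (child_age_law i (\<omega> v))"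
  by (cases i) (simp_all add: vertex_law_def vertex_given_age_def child_age_law_def age_law_child vertex_age_def nonspinal_age_def)

lemma measurable_offspring_kernel [measurable]:
  "(\<lambda>b. poisson_process (offspring_intensity b) \<bind> (\<lambda>c. return vertex_space (b, c))) \<in> borel \<rightarrow>\<^sub>M prob_algebra vertex_space"
  unfolding vertex_space_def
  by (rule measurable_bind_prob_space2[OF measurable_poisson_process_offspring]) measurable

lemma measurable_child_age_law [measurable]: "child_age_law i \<in> vertex_space \<rightarrow>\<^sub>M prob_algebra borel"
proof (cases i)
  case 0
  show ?thesis unfolding 0 child_age_law_def vertex_space_def nat.case
    by (rule measurable_compose[OF measurable_fst measurable_spinal_age_law])
next
  case (Suc j)
  have "(\<lambda>x. snd (snd x) j) \<in> vertex_space \<rightarrow>\<^sub>M (borel :: real measure)"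
    unfolding vertex_space_def by measurable
  from measurable_compose[OF this measurable_return_prob_space] show ?thesis
    unfolding Suc child_age_law_def nat.case .
qed

lemma measurable_child_kernel [measurable]:
  "(\<lambda>x. vertex_given_age (child_age_law i x)) \<in> vertex_space \<rightarrow>\<^sub>M prob_algebra vertex_space"
  unfolding vertex_given_age_def
  by (rule measurable_bind_prob_space[OF measurable_child_age_law measurable_offspring_kernel])

definition child_op :: "nat \<Rightarrow> (real \<times> nat \<times> (nat \<Rightarrow> real) \<Rightarrow> ennreal) \<Rightarrow> real \<times> nat \<times> (nat \<Rightarrow> real) \<Rightarrow> ennreal" where
  "child_op i f x = (\<integral>\<^sup>+y. f y \<partial>vertex_given_age (child_age_law i x))"

lemma measurable_child_op [measurable]:
  assumes "f \<in> borel_measurable vertex_space" shows "child_op i f \<in> borel_measurable vertex_space"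
  unfolding child_op_def
  by (rule measurable_compose[OF measurable_prob_algebraD[OF measurable_child_kernel] nn_integral_measurable_subprob_algebra[OF assms]])

lemma child_op_mono: "(\<And>y. f y \<le> g y) \<Longrightarrow> child_op i f x \<le> child_op i g x"
  unfolding child_op_def by (intro nn_integral_mono) auto

lemma nn_integral_configuration_law_initial:
  assumes G[measurable]: "G \<in> borel_measurable (\<Pi>\<^sub>M i\<in>{0..<N}. vertex_space)"
  shows "(\<integral>\<^sup>+\<omega>. G (restrict \<omega> {0..<N}) \<partial>configuration_law) = (\<integral>\<^sup>+\<omega>. G \<omega> \<partial>hat_H.C 0 N (\<lambda>_. undefined))"
proof -
  have up: "hat_H.up_to {0..<N} = N"
    by (rule antisym) (auto simp: hat_H.up_to_iff, metis atLeastLessThan_iff finite_atLeastLessThan hat_H.up_to_less le0 less_irrefl not_le)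
  have u: "(\<lambda>_. undefined) \<in> space (\<Pi>\<^sub>M i\<in>{0..<0::nat}. vertex_space)" by (simp add: space_PiM)
  have "(\<integral>\<^sup>+\<omega>. G (restrict \<omega> {0..<N}) \<partial>configuration_law) =
      (\<integral>\<^sup>+\<omega>. G \<omega> \<partial>distr configuration_law (\<Pi>\<^sub>M i\<in>{0..<N}. vertex_space) (\<lambda>\<omega>. restrict \<omega> {0..<N}))"
    by (subst nn_integral_distr) (auto intro!: measurable_restrict_subset simp: measurable_cong_sets[OF sets_configuration_law refl])
  also have "distr configuration_law (\<Pi>\<^sub>M i\<in>{0..<N}. vertex_space) (\<lambda>\<omega>. restrict \<omega> {0..<N}) = hat_H.CI {0..<N}"
    unfolding configuration_law_def by (rule hat_H.distr_lim) simp
  also have "(\<integral>\<^sup>+\<omega>. G \<omega> \<partial>hat_H.CI {0..<N}) = (\<integral>\<^sup>+\<omega>. G (restrict \<omega> {0..<N}) \<partial>hat_H.C 0 N (\<lambda>_. undefined))"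
    unfolding hat_H.CI_def up
    by (subst nn_integral_distr) (auto simp: measurable_cong_sets[OF hat_H.sets_C[OF u] refl] intro!: measurable_restrict_subset)
  also have "\<dots> = (\<integral>\<^sup>+\<omega>. G \<omega> \<partial>hat_H.C 0 N (\<lambda>_. undefined))"
    by (rule nn_integral_cong) (auto simp: hat_H.space_C[OF u] space_PiM PiE_def extensional_restrict)
  finally show ?thesis .
qed

lemma emeasure_configuration_law: "emeasure configuration_law UNIV = 1"
proof -
  have u: "(\<lambda>_. undefined) \<in> space (\<Pi>\<^sub>M i\<in>{0..<0::nat}. vertex_space)" by (simp add: space_PiM)
  have "emeasure configuration_law UNIV = (\<integral>\<^sup>+\<omega>. (\<lambda>_. 1) (restrict \<omega> {0..<0}) \<partial>configuration_law)" by simp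
  also have "\<dots> = (\<integral>\<^sup>+\<omega>. 1 \<partial>hat_H.C 0 0 (\<lambda>_. undefined))"
    by (rule nn_integral_configuration_law_initial) simp
  also have "\<dots> = 1" using prob_space.emeasure_space_1[OF hat_H.prob_space_C[OF u, of 0]] by simp
  finally show ?thesis .
qed

text \<open>Measurability with respect to the labels in \<open>J\<close>, in a form that composes easily.\<close>

definition depends_on :: "nat set \<Rightarrow> (configuration \<Rightarrow> 'a) \<Rightarrow> bool" where
  "depends_on J G \<longleftrightarrow> (\<forall>\<omega> \<omega>'. (\<forall>n\<in>J. \<omega> n = \<omega>' n) \<longrightarrow> G \<omega> = G \<omega>')"

lemma depends_on_restrict: "depends_on J G \<Longrightarrow> G (restrict \<omega> J) = G \<omega>"
  unfolding depends_on_def by (metis restrict_apply')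

lemma depends_on_mono: "depends_on J G \<Longrightarrow> J \<subseteq> J' \<Longrightarrow> depends_on J' G"
  unfolding depends_on_def by blast

lemma measurable_depends_on:
  assumes G: "G \<in> borel_measurable config_space"
  shows "G \<in> borel_measurable (\<Pi>\<^sub>M i\<in>J. vertex_space)"
proof -
  let ?e = "\<lambda>x n. if n \<in> J then x n else undefined"
  have "?e \<in> (\<Pi>\<^sub>M i\<in>J. vertex_space) \<rightarrow>\<^sub>M config_space"
  proof (rule measurable_PiM_single')
    show "(\<lambda>x. ?e x n) \<in> (\<Pi>\<^sub>M i\<in>J. vertex_space) \<rightarrow>\<^sub>M vertex_space" for n
      by (cases "n \<in> J") (auto intro: measurable_component_singleton)
  qed (auto simp: space_PiM)
  from measurable_compose[OF this G] have "(\<lambda>x. G (?e x)) \<in> borel_measurable (\<Pi>\<^sub>M i\<in>J. vertex_space)" .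
  moreover have "?e x = x" if "x \<in> space (\<Pi>\<^sub>M i\<in>J. vertex_space)" for x
    using that by (auto simp: space_PiM PiE_def extensional_def)
  ultimately show ?thesis by (simp cong: measurable_cong)
qed

text \<open>One step of the construction of the law from its successive conditional laws.\<close>

lemma configuration_law_step:
  assumes G[measurable]: "G \<in> borel_measurable config_space" and dep: "depends_on {0..<N} G"
    and f[measurable]: "f \<in> borel_measurable vertex_space"
  shows "(\<integral>\<^sup>+\<omega>. G \<omega> * f (\<omega> N) \<partial>configuration_law) =
    (\<integral>\<^sup>+\<omega>. G \<omega> * (\<integral>\<^sup>+y. f y \<partial>vertex_law N (restrict \<omega> {0..<N})) \<partial>configuration_law)"
proof -
  let ?P = "\<lambda>N. \<Pi>\<^sub>M i\<in>{0..<N}. vertex_space"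
  let ?u = "\<lambda>_::nat. undefined :: real \<times> nat \<times> (nat \<Rightarrow> real)"
  have u: "?u \<in> space (?P 0)" by (simp add: space_PiM)
  have GN[measurable]: "G \<in> borel_measurable (?P N)" for N by (rule measurable_depends_on[OF G])
  have H: "(\<lambda>\<omega>. G (restrict \<omega> {0..<N}) * f (\<omega> N)) \<in> borel_measurable (?P (Suc N))"
  proof (intro borel_measurable_times_ennreal)
    show "(\<lambda>\<omega>. G (restrict \<omega> {0..<N})) \<in> borel_measurable (?P (Suc N))"
      by (rule measurable_compose[OF measurable_restrict_subset GN]) auto
    show "(\<lambda>\<omega>. f (\<omega> N)) \<in> borel_measurable (?P (Suc N))"
      by (rule measurable_compose[OF measurable_component_singleton[of N "{0..<Suc N}" "\<lambda>_. vertex_space"] f]) simp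
  qed
  have "(\<integral>\<^sup>+\<omega>. G \<omega> * f (\<omega> N) \<partial>configuration_law) =
      (\<integral>\<^sup>+\<omega>. (\<lambda>\<omega>. G (restrict \<omega> {0..<N}) * f (\<omega> N)) (restrict \<omega> {0..<Suc N}) \<partial>configuration_law)"
    using depends_on_restrict[OF dep] by (intro nn_integral_cong) (simp add: min_absorb1 Int_absorb1)
  also have "\<dots> = (\<integral>\<^sup>+\<omega>. G (restrict \<omega> {0..<N}) * f (\<omega> N) \<partial>hat_H.C 0 (Suc N) ?u)"
    by (rule nn_integral_configuration_law_initial[OF H])
  also have "hat_H.C 0 (Suc N) ?u = hat_H.C 0 N ?u \<bind> hat_H.eP N" by simp
  also have "(\<integral>\<^sup>+\<omega>. G (restrict \<omega> {0..<N}) * f (\<omega> N) \<partial>(hat_H.C 0 N ?u \<bind> hat_H.eP N)) =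
      (\<integral>\<^sup>+\<omega>. \<integral>\<^sup>+\<omega>'. G (restrict \<omega>' {0..<N}) * f (\<omega>' N) \<partial>hat_H.eP N \<omega> \<partial>hat_H.C 0 N ?u)"
    by (rule nn_integral_bind[OF H]) (use hat_H.measurable_eP[of N] in \<open>simp add: measurable_cong_sets[OF hat_H.sets_C[OF u] refl]\<close>)
  also have "\<dots> = (\<integral>\<^sup>+\<omega>. G \<omega> * (\<integral>\<^sup>+y. f y \<partial>vertex_law N \<omega>) \<partial>hat_H.C 0 N ?u)"
  proof (rule nn_integral_cong)
    fix \<omega> assume "\<omega> \<in> space (hat_H.C 0 N ?u)"
    then have \<omega>: "\<omega> \<in> space (?P N)" by (simp add: hat_H.space_C[OF u])
    have "(\<integral>\<^sup>+\<omega>'. G (restrict \<omega>' {0..<N}) * f (\<omega>' N) \<partial>hat_H.eP N \<omega>) =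
        (\<integral>\<^sup>+y. G (restrict (fun_upd \<omega> N y) {0..<N}) * f ((fun_upd \<omega> N y) N) \<partial>vertex_law N \<omega>)"
      by (rule hat_H.nn_integral_eP[OF \<omega> H])
    also have "\<dots> = (\<integral>\<^sup>+y. G \<omega> * f y \<partial>vertex_law N \<omega>)"
      using depends_on_restrict[OF dep] dep by (intro nn_integral_cong) (auto simp: depends_on_def intro!: arg_cong2[where f="(*)"])
    also have "\<dots> = G \<omega> * (\<integral>\<^sup>+y. f y \<partial>vertex_law N \<omega>)"
      using hat_H.sets_P[OF \<omega>] f by (intro nn_integral_cmult) (simp cong: measurable_cong_sets)
    finally show "(\<integral>\<^sup>+\<omega>'. G (restrict \<omega>' {0..<N}) * f (\<omega>' N) \<partial>hat_H.eP N \<omega>) = G \<omega> * (\<integral>\<^sup>+y. f y \<partial>vertex_law N \<omega>)" .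
  qed
  also have "\<dots> = (\<integral>\<^sup>+\<omega>. (\<lambda>\<omega>. G \<omega> * (\<integral>\<^sup>+y. f y \<partial>vertex_law N \<omega>)) (restrict \<omega> {0..<N}) \<partial>configuration_law)"
  proof (rule nn_integral_configuration_law_initial[symmetric])
    have "(\<lambda>\<omega>. \<integral>\<^sup>+y. f y \<partial>vertex_law N \<omega>) \<in> borel_measurable (?P N)"
      by (rule measurable_compose[OF measurable_prob_algebraD[OF measurable_vertex_law] nn_integral_measurable_subprob_algebra[OF f]])
    then show "(\<lambda>\<omega>. G \<omega> * (\<integral>\<^sup>+y. f y \<partial>vertex_law N \<omega>)) \<in> borel_measurable (?P N)" by measurable
  qed
  finally show ?thesis by (simp add: depends_on_restrict[OF dep])
qed

lemma less_child: "v < child v i"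
  using le_prod_encode_1[of v i] by (simp add: child_def)

lemma configuration_law_child_step:
  assumes G[measurable]: "G \<in> borel_measurable config_space" and dep: "depends_on {0..<child v i} G"
    and f[measurable]: "f \<in> borel_measurable vertex_space"
  shows "(\<integral>\<^sup>+\<omega>. G \<omega> * f (\<omega> (child v i)) \<partial>configuration_law) =
    (\<integral>\<^sup>+\<omega>. G \<omega> * child_op i f (\<omega> v) \<partial>configuration_law)"
  using configuration_law_step[OF assms] less_child[of v i] by (simp add: vertex_law_child child_op_def)

inductive descendant :: "nat \<Rightarrow> nat \<Rightarrow> bool" for w where
  descendant_refl: "descendant w w"
| descendant_child: "descendant w v \<Longrightarrow> descendant w (child v i)"

lemma child_inject [simp]: "child v i = child v' i' \<longleftrightarrow> v = v' \<and> i = i'"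
  by (simp add: child_def)

lemma child_cases: obtains "n = 0" | v i where "n = child v i"
proof (cases n)
  case (Suc m)
  obtain v i where "prod_decode m = (v, i)" by fastforce
  then have "n = child v i" using Suc by (metis child_def prod_decode_inverse)
  then show thesis by (rule that)
qed (use that in blast)

lemma descendant_le: "descendant w v \<Longrightarrow> w \<le> v"
proof (induction rule: descendant.induct)
  case (descendant_child v i)
  then show ?case using less_child[of v i] by linarith
qed simp

lemma descendant_childD: "descendant w (child u i) \<Longrightarrow> child u i = w \<or> descendant w u"
  by (cases rule: descendant.cases) auto

lemma descendant_trans: "descendant v w \<Longrightarrow> descendant u v \<Longrightarrow> descendant u w"
  by (induction rule: descendant.induct) (auto intro: descendant.intros)

lemma descendant_linear: "descendant a n \<Longrightarrow> descendant b n \<Longrightarrow> descendant a b \<or> descendant b a"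
proof (induction rule: descendant.induct)
  case (descendant_child v i)
  then show ?case using descendant_childD[of b v i] descendant.descendant_child[of a v i] by auto
qed simp

lemma descendant_siblings:
  assumes "descendant (child v i) n" "descendant (child v j) n" shows "i = j"
proof -
  have "descendant (child v i) (child v j) \<or> descendant (child v j) (child v i)"
    by (rule descendant_linear[OF assms])
  then show ?thesis
    using descendant_childD descendant_le less_child by (metis child_inject not_le)
qed

lemma not_descendant_parent: "\<not> descendant (child v i) v"
  using descendant_le less_child by (metis not_le)

text \<open>For functions of the form of a product over labels, the labels larger than \<open>child v i\<close> are integrated out from the largest
  one downwards. Each of them is either a descendant of \<open>child v i\<close>, where the factor is \<open>1\<close>, or its integral is absorbed
  into the factor of its parent, which is not a descendant either.\<close>

lemma configuration_law_product_step:
  assumes g: "\<And>n. g n \<in> borel_measurable vertex_space" and g1: "\<And>n. descendant (child v i) n \<Longrightarrow> g n = (\<lambda>_. 1)"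
    and f[measurable]: "f \<in> borel_measurable vertex_space" and N: "Suc (child v i) \<le> N"
  shows "(\<integral>\<^sup>+\<omega>. (\<Prod>n<N. g n (\<omega> n)) * f (\<omega> (child v i)) \<partial>configuration_law) =
    (\<integral>\<^sup>+\<omega>. (\<Prod>n<N. g n (\<omega> n)) * child_op i f (\<omega> v) \<partial>configuration_law)"
  using N g g1
proof (induction N arbitrary: g rule: dec_induct)
  case base
  note [measurable] = base(1)
  have "(\<integral>\<^sup>+\<omega>. (\<Prod>n<child v i. g n (\<omega> n)) * f (\<omega> (child v i)) \<partial>configuration_law) =
      (\<integral>\<^sup>+\<omega>. (\<Prod>n<child v i. g n (\<omega> n)) * child_op i f (\<omega> v) \<partial>configuration_law)"
    by (rule configuration_law_child_step) (auto simp: depends_on_def)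
  then show ?case using base(2)[OF descendant_refl] by simp
next
  case (step N)
  note [measurable] = step.prems(1)
  let ?w = "child v i"
  obtain u j where N: "N = child u j" using step.hyps by (cases N rule: child_cases) auto
  show ?case
  proof (cases "descendant ?w N")
    case True
    then show ?thesis using step.IH[OF step.prems] step.prems(2)[OF True] by simp
  next
    case False
    then have u: "\<not> descendant ?w u" using N descendant_child by blast
    have uN: "u < N" using less_child N by simp
    let ?h = "child_op j (g N)"
    define g' where "g' = g(u := (\<lambda>x. g u x * ?h x))"
    have g'm: "g' n \<in> borel_measurable vertex_space" for n unfolding g'_def by (cases "n = u") simp_all
    have g'1: "g' n = (\<lambda>_. 1)" if "descendant ?w n" for n using that u step.prems(2) by (auto simp: g'_def)
    have prod': "(\<Prod>n<N. g' n (\<omega> n)) = (\<Prod>n<N. g n (\<omega> n)) * ?h (\<omega> u)" for \<omega>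
    proof -
      have "(\<Prod>n<N. g' n (\<omega> n)) = g' u (\<omega> u) * (\<Prod>n\<in>{..<N} - {u}. g' n (\<omega> n))"
        using uN by (intro prod.remove) auto
      also have "(\<Prod>n\<in>{..<N} - {u}. g' n (\<omega> n)) = (\<Prod>n\<in>{..<N} - {u}. g n (\<omega> n))"
        by (intro prod.cong) (auto simp: g'_def)
      also have "g' u (\<omega> u) * \<dots> = (g u (\<omega> u) * (\<Prod>n\<in>{..<N} - {u}. g n (\<omega> n))) * ?h (\<omega> u)"
        by (simp add: g'_def mult_ac)
      also have "g u (\<omega> u) * (\<Prod>n\<in>{..<N} - {u}. g n (\<omega> n)) = (\<Prod>n<N. g n (\<omega> n))"
        using uN by (intro prod.remove[symmetric]) auto
      finally show ?thesis .
    qed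
    \<comment> \<open>Integrating out the label \<open>N\<close> modifies the factor of its parent \<open>u\<close> only.\<close>
    have elim: "(\<integral>\<^sup>+\<omega>. (\<Prod>n<Suc N. g n (\<omega> n)) * F (\<omega> m) \<partial>configuration_law) =
        (\<integral>\<^sup>+\<omega>. (\<Prod>n<N. g' n (\<omega> n)) * F (\<omega> m) \<partial>configuration_law)"
      if [measurable]: "F \<in> borel_measurable vertex_space" and m: "m < N" for F m
    proof -
      have "(\<integral>\<^sup>+\<omega>. ((\<Prod>n<N. g n (\<omega> n)) * F (\<omega> m)) * g N (\<omega> (child u j)) \<partial>configuration_law) =
          (\<integral>\<^sup>+\<omega>. ((\<Prod>n<N. g n (\<omega> n)) * F (\<omega> m)) * child_op j (g N) (\<omega> u) \<partial>configuration_law)"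
        by (rule configuration_law_child_step) (use m in \<open>auto simp: depends_on_def N[symmetric]\<close>)
      then show ?thesis by (simp add: prod' N[symmetric] mult_ac)
    qed
    have "?w < N" "v < N" using step.hyps less_child[of v i] by linarith+
    then show ?thesis
      using step.IH[OF g'm g'1] by (simp only: elim f measurable_child_op)
  qed
qed

text \<open>Both sides are integrals of \<open>G\<close> against measures on the labels outside the subtree, and these measures agree on
  cylinder sets by \<open>configuration_law_product_step\<close>. The bound on \<open>f\<close> makes them finite.\<close>

lemma configuration_law_branching_step_bounded:
  assumes G[measurable]: "G \<in> borel_measurable config_space" and dep: "depends_on {n. \<not> descendant (child v i) n} G"
    and f[measurable]: "f \<in> borel_measurable vertex_space" and f1: "\<And>x. f x \<le> of_nat C"
  shows "(\<integral>\<^sup>+\<omega>. G \<omega> * f (\<omega> (child v i)) \<partial>configuration_law) =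
    (\<integral>\<^sup>+\<omega>. G \<omega> * child_op i f (\<omega> v) \<partial>configuration_law)"
proof -
  let ?w = "child v i"
  let ?J = "{n. \<not> descendant ?w n}"
  let ?P = "\<Pi>\<^sub>M i\<in>?J. vertex_space"
  let ?\<mu> = "\<lambda>F. distr (density configuration_law F) ?P (\<lambda>\<omega>. restrict \<omega> ?J)"
  have r[measurable]: "(\<lambda>\<omega>. restrict \<omega> ?J) \<in> config_space \<rightarrow>\<^sub>M ?P" by (rule measurable_restrict_subset) simp
  have sets_dens: "sets (density configuration_law F) = sets config_space" for F by (simp add: sets_configuration_law)
  have F1[measurable]: "(\<lambda>\<omega>. f (\<omega> ?w)) \<in> borel_measurable config_space" by measurable
  have F2[measurable]: "(\<lambda>\<omega>. child_op i f (\<omega> v)) \<in> borel_measurable config_space" by measurable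
  have GJ: "G \<in> borel_measurable ?P" by (rule measurable_depends_on[OF G])
  have int: "(\<integral>\<^sup>+\<omega>. H \<omega> * F \<omega> \<partial>configuration_law) = (\<integral>\<^sup>+\<omega>. H \<omega> \<partial>?\<mu> F)"
    if H: "H \<in> borel_measurable ?P" "\<And>\<omega>. H (restrict \<omega> ?J) = H \<omega>" and F[measurable]: "F \<in> borel_measurable config_space" for H F
  proof -
    have Hc[measurable]: "(\<lambda>\<omega>. H (restrict \<omega> ?J)) \<in> borel_measurable config_space" by (rule measurable_compose[OF r H(1)])
    have "(\<integral>\<^sup>+\<omega>. H \<omega> \<partial>?\<mu> F) = (\<integral>\<^sup>+\<omega>. H (restrict \<omega> ?J) \<partial>density configuration_law F)"
      using H(1) r by (intro nn_integral_distr) (auto simp: measurable_cong_sets[OF sets_dens refl])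
    also have "\<dots> = (\<integral>\<^sup>+\<omega>. F \<omega> * H (restrict \<omega> ?J) \<partial>configuration_law)"
      by (rule nn_integral_density) measurable
    finally show ?thesis by (simp add: H(2) mult.commute)
  qed
  have "?\<mu> (\<lambda>\<omega>. f (\<omega> ?w)) = ?\<mu> (\<lambda>\<omega>. child_op i f (\<omega> v))"
  proof (rule measure_eqI_PiM_infinite[where I="?J" and M="\<lambda>_. vertex_space"])
    fix A K assume K: "finite K" "K \<subseteq> ?J" and A: "\<And>n. n \<in> K \<Longrightarrow> A n \<in> sets vertex_space"
    let ?X = "prod_emb ?J (\<lambda>_. vertex_space) K (Pi\<^sub>E K A)"
    define g where "g n = (if n \<in> K then indicator (A n) else (\<lambda>_. 1 :: ennreal))" for n :: nat
    have gm: "g n \<in> borel_measurable vertex_space" for n using A by (auto simp: g_def)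
    have g1: "g n = (\<lambda>_. 1)" if "descendant ?w n" for n using that K by (auto simp: g_def)
    obtain N where N: "Suc ?w \<le> N" "K \<subseteq> {..<N}"
    proof
      show "Suc ?w \<le> Suc (?w + Max (insert 0 K))" by simp
      show "K \<subseteq> {..<Suc (?w + Max (insert 0 K))}"
        using K by (auto simp: less_Suc_eq_le intro!: trans_le_add2 Max_ge)
    qed
    have X: "?X \<in> sets ?P" using K A by (intro sets_PiM_I_finite measurable_prod_emb) auto
    have ind: "indicator ?X (restrict \<omega> ?J) = (\<Prod>n<N. g n (\<omega> n))" for \<omega>
    proof -
      have "(\<Prod>n<N. g n (\<omega> n)) = (\<Prod>n\<in>K. g n (\<omega> n))"
        using N K by (intro prod.mono_neutral_right) (auto simp: g_def)
      also have "\<dots> = (\<Prod>n\<in>K. indicator (A n) (\<omega> n))" by (intro prod.cong) (auto simp: g_def)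
      also have "\<dots> = (if \<forall>n\<in>K. \<omega> n \<in> A n then 1 else 0)"
        using K by (auto simp: indicator_def prod_zero_iff intro!: prod.neutral)
      also have "\<dots> = indicator ?X (restrict \<omega> ?J)"
        using K by (auto simp: indicator_def prod_emb_iff PiE_iff subset_iff)
      finally show ?thesis ..
    qed
    have em: "emeasure (?\<mu> F) ?X = (\<integral>\<^sup>+\<omega>. (\<Prod>n<N. g n (\<omega> n)) * F \<omega> \<partial>configuration_law)"
      if F: "F \<in> borel_measurable config_space" for F
    proof -
      have "emeasure (?\<mu> F) ?X = (\<integral>\<^sup>+\<omega>. indicator ?X (restrict \<omega> ?J) \<partial>?\<mu> F)"
      proof -
        have "(\<integral>\<^sup>+\<omega>. indicator ?X (restrict \<omega> ?J) \<partial>?\<mu> F) = (\<integral>\<^sup>+\<omega>. indicator ?X \<omega> \<partial>?\<mu> F)"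
        proof (rule nn_integral_cong)
          fix \<omega> assume "\<omega> \<in> space (?\<mu> F)"
          then have "restrict \<omega> ?J = \<omega>" by (simp add: space_PiM PiE_def extensional_restrict)
          then show "indicator ?X (restrict \<omega> ?J) = (indicator ?X \<omega> :: ennreal)" by simp
        qed
        then show ?thesis using X by simp
      qed
      also have "\<dots> = (\<integral>\<^sup>+\<omega>. indicator ?X (restrict \<omega> ?J) * F \<omega> \<partial>configuration_law)"
      proof (rule int[symmetric, OF _ _ F])
        have "(\<lambda>\<omega>. restrict \<omega> ?J) \<in> ?P \<rightarrow>\<^sub>M ?P" by (rule measurable_restrict_subset) simp
        then show "(\<lambda>\<omega>. indicator ?X (restrict \<omega> ?J)) \<in> borel_measurable ?P"
          using X by (rule measurable_compose[OF _ borel_measurable_indicator])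
      qed simp
      finally show ?thesis unfolding ind .
    qed
    show "emeasure (?\<mu> (\<lambda>\<omega>. f (\<omega> ?w))) ?X = emeasure (?\<mu> (\<lambda>\<omega>. child_op i f (\<omega> v))) ?X"
      unfolding em[OF F1] em[OF F2] by (rule configuration_law_product_step[OF gm g1 f N(1)])
  next
    show "finite_measure (?\<mu> (\<lambda>\<omega>. f (\<omega> ?w)))"
    proof
      have "emeasure (?\<mu> (\<lambda>\<omega>. f (\<omega> ?w))) (space (?\<mu> (\<lambda>\<omega>. f (\<omega> ?w)))) =
          (\<integral>\<^sup>+\<omega>. (\<lambda>_. 1) \<omega> \<partial>?\<mu> (\<lambda>\<omega>. f (\<omega> ?w)))" by simp
      also have "\<dots> = (\<integral>\<^sup>+\<omega>. (\<lambda>_. 1) \<omega> * f (\<omega> ?w) \<partial>configuration_law)"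
        by (rule int[symmetric, OF _ _ F1]) simp_all
      also have "\<dots> \<le> (\<integral>\<^sup>+\<omega>. of_nat C \<partial>configuration_law)" using f1 by (intro nn_integral_mono) auto
      also have "\<dots> = of_nat C" by (simp add: emeasure_configuration_law)
      finally show "emeasure (?\<mu> (\<lambda>\<omega>. f (\<omega> ?w))) (space (?\<mu> (\<lambda>\<omega>. f (\<omega> ?w)))) \<noteq> \<infinity>"
        by (auto simp: top_unique)
    qed
  qed simp_all
  then show ?thesis
    using int[OF GJ depends_on_restrict[OF dep] F1] int[OF GJ depends_on_restrict[OF dep] F2] by simp
qed

lemma nn_integral_SUP_min:
  fixes f :: "'a \<Rightarrow> ennreal"
  assumes [measurable]: "f \<in> borel_measurable M" "g \<in> borel_measurable M"
  shows "(\<integral>\<^sup>+x. g x * f x \<partial>M) = (SUP n. \<integral>\<^sup>+x. g x * min (f x) (of_nat n) \<partial>M)"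
proof -
  have "f x = (SUP n. min (f x) (of_nat n))" for x
    using inf_SUP[of "f x" "of_nat :: nat \<Rightarrow> ennreal" UNIV] by (simp add: ennreal_SUP_of_nat_eq_top inf_min)
  then have "g x * f x = (SUP n. g x * min (f x) (of_nat n))" for x
    by (metis SUP_mult_left_ennreal)
  then have "(\<integral>\<^sup>+x. g x * f x \<partial>M) = (\<integral>\<^sup>+x. (SUP n. g x * min (f x) (of_nat n)) \<partial>M)" by simp
  also have "\<dots> = (SUP n. \<integral>\<^sup>+x. g x * min (f x) (of_nat n) \<partial>M)"
    by (rule nn_integral_monotone_convergence_SUP)
      (auto simp: incseq_def le_fun_def intro!: mult_left_mono min.mono)
  finally show ?thesis .
qed

lemma sets_vertex_given_age: "sets (vertex_given_age (child_age_law i x)) = sets vertex_space"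
  using measurable_space[OF measurable_child_kernel, of x i] by (simp add: space_prob_algebra)

text \<open>Conditionally on everything outside the subtree of a child, the law of that child depends on its parent only. This is
  the Markov property along the tree, from which the branching property follows.\<close>

lemma configuration_law_branching_step:
  assumes G[measurable]: "G \<in> borel_measurable config_space" and dep: "depends_on {n. \<not> descendant (child v i) n} G"
    and f[measurable]: "f \<in> borel_measurable vertex_space"
  shows "(\<integral>\<^sup>+\<omega>. G \<omega> * f (\<omega> (child v i)) \<partial>configuration_law) =
    (\<integral>\<^sup>+\<omega>. G \<omega> * child_op i f (\<omega> v) \<partial>configuration_law)"
proof -
  let ?f = "\<lambda>n x. min (f x) (of_nat n)"
  \<comment> \<open>An unbounded \<open>f\<close> is the supremum of its truncations.\<close>
  have op: "child_op i f x = (SUP n. child_op i (?f n) x)" for x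
  proof -
    have f': "f \<in> borel_measurable (vertex_given_age (child_age_law i x))"
      using f by (simp add: measurable_cong_sets[OF sets_vertex_given_age refl])
    have "(\<integral>\<^sup>+y. 1 * f y \<partial>vertex_given_age (child_age_law i x)) =
        (SUP n. \<integral>\<^sup>+y. 1 * ?f n y \<partial>vertex_given_age (child_age_law i x))"
      by (rule nn_integral_SUP_min[OF f']) simp
    then show ?thesis by (simp add: child_op_def)
  qed
  have "(\<integral>\<^sup>+\<omega>. G \<omega> * f (\<omega> (child v i)) \<partial>configuration_law) =
      (SUP n. \<integral>\<^sup>+\<omega>. G \<omega> * ?f n (\<omega> (child v i)) \<partial>configuration_law)"
    by (rule nn_integral_SUP_min) measurable
  also have "\<dots> = (SUP n. \<integral>\<^sup>+\<omega>. G \<omega> * child_op i (?f n) (\<omega> v) \<partial>configuration_law)"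
  proof (intro SUP_cong refl)
    fix n
    have "?f n \<in> borel_measurable vertex_space" by measurable
    then show "(\<integral>\<^sup>+\<omega>. G \<omega> * ?f n (\<omega> (child v i)) \<partial>configuration_law) =
        (\<integral>\<^sup>+\<omega>. G \<omega> * child_op i (?f n) (\<omega> v) \<partial>configuration_law)"
      by (rule configuration_law_branching_step_bounded[OF G dep, where C=n]) simp
  qed
  also have "\<dots> = (\<integral>\<^sup>+\<omega>. (SUP n. G \<omega> * child_op i (?f n) (\<omega> v)) \<partial>configuration_law)"
    by (rule nn_integral_monotone_convergence_SUP[symmetric])
      (auto simp: incseq_def le_fun_def intro!: mult_left_mono child_op_mono min.mono)
  also have "\<dots> = (\<integral>\<^sup>+\<omega>. G \<omega> * child_op i f (\<omega> v) \<partial>configuration_law)"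
    unfolding op by (simp add: SUP_mult_left_ennreal)
  finally show ?thesis .
qed

section \<open>The branching property of the infinite tree\<close>

lemma aged_ball_tree_at_nonspinal:
  "aged_ball (Suc r) (tree_at \<omega> False v) =
     Node (mset (map (\<lambda>i. aged_ball r (tree_at \<omega> False (child v (Suc i)))) [0..<num_nonspinal \<omega> v]))"
  by (simp add: multiset.map_comp comp_def)

lemma aged_ball_tree_at_spinal:
  "aged_ball (Suc r) (tree_at \<omega> True v) =
     Node (add_mset (aged_ball r (tree_at \<omega> True (child v 0))) (subtrees (aged_ball (Suc r) (tree_at \<omega> False v))))"
  by (simp add: multiset.map_comp comp_def)

lemma descendant_childI: "descendant (child v i) n \<Longrightarrow> descendant v n"
  by (rule descendant_trans[OF _ descendant_child[OF descendant_refl]])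

lemma depends_on_aged_ball: "depends_on {n. descendant v n} (\<lambda>\<omega>. aged_ball r (tree_at \<omega> s v))"
  unfolding depends_on_def
proof (intro allI impI)
  fix \<omega> \<omega>' :: configuration assume "\<forall>n\<in>{n. descendant v n}. \<omega> n = \<omega>' n"
  then show "aged_ball r (tree_at \<omega> s v) = aged_ball r (tree_at \<omega>' s v)"
  proof (induction r arbitrary: s v)
    case (Suc r)
    have IH: "aged_ball r (tree_at \<omega> s' (child v i)) = aged_ball r (tree_at \<omega>' s' (child v i))" for s' i
      by (rule Suc.IH) (use Suc.prems descendant_childI in blast)
    have "\<omega> v = \<omega>' v" using Suc.prems descendant_refl by blast
    then have F: "aged_ball (Suc r) (tree_at \<omega> False v) = aged_ball (Suc r) (tree_at \<omega>' False v)"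
      unfolding aged_ball_tree_at_nonspinal IH by (simp add: num_nonspinal_def)
    show ?case
    proof (cases s)
      case True
      then show ?thesis by (simp only: aged_ball_tree_at_spinal IH F)
    qed (use F in simp)
  qed simp
qed

text \<open>A non-spinal vertex does not use its label for a spinal child; so the non-spinal part of a spinal vertex is independent of
  its spinal branch, given the vertex.\<close>

lemma depends_on_aged_ball_nonspinal:
  "depends_on {n. descendant v n \<and> \<not> descendant (child v 0) n} (\<lambda>\<omega>. aged_ball r (tree_at \<omega> False v))"
proof (cases r)
  case (Suc q)
  show ?thesis
    unfolding depends_on_def Suc
  proof (intro allI impI)
    fix \<omega> \<omega>' :: configuration assume eq: "\<forall>n\<in>{n. descendant v n \<and> \<not> descendant (child v 0) n}. \<omega> n = \<omega>' n"
    have "aged_ball q (tree_at \<omega> False (child v (Suc i))) = aged_ball q (tree_at \<omega>' False (child v (Suc i)))" for i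
    proof (rule depends_on_aged_ball[unfolded depends_on_def, rule_format])
      fix n assume "n \<in> {n. descendant (child v (Suc i)) n}"
      then show "\<omega> n = \<omega>' n" using eq descendant_childI descendant_siblings by blast
    qed
    moreover have "\<omega> v = \<omega>' v" using eq descendant_refl not_descendant_parent by blast
    ultimately show "aged_ball (Suc q) (tree_at \<omega> False v) = aged_ball (Suc q) (tree_at \<omega>' False v)"
      unfolding aged_ball_tree_at_nonspinal by (simp add: num_nonspinal_def)
  qed
qed (simp add: depends_on_def)

text \<open>The conditional probability that the ball of radius \<open>r\<close> about a non-spinal vertex is \<open>t\<close>, given its age and the ages
  of its children. The children come with an order, hence the sum over the orderings of the subtrees of \<open>t\<close>.\<close>

primrec nonspinal_kernel :: "nat \<Rightarrow> rtree \<Rightarrow> real \<times> nat \<times> (nat \<Rightarrow> real) \<Rightarrow> ennreal" where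
  "nonspinal_kernel 0 t = (\<lambda>x. if t = Node {#} then 1 else 0)"
| "nonspinal_kernel (Suc r) t = (\<lambda>x. \<Sum>ts\<in>permutations_of_multiset (subtrees t).
     (if fst (snd x) = length ts then 1 else 0) * (\<Prod>i<length ts. child_op (Suc i) (nonspinal_kernel r (ts ! i)) x))"

text \<open>The same for a spinal vertex; \<open>c\<close> is the ball of its spinal child, and without that branch the vertex looks like a
  non-spinal one.\<close>

primrec spinal_kernel :: "nat \<Rightarrow> rtree \<Rightarrow> real \<times> nat \<times> (nat \<Rightarrow> real) \<Rightarrow> ennreal" where
  "spinal_kernel 0 t = (\<lambda>x. if t = Node {#} then 1 else 0)"
| "spinal_kernel (Suc r) t = (\<lambda>x. \<Sum>c\<in>set_mset (subtrees t).
     child_op 0 (spinal_kernel r c) x * nonspinal_kernel (Suc r) (Node (subtrees t - {#c#})) x)"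

lemma measurable_num [measurable]: "(\<lambda>x. fst (snd x)) \<in> vertex_space \<rightarrow>\<^sub>M count_space UNIV"
  unfolding vertex_space_def by measurable

lemma measurable_nonspinal_kernel [measurable]: "nonspinal_kernel r t \<in> borel_measurable vertex_space"
proof (induction r arbitrary: t)
  case (Suc r)
  note [measurable] = Suc
  show ?case unfolding nonspinal_kernel.simps by measurable
qed simp

lemma measurable_spinal_kernel [measurable]: "spinal_kernel r t \<in> borel_measurable vertex_space"
proof (induction r arbitrary: t)
  case (Suc r)
  note [measurable] = Suc
  show ?case unfolding spinal_kernel.simps by measurable
qed simp

definition ball_indicator :: "nat \<Rightarrow> bool \<Rightarrow> nat \<Rightarrow> rtree \<Rightarrow> configuration \<Rightarrow> ennreal" where
  "ball_indicator r s v t \<omega> = (if aged_ball r (tree_at \<omega> s v) = t then 1 else 0)"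

lemma measurable_ball_indicator [measurable]: "ball_indicator r s v t \<in> borel_measurable config_space"
proof -
  have "(\<lambda>b. if b = t then 1 else 0 :: ennreal) \<in> borel_measurable (count_space UNIV)" by simp
  from measurable_compose[OF measurable_aged_ball_tree_at this] show ?thesis
    unfolding ball_indicator_def .
qed

lemma depends_on_compose: "depends_on J F \<Longrightarrow> depends_on J (\<lambda>\<omega>. h (F \<omega>))"
  unfolding depends_on_def by metis

lemma depends_on_mult: "depends_on J F \<Longrightarrow> depends_on J G \<Longrightarrow> depends_on J (\<lambda>\<omega>. F \<omega> * G \<omega>)"
  unfolding depends_on_def by metis

lemma depends_on_prod: "(\<And>i. i \<in> I \<Longrightarrow> depends_on J (F i)) \<Longrightarrow> depends_on J (\<lambda>\<omega>. \<Prod>i\<in>I. F i \<omega>)"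
  unfolding depends_on_def by (intro allI impI prod.cong refl) metis

lemma depends_on_vertex: "v \<in> J \<Longrightarrow> depends_on J (\<lambda>\<omega>. h (\<omega> v))"
  unfolding depends_on_def by metis

lemma depends_on_ball_indicator: "depends_on {n. descendant v n} (ball_indicator r s v t)"
  unfolding ball_indicator_def[abs_def] by (rule depends_on_compose[OF depends_on_aged_ball])

text \<open>The labels which are not strict descendants of \<open>v\<close>; the label \<open>v\<close> itself is included.\<close>

abbreviation outside :: "nat \<Rightarrow> nat set" where
  "outside v \<equiv> {n. descendant v n \<longrightarrow> n = v}"

lemma ball_indicator_nonspinal:
  "ball_indicator (Suc r) False v t \<omega> = (\<Sum>ts\<in>permutations_of_multiset (subtrees t).
     (if num_nonspinal \<omega> v = length ts then 1 else 0) *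
     (\<Prod>i<length ts. ball_indicator r False (child v (Suc i)) (ts ! i) \<omega>))"
proof -
  let ?b = "\<lambda>i. aged_ball r (tree_at \<omega> False (child v (Suc i)))"
  let ?L = "map ?b [0..<num_nonspinal \<omega> v]"
  have "(if num_nonspinal \<omega> v = length ts then 1 else 0) *
     (\<Prod>i<length ts. ball_indicator r False (child v (Suc i)) (ts ! i) \<omega>) = (if ts = ?L then 1 else 0)" for ts
  proof (cases "ts = ?L")
    case True
    then show ?thesis by (simp add: ball_indicator_def)
  next
    case False
    show ?thesis
    proof (cases "num_nonspinal \<omega> v = length ts")
      case True
      with False obtain i where "i < length ts" "ts ! i \<noteq> ?b i"
        by (metis (no_types, lifting) add.left_neutral diff_zero length_map length_upt nth_equalityI nth_map_upt)
      then have "(\<Prod>i<length ts. ball_indicator r False (child v (Suc i)) (ts ! i) \<omega>) = 0"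
        by (intro prod_zero) (auto simp: ball_indicator_def intro!: bexI[of _ i])
      then show ?thesis using False by simp
    qed (use False in simp)
  qed
  then have "(\<Sum>ts\<in>permutations_of_multiset (subtrees t).
     (if num_nonspinal \<omega> v = length ts then 1 else 0) *
     (\<Prod>i<length ts. ball_indicator r False (child v (Suc i)) (ts ! i) \<omega>)) =
     (\<Sum>ts\<in>permutations_of_multiset (subtrees t). if ts = ?L then 1 else 0)"
    by simp
  also have "\<dots> = (if ?L \<in> permutations_of_multiset (subtrees t) then 1 else 0)"
    by (simp add: sum.delta')
  also have "\<dots> = ball_indicator (Suc r) False v t \<omega>"
    unfolding ball_indicator_def aged_ball_tree_at_nonspinal
    by (cases t) (auto simp: permutations_of_multiset_def)
  finally show ?thesis ..
qed

lemma ball_indicator_spinal: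
  "ball_indicator (Suc r) True v t \<omega> = (\<Sum>c\<in>set_mset (subtrees t).
     ball_indicator r True (child v 0) c \<omega> * ball_indicator (Suc r) False v (Node (subtrees t - {#c#})) \<omega>)"
proof -
  let ?b = "aged_ball r (tree_at \<omega> True (child v 0))" and ?F = "aged_ball (Suc r) (tree_at \<omega> False v)"
  obtain m where t: "t = Node m" by (cases t)
  obtain M where F: "?F = Node M" by (cases ?F)
  have "(\<Sum>c\<in>set_mset m. ball_indicator r True (child v 0) c \<omega> * ball_indicator (Suc r) False v (Node (m - {#c#})) \<omega>) =
      (\<Sum>c\<in>set_mset m. if c = ?b then (if M = m - {#?b#} then 1 else 0) else 0)"
    unfolding ball_indicator_def F by (intro sum.cong) auto
  also have "\<dots> = (if ?b \<in># m \<and> M = m - {#?b#} then 1 else 0)" by (simp add: sum.delta')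
  also have "\<dots> = (if add_mset ?b M = m then 1 else 0)" by (auto simp: insert_DiffM)
  also have "\<dots> = ball_indicator (Suc r) True v t \<omega>"
    unfolding ball_indicator_def aged_ball_tree_at_spinal F t by simp
  finally show ?thesis by (simp add: t)
qed

text \<open>The branches of distinct children are integrated out one after the other; those not yet treated lie
  outside the subtree of the current child.\<close>

lemma nonspinal_product_expectation:
  assumes IH: "\<And>v t G. G \<in> borel_measurable config_space \<Longrightarrow> depends_on (outside v) G \<Longrightarrow>
      (\<integral>\<^sup>+\<omega>. G \<omega> * ball_indicator r False v t \<omega> \<partial>configuration_law) =
      (\<integral>\<^sup>+\<omega>. G \<omega> * nonspinal_kernel r t (\<omega> v) \<partial>configuration_law)"
    and G: "G \<in> borel_measurable config_space" "depends_on (outside v) G"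
  shows "(\<integral>\<^sup>+\<omega>. G \<omega> * (\<Prod>i<j. ball_indicator r False (child v (Suc i)) (ts i) \<omega>) \<partial>configuration_law) =
    (\<integral>\<^sup>+\<omega>. G \<omega> * (\<Prod>i<j. child_op (Suc i) (nonspinal_kernel r (ts i)) (\<omega> v)) \<partial>configuration_law)"
  using G
proof (induction j arbitrary: G)
  case (Suc j)
  note [measurable] = Suc.prems(1)
  let ?w = "child v (Suc j)"
  let ?H = "\<lambda>i. ball_indicator r False (child v (Suc i)) (ts i)"
  let ?K = "nonspinal_kernel r (ts j)"
  let ?G' = "\<lambda>\<omega>. G \<omega> * (\<Prod>i<j. ?H i \<omega>)"
  have dep: "depends_on {n. \<not> descendant ?w n} ?G'"
  proof (intro depends_on_mult depends_on_prod)
    show "depends_on {n. \<not> descendant ?w n} G"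
      by (rule depends_on_mono[OF Suc.prems(2)]) (use descendant_childI not_descendant_parent in blast)
    show "depends_on {n. \<not> descendant ?w n} (?H i)" if "i \<in> {..<j}" for i
      by (rule depends_on_mono[OF depends_on_ball_indicator]) (use that descendant_siblings in force)
  qed
  have dep': "depends_on (outside ?w) ?G'" by (rule depends_on_mono[OF dep]) auto
  have mG': "?G' \<in> borel_measurable config_space" by measurable
  have mk: "(\<lambda>\<omega>. G \<omega> * child_op (Suc j) ?K (\<omega> v)) \<in> borel_measurable config_space" by measurable
  have dk: "depends_on (outside v) (\<lambda>\<omega>. G \<omega> * child_op (Suc j) ?K (\<omega> v))"
    by (rule depends_on_mult[OF Suc.prems(2) depends_on_vertex]) simp
  have "(\<integral>\<^sup>+\<omega>. G \<omega> * (\<Prod>i<Suc j. ?H i \<omega>) \<partial>configuration_law) = (\<integral>\<^sup>+\<omega>. ?G' \<omega> * ?H j \<omega> \<partial>configuration_law)"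
    by (simp add: mult_ac)
  also have "\<dots> = (\<integral>\<^sup>+\<omega>. ?G' \<omega> * ?K (\<omega> ?w) \<partial>configuration_law)"
    by (rule IH[OF mG' dep'])
  also have "\<dots> = (\<integral>\<^sup>+\<omega>. ?G' \<omega> * child_op (Suc j) ?K (\<omega> v) \<partial>configuration_law)"
    by (rule configuration_law_branching_step[OF mG' dep measurable_nonspinal_kernel])
  also have "\<dots> = (\<integral>\<^sup>+\<omega>. (G \<omega> * child_op (Suc j) ?K (\<omega> v)) * (\<Prod>i<j. ?H i \<omega>) \<partial>configuration_law)"
    by (simp add: mult_ac)
  also have "\<dots> = (\<integral>\<^sup>+\<omega>. (G \<omega> * child_op (Suc j) ?K (\<omega> v)) * (\<Prod>i<j. child_op (Suc i) (nonspinal_kernel r (ts i)) (\<omega> v)) \<partial>configuration_law)"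
    by (rule Suc.IH[OF mk dk])
  finally show ?case by (simp add: mult_ac)
qed simp

lemma nonspinal_ball_expectation:
  "G \<in> borel_measurable config_space \<Longrightarrow> depends_on (outside v) G \<Longrightarrow>
    (\<integral>\<^sup>+\<omega>. G \<omega> * ball_indicator r False v t \<omega> \<partial>configuration_law) =
    (\<integral>\<^sup>+\<omega>. G \<omega> * nonspinal_kernel r t (\<omega> v) \<partial>configuration_law)"
proof (induction r arbitrary: v t G)
  case 0
  then show ?case by (simp add: ball_indicator_def eq_commute[of "Node {#}"])
next
  case (Suc r)
  note [measurable] = Suc.prems(1)
  let ?P = "permutations_of_multiset (subtrees t)"
  let ?I = "\<lambda>ts \<omega>. if fst (snd (\<omega> v)) = length ts then 1 else (0::ennreal)"
  have [measurable]: "(\<lambda>\<omega>. fst (snd (\<omega> v))) \<in> config_space \<rightarrow>\<^sub>M count_space UNIV" by measurable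
  have "(\<integral>\<^sup>+\<omega>. G \<omega> * ball_indicator (Suc r) False v t \<omega> \<partial>configuration_law) =
      (\<integral>\<^sup>+\<omega>. (\<Sum>ts\<in>?P. (G \<omega> * ?I ts \<omega>) * (\<Prod>i<length ts. ball_indicator r False (child v (Suc i)) (ts ! i) \<omega>)) \<partial>configuration_law)"
    by (simp add: ball_indicator_nonspinal num_nonspinal_def sum_distrib_left mult_ac)
  also have "\<dots> = (\<Sum>ts\<in>?P. \<integral>\<^sup>+\<omega>. (G \<omega> * ?I ts \<omega>) * (\<Prod>i<length ts. ball_indicator r False (child v (Suc i)) (ts ! i) \<omega>) \<partial>configuration_law)"
    by (rule nn_integral_sum) measurable
  also have "\<dots> = (\<Sum>ts\<in>?P. \<integral>\<^sup>+\<omega>. (G \<omega> * ?I ts \<omega>) * (\<Prod>i<length ts. child_op (Suc i) (nonspinal_kernel r (ts ! i)) (\<omega> v)) \<partial>configuration_law)"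
  proof (intro sum.cong refl nonspinal_product_expectation[OF Suc.IH])
    fix ts
    show "(\<lambda>\<omega>. G \<omega> * ?I ts \<omega>) \<in> borel_measurable config_space" by measurable
    show "depends_on (outside v) (\<lambda>\<omega>. G \<omega> * ?I ts \<omega>)"
      by (intro depends_on_mult Suc.prems(2) depends_on_vertex[of v _ "\<lambda>x. if fst (snd x) = length ts then 1 else 0"]) simp
  qed
  also have "\<dots> = (\<integral>\<^sup>+\<omega>. (\<Sum>ts\<in>?P. (G \<omega> * ?I ts \<omega>) * (\<Prod>i<length ts. child_op (Suc i) (nonspinal_kernel r (ts ! i)) (\<omega> v))) \<partial>configuration_law)"
    by (rule nn_integral_sum[symmetric]) measurable
  also have "\<dots> = (\<integral>\<^sup>+\<omega>. G \<omega> * nonspinal_kernel (Suc r) t (\<omega> v) \<partial>configuration_law)"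
    by (simp add: sum_distrib_left mult_ac)
  finally show ?case .
qed

lemma spinal_ball_expectation:
  "G \<in> borel_measurable config_space \<Longrightarrow> depends_on (outside v) G \<Longrightarrow>
    (\<integral>\<^sup>+\<omega>. G \<omega> * ball_indicator r True v t \<omega> \<partial>configuration_law) =
    (\<integral>\<^sup>+\<omega>. G \<omega> * spinal_kernel r t (\<omega> v) \<partial>configuration_law)"
proof (induction r arbitrary: v t G)
  case 0
  then show ?case by (simp add: ball_indicator_def eq_commute[of "Node {#}"])
next
  case (Suc r)
  note [measurable] = Suc.prems(1)
  let ?w = "child v 0"
  let ?H = "\<lambda>c. ball_indicator r True ?w c"
  let ?B = "\<lambda>c. ball_indicator (Suc r) False v (Node (subtrees t - {#c#}))"
  let ?k = "\<lambda>c. child_op 0 (spinal_kernel r c)"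
  have step: "(\<integral>\<^sup>+\<omega>. (G \<omega> * ?B c \<omega>) * ?H c \<omega> \<partial>configuration_law) =
      (\<integral>\<^sup>+\<omega>. (G \<omega> * ?k c (\<omega> v)) * nonspinal_kernel (Suc r) (Node (subtrees t - {#c#})) (\<omega> v) \<partial>configuration_law)" for c
  proof -
    have dep: "depends_on {n. \<not> descendant ?w n} (\<lambda>\<omega>. G \<omega> * ?B c \<omega>)"
    proof (intro depends_on_mult)
      show "depends_on {n. \<not> descendant ?w n} G"
        by (rule depends_on_mono[OF Suc.prems(2)]) (use descendant_childI not_descendant_parent in blast)
      show "depends_on {n. \<not> descendant ?w n} (?B c)"
        unfolding ball_indicator_def[abs_def]
        by (rule depends_on_mono[OF depends_on_compose[OF depends_on_aged_ball_nonspinal]]) auto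
    qed
    have dep': "depends_on (outside ?w) (\<lambda>\<omega>. G \<omega> * ?B c \<omega>)" by (rule depends_on_mono[OF dep]) auto
    have mB: "(\<lambda>\<omega>. G \<omega> * ?B c \<omega>) \<in> borel_measurable config_space" by measurable
    have mk: "(\<lambda>\<omega>. G \<omega> * ?k c (\<omega> v)) \<in> borel_measurable config_space" by measurable
    have dk: "depends_on (outside v) (\<lambda>\<omega>. G \<omega> * ?k c (\<omega> v))"
      by (rule depends_on_mult[OF Suc.prems(2) depends_on_vertex]) simp
    have "(\<integral>\<^sup>+\<omega>. (G \<omega> * ?B c \<omega>) * ?H c \<omega> \<partial>configuration_law) = (\<integral>\<^sup>+\<omega>. (G \<omega> * ?B c \<omega>) * spinal_kernel r c (\<omega> ?w) \<partial>configuration_law)"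
      by (rule Suc.IH[OF mB dep'])
    also have "\<dots> = (\<integral>\<^sup>+\<omega>. (G \<omega> * ?B c \<omega>) * ?k c (\<omega> v) \<partial>configuration_law)"
      by (rule configuration_law_branching_step[OF mB dep measurable_spinal_kernel])
    also have "\<dots> = (\<integral>\<^sup>+\<omega>. (G \<omega> * ?k c (\<omega> v)) * ?B c \<omega> \<partial>configuration_law)" by (simp add: mult_ac)
    also have "\<dots> = (\<integral>\<^sup>+\<omega>. (G \<omega> * ?k c (\<omega> v)) * nonspinal_kernel (Suc r) (Node (subtrees t - {#c#})) (\<omega> v) \<partial>configuration_law)"
      by (rule nonspinal_ball_expectation[OF mk dk])
    finally show ?thesis .
  qed
  have "(\<integral>\<^sup>+\<omega>. G \<omega> * ball_indicator (Suc r) True v t \<omega> \<partial>configuration_law) =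
      (\<integral>\<^sup>+\<omega>. (\<Sum>c\<in>set_mset (subtrees t). (G \<omega> * ?B c \<omega>) * ?H c \<omega>) \<partial>configuration_law)"
    by (simp add: ball_indicator_spinal sum_distrib_left mult_ac)
  also have "\<dots> = (\<Sum>c\<in>set_mset (subtrees t). \<integral>\<^sup>+\<omega>. (G \<omega> * ?B c \<omega>) * ?H c \<omega> \<partial>configuration_law)"
    by (rule nn_integral_sum) measurable
  also have "\<dots> = (\<Sum>c\<in>set_mset (subtrees t). \<integral>\<^sup>+\<omega>. (G \<omega> * ?k c (\<omega> v)) * nonspinal_kernel (Suc r) (Node (subtrees t - {#c#})) (\<omega> v) \<partial>configuration_law)"
    by (simp only: step)
  also have "\<dots> = (\<integral>\<^sup>+\<omega>. (\<Sum>c\<in>set_mset (subtrees t). (G \<omega> * ?k c (\<omega> v)) * nonspinal_kernel (Suc r) (Node (subtrees t - {#c#})) (\<omega> v)) \<partial>configuration_law)"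
    by (rule nn_integral_sum[symmetric]) measurable
  also have "\<dots> = (\<integral>\<^sup>+\<omega>. G \<omega> * spinal_kernel (Suc r) t (\<omega> v) \<partial>configuration_law)"
    by (simp only: spinal_kernel.simps sum_distrib_left mult.assoc)
  finally show ?case .
qed

definition age_op :: "(real \<times> nat \<times> (nat \<Rightarrow> real) \<Rightarrow> ennreal) \<Rightarrow> real \<Rightarrow> ennreal" where
  "age_op f a = (\<integral>\<^sup>+c. f (a, c) \<partial>poisson_process (offspring_intensity a))"

lemma sets_poisson_process_offspring:
  "sets (poisson_process (offspring_intensity a)) = sets (count_space UNIV \<Otimes>\<^sub>M (\<Pi>\<^sub>M i\<in>UNIV. borel))"
  using measurable_space[OF measurable_poisson_process_offspring, of a] by (simp add: space_prob_algebra)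

lemma nn_integral_offspring_kernel:
  assumes f[measurable]: "f \<in> borel_measurable vertex_space"
  shows "(\<integral>\<^sup>+y. f y \<partial>(poisson_process (offspring_intensity a) \<bind> (\<lambda>c. return vertex_space (a, c)))) = age_op f a"
proof -
  have p: "Pair a \<in> (count_space UNIV \<Otimes>\<^sub>M (\<Pi>\<^sub>M i\<in>UNIV. borel)) \<rightarrow>\<^sub>M vertex_space"
    unfolding vertex_space_def by measurable
  have "(\<integral>\<^sup>+y. f y \<partial>(poisson_process (offspring_intensity a) \<bind> (\<lambda>c. return vertex_space (a, c)))) =
     (\<integral>\<^sup>+c. \<integral>\<^sup>+y. f y \<partial>return vertex_space (a, c) \<partial>poisson_process (offspring_intensity a))"
    by (rule nn_integral_bind[OF f])
      (use measurable_compose[OF p return_measurable] in \<open>simp add: measurable_cong_sets[OF sets_poisson_process_offspring refl]\<close>)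
  also have "\<dots> = age_op f a"
    unfolding age_op_def using f by (intro nn_integral_cong nn_integral_return) auto
  finally show ?thesis .
qed

lemma measurable_age_op [measurable]:
  assumes f: "f \<in> borel_measurable vertex_space" shows "age_op f \<in> borel_measurable borel"
proof -
  have "(\<lambda>a. \<integral>\<^sup>+y. f y \<partial>(poisson_process (offspring_intensity a) \<bind> (\<lambda>c. return vertex_space (a, c)))) \<in> borel_measurable borel"
    by (rule measurable_compose[OF measurable_prob_algebraD[OF measurable_offspring_kernel] nn_integral_measurable_subprob_algebra[OF f]])
  then show ?thesis unfolding nn_integral_offspring_kernel[OF f] .
qed

lemma nn_integral_vertex_given_age:
  assumes \<mu>: "sets \<mu> = sets borel" and f: "f \<in> borel_measurable vertex_space"
  shows "(\<integral>\<^sup>+y. f y \<partial>vertex_given_age \<mu>) = (\<integral>\<^sup>+a. age_op f a \<partial>\<mu>)"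
proof -
  have "(\<integral>\<^sup>+y. f y \<partial>vertex_given_age \<mu>) =
      (\<integral>\<^sup>+a. \<integral>\<^sup>+y. f y \<partial>(poisson_process (offspring_intensity a) \<bind> (\<lambda>c. return vertex_space (a, c))) \<partial>\<mu>)"
    unfolding vertex_given_age_def
    by (rule nn_integral_bind[OF f]) (use measurable_prob_algebraD[OF measurable_offspring_kernel] in \<open>simp add: measurable_cong_sets[OF \<mu> refl]\<close>)
  then show ?thesis by (simp only: nn_integral_offspring_kernel[OF f])
qed

lemma child_op_spinal:
  "f \<in> borel_measurable vertex_space \<Longrightarrow> child_op 0 f x = (\<integral>\<^sup>+a. age_op f a \<partial>spinal_age_law (fst x))"
  unfolding child_op_def
  by (subst nn_integral_vertex_given_age) (simp_all add: child_age_law_def spinal_age_law_def)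

lemma child_op_nonspinal:
  "f \<in> borel_measurable vertex_space \<Longrightarrow> child_op (Suc j) f x = age_op f (snd (snd x) j)"
  unfolding child_op_def
  by (subst nn_integral_vertex_given_age) (simp_all add: child_age_law_def nn_integral_return)

lemma emeasure_hat_H_ball:
  "emeasure (distr configuration_law (count_space UNIV) (\<lambda>\<omega>. aged_ball r (hat_H_tree \<omega>))) {t} =
     (\<integral>\<^sup>+a. age_op (spinal_kernel r t) a \<partial>root_age_law)"
proof -
  have "emeasure (distr configuration_law (count_space UNIV) (\<lambda>\<omega>. aged_ball r (hat_H_tree \<omega>))) {t} =
      (\<integral>\<^sup>+\<omega>. (\<lambda>_. 1) \<omega> * ball_indicator r True 0 t \<omega> \<partial>configuration_law)"
    unfolding ball_indicator_def hat_H_tree_def[symmetric]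
    by (subst nn_integral_indicator[symmetric], simp, subst nn_integral_distr)
      (auto simp: indicator_def intro!: nn_integral_cong)
  also have "\<dots> = (\<integral>\<^sup>+\<omega>. (\<lambda>_. 1) \<omega> * spinal_kernel r t (\<omega> 0) \<partial>configuration_law)"
    by (rule spinal_ball_expectation) (simp_all add: depends_on_def)
  also have "\<dots> = (\<integral>\<^sup>+\<omega>. (\<lambda>_. 1) \<omega> * (\<integral>\<^sup>+y. spinal_kernel r t y \<partial>vertex_law 0 (restrict \<omega> {0..<0})) \<partial>configuration_law)"
    by (rule configuration_law_step) (simp_all add: depends_on_def)
  also have "vertex_law 0 = (\<lambda>\<omega>. vertex_given_age root_age_law)"
    by (simp add: fun_eq_iff vertex_law_def vertex_given_age_def)
  also have "(\<integral>\<^sup>+\<omega>. (\<lambda>_. 1) \<omega> * (\<integral>\<^sup>+y. spinal_kernel r t y \<partial>vertex_given_age root_age_law) \<partial>configuration_law) =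
      (\<integral>\<^sup>+y. spinal_kernel r t y \<partial>vertex_given_age root_age_law)"
    by (simp add: emeasure_configuration_law)
  also have "\<dots> = (\<integral>\<^sup>+a. age_op (spinal_kernel r t) a \<partial>root_age_law)"
    by (rule nn_integral_vertex_given_age) (simp_all add: root_age_law_def)
  finally show ?thesis .
qed

section \<open>Poisson offspring\<close>

text \<open>A multiset of size \<open>n\<close> has \<open>n!\<close> orderings up to its symmetries, which are the factorials in \<open>multiset_weight\<close>.\<close>

lemma sum_permutations_multiset_weight:
  "(\<Sum>ts\<in>permutations_of_multiset M. \<Prod>i<length ts. v (ts ! i)) = fact (size M) * multiset_weight v M"
proof (induction "size M" arbitrary: M)
  case 0
  then show ?case by simp
next
  case (Suc n)
  then have M: "M \<noteq> {#}" by auto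
  have prod: "(\<Prod>i<Suc (length ts). v ((c # ts) ! i)) = v c * (\<Prod>i<length ts. v (ts ! i))" for c ts
    by (simp add: prod.lessThan_Suc_shift del: prod.lessThan_Suc)
  have "(\<Sum>ts\<in>permutations_of_multiset M. \<Prod>i<length ts. v (ts ! i)) =
      (\<Sum>c\<in>set_mset M. \<Sum>ts\<in>(#) c ` permutations_of_multiset (M - {#c#}). \<Prod>i<length ts. v (ts ! i))"
    unfolding permutations_of_multiset_nonempty[OF M] by (rule sum.UNION_disjoint) auto
  also have "\<dots> = (\<Sum>c\<in>set_mset M. v c * (\<Sum>ts\<in>permutations_of_multiset (M - {#c#}). \<Prod>i<length ts. v (ts ! i)))"
    by (subst sum.reindex) (auto simp: prod sum_distrib_left simp del: prod.lessThan_Suc)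
  also have "\<dots> = (\<Sum>c\<in>set_mset M. fact n * (real (count M c) * multiset_weight v M))"
  proof (rule sum.cong[OF refl])
    fix c assume c: "c \<in> set_mset M"
    then have n: "n = size (M - {#c#})" using Suc(2) by (simp add: size_Diff_singleton)
    show "v c * (\<Sum>ts\<in>permutations_of_multiset (M - {#c#}). \<Prod>i<length ts. v (ts ! i)) =
        fact n * (real (count M c) * multiset_weight v M)"
      using Suc(1)[OF n] multiset_weight_remove[of c M v] c n by simp
  qed
  also have "\<dots> = fact n * (real (size M) * multiset_weight v M)"
    by (simp add: size_multiset_overloaded_eq sum_distrib_left sum_distrib_right)
  finally show ?case by (simp add: Suc(2)[symmetric])
qed

lemma PiM_nn_integral_prod:
  fixes D :: "real measure" and f :: "nat \<Rightarrow> real \<Rightarrow> ennreal"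
  assumes D: "prob_space D" and f: "\<And>i. f i \<in> borel_measurable D"
  shows "(\<integral>\<^sup>+x. (\<Prod>i<n. f i (x i)) \<partial>(\<Pi>\<^sub>M i\<in>(UNIV::nat set). D)) = (\<Prod>i<n. \<integral>\<^sup>+x. f i x \<partial>D)"
proof -
  interpret D: prob_space D by fact
  interpret P: product_prob_space "\<lambda>_. D" "UNIV :: nat set" ..
  have "(\<integral>\<^sup>+x. (\<Prod>i<n. f i (x i)) \<partial>(\<Pi>\<^sub>M i\<in>(UNIV::nat set). D)) =
      (\<integral>\<^sup>+x. (\<Prod>i<n. f i (x i)) \<partial>distr (\<Pi>\<^sub>M i\<in>(UNIV::nat set). D) (\<Pi>\<^sub>M i\<in>{..<n}. D) (\<lambda>x. restrict x {..<n}))"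
    using f by (subst nn_integral_distr) (auto intro!: measurable_restrict_subset)
  also have "\<dots> = (\<integral>\<^sup>+x. (\<Prod>i<n. f i (x i)) \<partial>(\<Pi>\<^sub>M i\<in>{..<n}. D))"
    by (subst P.distr_PiM_restrict_finite) auto
  also have "\<dots> = (\<Prod>i<n. \<integral>\<^sup>+x. f i x \<partial>D)"
    using f by (subst P.product_nn_integral_prod) auto
  finally show ?thesis .
qed

lemma nn_integral_iid_fixed_number:
  fixes D :: "real measure" and f :: "nat \<Rightarrow> real \<Rightarrow> ennreal"
  assumes D: "prob_space D" "sets D = sets borel" and f[measurable]: "\<And>i. f i \<in> borel_measurable borel"
  shows "(\<integral>\<^sup>+c. (if fst c = N then 1 else 0) * (\<Prod>i<N. f i (snd c i)) \<partial>(measure_pmf p \<Otimes>\<^sub>M (\<Pi>\<^sub>M i\<in>UNIV. D))) =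
    ennreal (pmf p N) * (\<Prod>i<N. \<integral>\<^sup>+x. f i x \<partial>D)"
proof -
  interpret P: prob_space "\<Pi>\<^sub>M i\<in>(UNIV::nat set). D"
    by (intro prob_space_PiM D)
  have s: "sets (measure_pmf p \<Otimes>\<^sub>M (\<Pi>\<^sub>M i\<in>(UNIV::nat set). D)) =
      sets (count_space UNIV \<Otimes>\<^sub>M (\<Pi>\<^sub>M i\<in>(UNIV::nat set). borel))"
    by (intro sets_pair_measure_cong sets_PiM_cong) (auto simp: D)
  have "(\<lambda>c. (if fst c = N then 1 else 0) * (\<Prod>i<N. f i (snd c i))) \<in> borel_measurable (count_space UNIV \<Otimes>\<^sub>M (\<Pi>\<^sub>M i\<in>(UNIV::nat set). borel))"
    by measurable
  then have m: "(\<lambda>c. (if fst c = N then 1 else 0) * (\<Prod>i<N. f i (snd c i))) \<in> borel_measurable (measure_pmf p \<Otimes>\<^sub>M (\<Pi>\<^sub>M i\<in>(UNIV::nat set). D))"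
    using measurable_cong_sets[OF s refl] by blast
  have fD: "f i \<in> borel_measurable D" for i using f measurable_cong_sets[OF D(2) refl] by blast
  have mD: "(\<lambda>x. \<Prod>i<N. f i (x i)) \<in> borel_measurable (\<Pi>\<^sub>M i\<in>(UNIV::nat set). D)"
    using fD by measurable
  have "(\<integral>\<^sup>+c. (if fst c = N then 1 else 0) * (\<Prod>i<N. f i (snd c i)) \<partial>(measure_pmf p \<Otimes>\<^sub>M (\<Pi>\<^sub>M i\<in>UNIV. D))) =
      (\<integral>\<^sup>+n. \<integral>\<^sup>+x. (if n = N then 1 else 0) * (\<Prod>i<N. f i (x i)) \<partial>(\<Pi>\<^sub>M i\<in>UNIV. D) \<partial>measure_pmf p)"
    by (subst P.nn_integral_fst[OF m, symmetric]) simp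
  also have "\<dots> = (\<integral>\<^sup>+n. (\<Prod>i<N. \<integral>\<^sup>+x. f i x \<partial>D) * indicator {N} n \<partial>measure_pmf p)"
    using mD by (intro nn_integral_cong) (auto simp: nn_integral_cmult PiM_nn_integral_prod[OF D(1) fD] indicator_def)
  also have "\<dots> = ennreal (pmf p N) * (\<Prod>i<N. \<integral>\<^sup>+x. f i x \<partial>D)"
    by (subst nn_integral_cmult_indicator) (simp_all add: emeasure_pmf_single mult.commute)
  finally show ?thesis .
qed

text \<open>The powers of the total mass in the Poisson probability cancel those in the normalisation of the intensity.\<close>

lemma nn_integral_poisson_process_fixed_number:
  fixes f :: "nat \<Rightarrow> real \<Rightarrow> ennreal"
  assumes L: "finite_measure L" "sets L = sets borel" and f[measurable]: "\<And>i. f i \<in> borel_measurable borel"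
  shows "(\<integral>\<^sup>+c. (if fst c = N then 1 else 0) * (\<Prod>i<N. f i (snd c i)) \<partial>poisson_process L) =
    ennreal (exp (- measure L UNIV) / fact N) * (\<Prod>i<N. \<integral>\<^sup>+x. f i x \<partial>L)"
proof -
  interpret L: finite_measure L by fact
  define m where "m = measure L UNIV"
  have sp[simp]: "space L = UNIV" using sets_eq_imp_space_eq[OF L(2)] by simp
  have fL: "f i \<in> borel_measurable L" for i using f measurable_cong_sets[OF L(2) refl] by blast
  show ?thesis
  proof (cases "m = 0")
    case True
    then have "emeasure L UNIV = 0" by (simp add: m_def L.emeasure_eq_measure)
    then have "AE x in L. False" by (subst AE_iff_null) (auto simp: null_sets_def L(2))
    then have z: "(\<integral>\<^sup>+x. f i x \<partial>L) = 0" for i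
      using fL by (subst nn_integral_0_iff_AE) auto
    have "(\<integral>\<^sup>+c. (if fst c = N then 1 else 0) * (\<Prod>i<N. f i (snd c i)) \<partial>poisson_process L) =
        ennreal (pmf (return_pmf 0) N) * (\<Prod>i<N. \<integral>\<^sup>+x. f i x \<partial>return borel 0)"
      using True unfolding poisson_process_def Let_def sp m_def[symmetric]
      by (simp only: if_True refl) (rule nn_integral_iid_fixed_number[OF _ _ f], auto intro: prob_space_return)
    then show ?thesis
      using True by (cases N) (auto simp: z m_def[symmetric] indicator_def)
  next
    case False
    then have m: "m > 0" by (simp add: m_def order_less_le)
    let ?D = "uniform_measure L UNIV"
    have em: "emeasure L UNIV = ennreal m" by (simp add: m_def L.emeasure_eq_measure)
    have D: "prob_space ?D"
      using m by (intro prob_space_uniform_measure) (auto simp: em)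
    have A: "(\<integral>\<^sup>+x. f i x \<partial>?D) = ennreal (1 / m) * (\<integral>\<^sup>+x. f i x \<partial>L)" for i
    proof -
      have "(\<integral>\<^sup>+x. f i x \<partial>?D) = (\<integral>\<^sup>+x. f i x \<partial>L) / ennreal m"
        using fL by (subst nn_integral_uniform_measure) (auto simp: em L(2))
      also have "\<dots> = (\<integral>\<^sup>+x. f i x \<partial>L) * inverse (ennreal m)" by (simp add: divide_ennreal_def)
      finally show ?thesis using m by (simp add: inverse_ennreal inverse_eq_divide mult.commute)
    qed
    have "(\<integral>\<^sup>+c. (if fst c = N then 1 else 0) * (\<Prod>i<N. f i (snd c i)) \<partial>poisson_process L) =
        ennreal (pmf (poisson_pmf m) N) * (\<Prod>i<N. \<integral>\<^sup>+x. f i x \<partial>?D)"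
      using False unfolding poisson_process_def Let_def sp m_def[symmetric]
      by (simp only: if_False) (rule nn_integral_iid_fixed_number[OF D _ f], simp add: L(2))
    also have "\<dots> = (ennreal (m ^ N / fact N * exp (- m)) * ennreal ((1 / m) ^ N)) * (\<Prod>i<N. \<integral>\<^sup>+x. f i x \<partial>L)"
      using m by (simp add: A prod.distrib prod_constant ennreal_power pmf_poisson mult.assoc)
    also have "ennreal (m ^ N / fact N * exp (- m)) * ennreal ((1 / m) ^ N) = ennreal (exp (- m) / fact N)"
      using m by (simp add: ennreal_mult[symmetric] power_divide)
    finally show ?thesis by (simp add: m_def)
  qed
qed

section \<open>The law of balls in the infinite tree\<close>

text \<open>Translates the densities of the infinite tree into \<open>exp_age\<close> and \<open>age_param\<close>.\<close>

lemma hyperbolic_age_param: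
  "(sech (a/2))\<^sup>2 = 2 * (exp (- a) / 2) * (1 / (1 - age_param a)^2)"
  "tanh (a/2) = age_param a / (1 - age_param a)"
proof -
  define e where "e = exp (- (a/2))"
  have e: "e > 0" "exp (a/2) = 1 / e" "exp (- a) = e * e"
    by (simp_all add: e_def exp_minus field_simps flip: exp_add)
  have pos: "1 + e * e > 0" using e by (simp add: add_pos_pos)
  have c: "cosh (a/2) = (1 / e + e) / 2" by (simp add: cosh_def e e_def[symmetric] scaleR_conv_of_real)
  have s: "sinh (a/2) = (1 / e - e) / 2" by (simp add: sinh_def e e_def[symmetric] scaleR_conv_of_real)
  have y: "1 - age_param a = (1 + e * e) / 2" "age_param a = (1 - e * e) / 2" by (simp_all add: age_param_def e field_simps)
  have c': "cosh (a/2) = (1 + e * e) / (2 * e)" unfolding c using e by (simp add: field_simps)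
  have s': "sinh (a/2) = (1 - e * e) / (2 * e)" unfolding s using e by (simp add: field_simps)
  show "(sech (a/2))\<^sup>2 = 2 * (exp (- a) / 2) * (1 / (1 - age_param a)^2)"
    unfolding sech_def c' y(1) e(3) using e pos by (simp add: power2_eq_square)
  have "p / (2 * e) / (q / (2 * e)) = p / 2 / (q / 2)" for p q :: real using e by simp
  then show "tanh (a/2) = age_param a / (1 - age_param a)"
    unfolding tanh_def c' s' y(1) unfolding y(2) .
qed

lemma nn_integral_exp_age_density:
  assumes [measurable]: "g \<in> borel_measurable borel" "h \<in> borel_measurable borel" "F \<in> borel_measurable borel"
    and gh: "\<And>a. 0 \<le> a \<Longrightarrow> g a = h a * (exp (- a) / 2)" "\<And>a. 0 \<le> a \<Longrightarrow> 0 \<le> h a"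
  shows "(\<integral>\<^sup>+a. F a \<partial>density lborel (\<lambda>a. ennreal (indicator {0..} a * g a))) = (\<integral>\<^sup>+a. ennreal (h a) * F a \<partial>exp_age)"
proof -
  have eq: "ennreal (indicator {0..} a * g a) = ennreal (indicator {0..} a * (exp (- a) / 2)) * ennreal (h a)" for a
  proof (cases "0 \<le> a")
    case True
    then show ?thesis by (subst ennreal_mult[symmetric]) (auto simp: gh mult.commute)
  qed simp
  have "(\<integral>\<^sup>+a. F a \<partial>density lborel (\<lambda>a. ennreal (indicator {0..} a * g a))) =
      (\<integral>\<^sup>+a. ennreal (indicator {0..} a * g a) * F a \<partial>lborel)"
    by (rule nn_integral_density) measurable
  also have "\<dots> = (\<integral>\<^sup>+a. ennreal (h a) * F a \<partial>exp_age)"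
    unfolding exp_age_def eq mult.assoc by (rule nn_integral_density[symmetric]) measurable
  finally show ?thesis .
qed

lemma nn_integral_tempered:
  assumes "tempered f" "\<And>a. 0 \<le> a \<Longrightarrow> 0 \<le> f a"
  shows "(\<integral>\<^sup>+a. ennreal (f a) \<partial>exp_age) = ennreal (\<integral>a. f a \<partial>exp_age)"
proof (rule nn_integral_eq_integral[OF integrable_tempered[OF assms(1)]])
  show "AE a in exp_age. 0 \<le> f a" using AE_exp_age_nonneg by eventually_elim (rule assms(2))
qed

lemma measurable_age_param [measurable]: "age_param \<in> borel_measurable borel"
  by (rule tempered_measurable[OF tempered_age_param])

lemma nn_integral_offspring_intensity:
  assumes b: "0 \<le> b" and F[measurable]: "F \<in> borel_measurable borel"
  shows "(\<integral>\<^sup>+a. F a \<partial>offspring_intensity b) = (\<integral>\<^sup>+a. ennreal (min b a * (1 / (1 - age_param a)^2)) * F a \<partial>exp_age)"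
  unfolding offspring_intensity_def
  by (rule nn_integral_exp_age_density) (use b in \<open>auto simp: hyperbolic_age_param(1)\<close>)

lemma edge_op_total_intensity:
  assumes b: "0 \<le> b"
  shows "edge_op (\<lambda>a. 1 / (1 - age_param a)^2) b = - 2 * ln (1 - age_param b)"
proof (rule edge_op_eqI[OF _ _ _ _ tempered_age_param_power _ b])
  have y: "1 - age_param x > 0" for x using age_param_bounds(2)[of x] by simp
  show "- 2 * ln (1 - age_param 0) = 0" by (simp add: age_param_def)
  show "((\<lambda>b. - 2 * ln (1 - age_param b)) has_real_derivative exp (- b) / (1 - age_param b)) (at b)" for b
  proof -
    have "((\<lambda>b. - 2 * ln (1 - age_param b)) has_real_derivative - 2 * (1 / (1 - age_param b) * (0 - exp (- b) / 2))) (at b)"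
      by (intro DERIV_cmult DERIV_chain2[OF DERIV_ln_divide] DERIV_diff DERIV_const DERIV_age_param y)
    moreover have "- 2 * (1 / d * (0 - e / 2)) = e / d" for e d :: real by simp
    ultimately show ?thesis by (simp only:)
  qed
  show "((\<lambda>b. exp (- b) / (1 - age_param b)) has_real_derivative - (exp (- b) / 2 * (1 / (1 - age_param b)^2))) (at b)" for b
  proof -
    have "((\<lambda>b. exp (- b) / (1 - age_param b)) has_real_derivative
        (- exp (- b) * (1 - age_param b) - exp (- b) * (- (exp (- b) / 2))) / ((1 - age_param b) * (1 - age_param b))) (at b)"
      using y[of b] by (intro DERIV_divide) (auto intro!: derivative_eq_intros DERIV_age_param)
    moreover have "- exp (- b) * (1 - age_param b) - exp (- b) * (- (exp (- b) / 2)) = - (exp (- b) / 2)"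
      by (simp add: age_param_def field_simps)
    ultimately show ?thesis by (simp add: power2_eq_square)
  qed
  have "2 * (e / 2 * (1 / d ^ 1)) = e / d" for e d :: real by simp
  with tendsto_mult_right_zero[OF tempered_tendsto_0[OF tempered_age_param_power[of 1]], of 2]
  show "((\<lambda>b. exp (- b) / (1 - age_param b)) \<longlongrightarrow> 0) at_top" by (simp only:)
  show "isCont (\<lambda>a. 1 / (1 - age_param a)^2) x" for x
    using y[of x] by (intro continuous_intros DERIV_isCont[OF DERIV_age_param]) auto
qed

text \<open>The probability that a vertex of age \<open>b\<close> has no non-spinal children.\<close>

lemma exp_offspring_intensity:
  assumes b: "0 \<le> b" shows "exp (- measure (offspring_intensity b) UNIV) = (1 - age_param b)^2"
proof -
  have y: "1 - age_param b > 0" using age_param_bounds(2)[of b] by simp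
  have "emeasure (offspring_intensity b) UNIV = (\<integral>\<^sup>+a. 1 \<partial>offspring_intensity b)" by simp
  also have "\<dots> = (\<integral>\<^sup>+a. ennreal (min b a * (1 / (1 - age_param a)^2)) \<partial>exp_age)"
    using nn_integral_offspring_intensity[OF b, of "\<lambda>_. 1"] by simp
  also have "\<dots> = ennreal (edge_op (\<lambda>a. 1 / (1 - age_param a)^2) b)"
    unfolding edge_op_def using b by (intro nn_integral_tempered tempered_mult tempered_min tempered_age_param_power) simp
  finally have "measure (offspring_intensity b) UNIV = edge_op (\<lambda>a. 1 / (1 - age_param a)^2) b"
    using b by (simp add: measure_def edge_op_nonneg)
  then have "- measure (offspring_intensity b) UNIV = ln (1 - age_param b) + ln (1 - age_param b)"
    by (simp add: edge_op_total_intensity[OF b])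
  then have "exp (- measure (offspring_intensity b) UNIV) = exp (ln (1 - age_param b)) * exp (ln (1 - age_param b))"
    by (simp only: exp_add)
  then show ?thesis using y by (simp add: power2_eq_square)
qed

lemma ball_total_nonneg:
  assumes "0 \<le> b" shows "0 \<le> ball_total r t b"
proof -
  have s: "(\<lambda>k. ball_weight r t k b) sums ball_total r t b"
    using size_asymp_ball_weight[OF assms, of r t] by (simp add: size_asymp_def)
  have "0 \<le> (\<Sum>k. ball_weight r t k b)"
    by (rule suminf_nonneg[OF sums_summable[OF s] ball_weight_nonneg[OF assms]])
  then show ?thesis unfolding sums_unique[OF s, symmetric] .
qed

lemma ball_spine_nonneg:
  assumes "0 \<le> b" shows "0 \<le> ball_spine r t b"
proof (rule LIMSEQ_le_const)
  show "(\<lambda>k. ball_weight r t k b / size_prob k) \<longlonglongrightarrow> ball_spine r t b"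
    using size_asymp_ball_weight[OF assms, of r t] by (simp add: size_asymp_def)
  show "\<exists>N. \<forall>n\<ge>N. 0 \<le> ball_weight r t n b / size_prob n"
    by (intro exI allI impI divide_nonneg_nonneg ball_weight_nonneg[OF assms] pmf_nonneg)
qed

lemma age_op_const: "age_op (\<lambda>_. c) a = c"
proof -
  have "prob_space (poisson_process (offspring_intensity a))"
    using measurable_space[OF measurable_poisson_process_offspring, of a] by (simp add: space_prob_algebra)
  then show ?thesis by (simp add: age_op_def prob_space.emeasure_space_1)
qed

lemma measurable_offspring_section:
  assumes f: "f \<in> borel_measurable vertex_space"
  shows "(\<lambda>c. f (a, c)) \<in> borel_measurable (poisson_process (offspring_intensity a))"
proof -
  have "Pair a \<in> (count_space UNIV \<Otimes>\<^sub>M (\<Pi>\<^sub>M i\<in>UNIV. borel)) \<rightarrow>\<^sub>M vertex_space"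
    unfolding vertex_space_def by measurable
  from measurable_compose[OF this f] show ?thesis
    by (simp add: measurable_cong_sets[OF sets_poisson_process_offspring refl])
qed

text \<open>The balls of the children form a Poisson multiset, so their law is given by \<open>multiset_weight\<close>; the probability of
  having no children is the factor which normalises the weights.\<close>

lemma age_op_nonspinal_kernel:
  "0 \<le> b \<Longrightarrow> age_op (nonspinal_kernel r t) b = ennreal ((1 - age_param b)^2 * ball_total r t b)"
proof (induction r arbitrary: t b)
  case 0
  have "1 - age_param b > 0" using age_param_bounds(2)[of b] by simp
  then show ?case by (auto simp: age_op_const)
next
  case (Suc r)
  note b = Suc.prems
  obtain M where t: "t = Node M" by (cases t)
  let ?U = "\<lambda>c. age_op (nonspinal_kernel r c)"
  let ?L = "offspring_intensity b"
  let ?V = "\<lambda>c. edge_op (ball_total r c) b"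
  let ?P = "permutations_of_multiset M"
  have U: "(\<integral>\<^sup>+a. ?U c a \<partial>?L) = ennreal (?V c)" for c
  proof -
    have "(\<integral>\<^sup>+a. ?U c a \<partial>?L) = (\<integral>\<^sup>+a. ennreal (min b a * (1 / (1 - age_param a)^2)) * ?U c a \<partial>exp_age)"
      by (rule nn_integral_offspring_intensity[OF b]) measurable
    also have "\<dots> = (\<integral>\<^sup>+a. ennreal (min b a * ball_total r c a) \<partial>exp_age)"
    proof (rule nn_integral_cong_AE)
      show "AE a in exp_age. ennreal (min b a * (1 / (1 - age_param a)^2)) * ?U c a = ennreal (min b a * ball_total r c a)"
        using AE_exp_age_nonneg
      proof eventually_elim
        case (elim a)
        have "1 - age_param a > 0" using age_param_bounds(2)[of a] by simp
        then show ?case unfolding Suc.IH[OF elim] using b elim ball_total_nonneg[OF elim]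
          by (subst ennreal_mult[symmetric]) auto
      qed
    qed
    also have "\<dots> = ennreal (?V c)"
      unfolding edge_op_def using b
      by (intro nn_integral_tempered tempered_mult tempered_min tempered_ball_total mult_nonneg_nonneg ball_total_nonneg) auto
    finally show ?thesis .
  qed
  have Vn: "0 \<le> ?V c" for c using b by (intro edge_op_nonneg ball_total_nonneg)
  have "age_op (nonspinal_kernel (Suc r) t) b = (\<integral>\<^sup>+c. (\<Sum>ts\<in>?P. (if fst c = length ts then 1 else 0) *
      (\<Prod>i<length ts. ?U (ts ! i) (snd c i))) \<partial>poisson_process ?L)"
  proof -
    have "nonspinal_kernel (Suc r) t (b, c) = (\<Sum>ts\<in>?P. (if fst c = length ts then 1 else 0) *
        (\<Prod>i<length ts. ?U (ts ! i) (snd c i)))" for c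
      by (simp add: t child_op_nonspinal)
    then show ?thesis by (simp only: age_op_def[of "nonspinal_kernel (Suc r) t"])
  qed
  also have "\<dots> = (\<Sum>ts\<in>?P. \<integral>\<^sup>+c. (if fst c = length ts then 1 else 0) * (\<Prod>i<length ts. ?U (ts ! i) (snd c i)) \<partial>poisson_process ?L)"
  proof (rule nn_integral_sum)
    fix ts :: "rtree list"
    have "(\<lambda>c. (if fst c = length ts then 1 else 0) * (\<Prod>i<length ts. ?U (ts ! i) (snd c i))) \<in>
        borel_measurable (count_space UNIV \<Otimes>\<^sub>M (\<Pi>\<^sub>M i\<in>(UNIV::nat set). (borel :: real measure)))" by measurable
    then show "(\<lambda>c. (if fst c = length ts then 1 else 0) * (\<Prod>i<length ts. ?U (ts ! i) (snd c i))) \<in>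
        borel_measurable (poisson_process ?L)"
      by (simp only: measurable_cong_sets[OF sets_poisson_process_offspring refl])
  qed
  also have "\<dots> = (\<Sum>ts\<in>?P. ennreal (exp (- measure ?L UNIV) / fact (length ts)) * (\<Prod>i<length ts. \<integral>\<^sup>+a. ?U (ts ! i) a \<partial>?L))"
    by (intro sum.cong refl nn_integral_poisson_process_fixed_number finite_offspring_intensity sets_offspring_intensity) measurable
  also have "\<dots> = (\<Sum>ts\<in>?P. ennreal ((1 - age_param b)^2 / fact (size M) * (\<Prod>i<length ts. ?V (ts ! i))))"
  proof (rule sum.cong[OF refl])
    fix ts assume "ts \<in> ?P"
    then have "length ts = size M" by (rule length_finite_permutations_of_multiset)
    then show "ennreal (exp (- measure ?L UNIV) / fact (length ts)) * (\<Prod>i<length ts. \<integral>\<^sup>+a. ?U (ts ! i) a \<partial>?L) =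
        ennreal ((1 - age_param b)^2 / fact (size M) * (\<Prod>i<length ts. ?V (ts ! i)))"
      unfolding U exp_offspring_intensity[OF b] using Vn
      by (subst ennreal_mult) (auto intro!: prod_nonneg simp: prod_ennreal)
  qed
  also have "\<dots> = ennreal (\<Sum>ts\<in>?P. (1 - age_param b)^2 / fact (size M) * (\<Prod>i<length ts. ?V (ts ! i)))"
    using Vn by (intro sum_ennreal mult_nonneg_nonneg divide_nonneg_nonneg prod_nonneg) simp_all
  also have "(\<Sum>ts\<in>?P. (1 - age_param b)^2 / fact (size M) * (\<Prod>i<length ts. ?V (ts ! i))) =
      (1 - age_param b)^2 * ball_total (Suc r) t b"
    by (simp only: sum_distrib_left[symmetric] sum_permutations_multiset_weight[where v="?V"] ball_total.simps(2) t rtree.sel) simp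
  finally show ?case .
qed

text \<open>This is \<open>2 tanh (b / 2) / (1 - age_param b)\<^sup>2\<close>, which combines the harmonic function \<open>2 tanh (b / 2)\<close> of the spine with
  the normalisation of the weights.\<close>

abbreviation spine_factor :: "real \<Rightarrow> real" where
  "spine_factor b \<equiv> 2 * age_param b / (1 - age_param b)^3"

lemma spine_factor_nonneg: "0 \<le> b \<Longrightarrow> 0 \<le> spine_factor b"
  using age_param_bounds[of b] by auto

text \<open>The age of the spinal child is biased by \<open>tanh (a / 2)\<close>, and \<open>2 tanh (b / 2)\<close> is the matching normalisation at the
  parent. Hence one step along the spine multiplies \<open>spine_factor\<close> exactly as \<open>edge_op\<close> requires. At
  \<open>b = 0\<close> the age of the child is degenerate, but both sides vanish.\<close>

lemma ball_spine_eq: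
  "0 \<le> b \<Longrightarrow> ennreal (ball_spine r t b) = ennreal (spine_factor b) * age_op (spinal_kernel r t) b"
proof (induction r arbitrary: t b)
  case 0
  then show ?case by (simp add: age_op_const)
next
  case (Suc r)
  note b = Suc.prems
  obtain M where t: "t = Node M" by (cases t)
  let ?T = "\<lambda>c. age_op (spinal_kernel r c)"
  let ?R = "\<lambda>c. Node (M - {#c#})"
  let ?I = "\<lambda>c. \<integral>\<^sup>+a. ?T c a \<partial>spinal_age_law b"
  have y: "0 \<le> age_param b" "1 - age_param b > 0" using age_param_bounds[of b] b by auto
  have I: "ennreal (2 * tanh (b/2)) * ?I c = ennreal (edge_op (ball_spine r c) b)" for c
  proof (cases "b = 0")
    case False
    then have tpos: "0 < tanh (b/2)" using b by simp
    let ?h = "\<lambda>a. min b a * spine_factor a / (2 * tanh (b/2))"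
    have "?I c = (\<integral>\<^sup>+a. ennreal (?h a) * ?T c a \<partial>exp_age)"
    proof -
      have "(\<integral>\<^sup>+a. ?T c a \<partial>density lborel (\<lambda>a. ennreal (indicator {0..} a *
         (min b a * (sech (a/2))\<^sup>2 * tanh (a/2) / (2 * tanh (b/2)))))) = (\<integral>\<^sup>+a. ennreal (?h a) * ?T c a \<partial>exp_age)"
      proof (rule nn_integral_exp_age_density)
        show "min b a * (sech (a/2))\<^sup>2 * tanh (a/2) / (2 * tanh (b/2)) = ?h a * (exp (- a) / 2)" for a
          unfolding hyperbolic_age_param[of a] by (simp add: power2_eq_square power3_eq_cube mult_ac)
        show "0 \<le> ?h a" if "0 \<le> a" for a 
          using that b tpos by (intro divide_nonneg_nonneg mult_nonneg_nonneg[OF _ spine_factor_nonneg]) simp_all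
      qed measurable
      then show ?thesis using False b by (simp add: spinal_age_law_def)
    qed
    then have "ennreal (2 * tanh (b/2)) * ?I c = (\<integral>\<^sup>+a. ennreal (2 * tanh (b/2)) * (ennreal (?h a) * ?T c a) \<partial>exp_age)"
      by (simp add: nn_integral_cmult)
    also have "\<dots> = (\<integral>\<^sup>+a. ennreal (min b a * ball_spine r c a) \<partial>exp_age)"
    proof (rule nn_integral_cong_AE)
      show "AE a in exp_age. ennreal (2 * tanh (b/2)) * (ennreal (?h a) * ?T c a) = ennreal (min b a * ball_spine r c a)"
        using AE_exp_age_nonneg
      proof eventually_elim
        case (elim a)
        have "ennreal (2 * tanh (b/2)) * ennreal (?h a) = ennreal (min b a) * ennreal (spine_factor a)"
          using tpos spine_factor_nonneg[OF elim] b elim by (simp add: ennreal_mult'[symmetric] mult_ac)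
        then have "ennreal (2 * tanh (b/2)) * (ennreal (?h a) * ?T c a) = ennreal (min b a) * (ennreal (spine_factor a) * ?T c a)"
          by (metis mult.assoc)
        also have "\<dots> = ennreal (min b a * ball_spine r c a)"
          using Suc.IH[OF elim, of c] b elim by (simp add: ennreal_mult' ball_spine_nonneg)
        finally show ?case .
      qed
    qed
    also have "\<dots> = ennreal (edge_op (ball_spine r c) b)"
      unfolding edge_op_def using b
      by (intro nn_integral_tempered tempered_mult tempered_min tempered_ball_spine mult_nonneg_nonneg ball_spine_nonneg) auto
    finally show ?thesis .
  qed (simp add: edge_op_0)
  have "age_op (spinal_kernel (Suc r) t) b =
      (\<integral>\<^sup>+c. (\<Sum>d\<in>set_mset M. ?I d * nonspinal_kernel (Suc r) (?R d) (b, c)) \<partial>poisson_process (offspring_intensity b))"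
  proof -
    have "spinal_kernel (Suc r) t (b, c) = (\<Sum>d\<in>set_mset M. ?I d * nonspinal_kernel (Suc r) (?R d) (b, c))" for c
      by (simp add: t child_op_spinal del: nonspinal_kernel.simps)
    then show ?thesis by (simp only: age_op_def[of "spinal_kernel (Suc r) t"])
  qed
  also have "\<dots> = (\<Sum>d\<in>set_mset M. ?I d * age_op (nonspinal_kernel (Suc r) (?R d)) b)"
  proof -
    have m: "(\<lambda>c. nonspinal_kernel (Suc r) (?R d) (b, c)) \<in> borel_measurable (poisson_process (offspring_intensity b))" for d
      by (rule measurable_offspring_section[OF measurable_nonspinal_kernel])
    have "(\<integral>\<^sup>+c. (\<Sum>d\<in>set_mset M. ?I d * nonspinal_kernel (Suc r) (?R d) (b, c)) \<partial>poisson_process (offspring_intensity b)) =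
        (\<Sum>d\<in>set_mset M. \<integral>\<^sup>+c. ?I d * nonspinal_kernel (Suc r) (?R d) (b, c) \<partial>poisson_process (offspring_intensity b))"
      by (rule nn_integral_sum) (rule borel_measurable_times_ennreal[OF borel_measurable_const m])
    then show ?thesis unfolding nn_integral_cmult[OF m] age_op_def[of "nonspinal_kernel (Suc r) _"] .
  qed
  finally have "ennreal (spine_factor b) * age_op (spinal_kernel (Suc r) t) b =
      (\<Sum>d\<in>set_mset M. ennreal (spine_factor b) * (?I d * ennreal ((1 - age_param b)^2 * ball_total (Suc r) (?R d) b)))"
    by (simp only: age_op_nonspinal_kernel[OF b] sum_distrib_left)
  also have "\<dots> = (\<Sum>d\<in>set_mset M. ennreal (edge_op (ball_spine r d) b * ball_total (Suc r) (?R d) b))"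
  proof (rule sum.cong[OF refl])
    fix d
    have "spine_factor b * (1 - age_param b)^2 = 2 * tanh (b/2)"
      unfolding hyperbolic_age_param using y by (simp add: power2_eq_square power3_eq_cube)
    then have sp: "ennreal (spine_factor b) * ennreal ((1 - age_param b)^2) = ennreal (2 * tanh (b/2))"
      by (subst ennreal_mult[symmetric, OF spine_factor_nonneg[OF b] zero_le_power2]) (rule arg_cong)
    have assoc: "x * (i * (q * u)) = ((x * q) * i) * u" for x i q u :: ennreal by (simp only: mult_ac)
    have "ennreal (spine_factor b) * (?I d * ennreal ((1 - age_param b)^2 * ball_total (Suc r) (?R d) b)) =
        (ennreal (2 * tanh (b/2)) * ?I d) * ennreal (ball_total (Suc r) (?R d) b)"
      unfolding ennreal_mult[OF zero_le_power2 ball_total_nonneg[OF b]] assoc sp ..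
    also have "\<dots> = ennreal (edge_op (ball_spine r d) b * ball_total (Suc r) (?R d) b)"
      unfolding I using b by (simp add: ennreal_mult edge_op_nonneg ball_spine_nonneg ball_total_nonneg)
    finally show "ennreal (spine_factor b) * (?I d * ennreal ((1 - age_param b)^2 * ball_total (Suc r) (?R d) b)) =
        ennreal (edge_op (ball_spine r d) b * ball_total (Suc r) (?R d) b)" .
  qed
  also have "\<dots> = ennreal (\<Sum>d\<in>set_mset M. edge_op (ball_spine r d) b * ball_total (Suc r) (?R d) b)"
    using b by (intro sum_ennreal mult_nonneg_nonneg edge_op_nonneg ball_spine_nonneg ball_total_nonneg)
  also have "(\<Sum>d\<in>set_mset M. edge_op (ball_spine r d) b * ball_total (Suc r) (?R d) b) = ball_spine (Suc r) t b"
    by (simp add: ball_spine.simps(2) ball_total.simps(2) t multiset_weight_deriv_def)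
  finally show ?case by simp
qed

lemma hat_H_ball_prob:
  "emeasure (distr configuration_law (count_space UNIV) (\<lambda>\<omega>. aged_ball r (hat_H_tree \<omega>))) {t} =
     ennreal (\<integral>a. ball_spine r t a \<partial>exp_age)"
proof -
  have "(\<integral>\<^sup>+a. age_op (spinal_kernel r t) a \<partial>root_age_law) = (\<integral>\<^sup>+a. ennreal (spine_factor a) * age_op (spinal_kernel r t) a \<partial>exp_age)"
    unfolding root_age_law_def
  proof (rule nn_integral_exp_age_density)
    show "(sech (a/2))\<^sup>2 * tanh (a/2) = spine_factor a * (exp (- a) / 2)" for a
      unfolding hyperbolic_age_param[of a] by (simp add: power2_eq_square power3_eq_cube mult_ac)
  qed (measurable, rule spine_factor_nonneg)
  also have "\<dots> = (\<integral>\<^sup>+a. ennreal (ball_spine r t a) \<partial>exp_age)"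
  proof (rule nn_integral_cong_AE)
    show "AE a in exp_age. ennreal (spine_factor a) * age_op (spinal_kernel r t) a = ennreal (ball_spine r t a)"
      using AE_exp_age_nonneg by eventually_elim (simp only: ball_spine_eq)
  qed
  also have "\<dots> = ennreal (\<integral>a. ball_spine r t a \<partial>exp_age)"
    by (intro nn_integral_tempered tempered_ball_spine ball_spine_nonneg)
  finally show ?thesis by (simp only: emeasure_hat_H_ball)
qed

section \<open>Convergence in distribution from convergence of point masses\<close>

text \<open>By Scheffe's lemma, convergence of the point masses to those of a probability measure is convergence in total variation.\<close>

lemma pmf_tendsto_imp_converges_in_distribution:
  fixes p :: "nat \<Rightarrow> 'a :: countable pmf" and L :: "'a measure"
  assumes L: "prob_space L" "sets L = UNIV" and lim: "\<And>x. (\<lambda>k. pmf (p k) x) \<longlonglongrightarrow> measure L {x}"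
  shows "converges_in_distribution (\<lambda>k. measure_pmf (p k)) L"
proof -
  interpret L: prob_space L by fact
  have spL: "space L = UNIV" using sets_eq_imp_space_eq[of L "count_space UNIV"] L(2) by simp
  define q where "q = embed_pmf (\<lambda>x. measure L {x})"
  have "(\<integral>\<^sup>+x. ennreal (measure L {x}) \<partial>count_space UNIV) = emeasure L UNIV"
    by (subst L.emeasure_eq_measure[symmetric], subst emeasure_countable_singleton[of _ L, symmetric]) (auto simp: L(2))
  then have total: "(\<integral>\<^sup>+x. ennreal (measure L {x}) \<partial>count_space UNIV) = 1"
    using L.emeasure_space_1 by (simp only: spL)
  have q: "pmf q x = measure L {x}" for x
    unfolding q_def by (rule pmf_embed_pmf[OF measure_nonneg total])
  have Lq: "L = measure_pmf q"
    by (rule measure_eqI_countable[of _ UNIV]) (auto simp: L(2) emeasure_pmf_single q L.emeasure_eq_measure)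
  have lim': "(\<lambda>k. pmf (p k) x) \<longlonglongrightarrow> pmf q x" for x using lim[of x] by (simp only: q)
  have int: "integrable (count_space UNIV) (pmf r)" for r :: "'a pmf" by (rule integrable_pmf)
  have "(\<lambda>k. \<integral>\<^sup>+x. norm (pmf (p k) x - pmf q x) \<partial>count_space UNIV) \<longlonglongrightarrow> 0"
    by (rule Scheffe_lemma2) (use lim' in \<open>auto simp: nn_integral_pmf int\<close>)
  then have d: "(\<lambda>k. \<integral>x. \<bar>pmf (p k) x - pmf q x\<bar> \<partial>count_space UNIV) \<longlonglongrightarrow> 0"
  proof -
    assume *: "(\<lambda>k. \<integral>\<^sup>+x. norm (pmf (p k) x - pmf q x) \<partial>count_space UNIV) \<longlonglongrightarrow> 0"
    have "(\<integral>\<^sup>+x. norm (pmf (p k) x - pmf q x) \<partial>count_space UNIV) = ennreal (\<integral>x. \<bar>pmf (p k) x - pmf q x\<bar> \<partial>count_space UNIV)" for k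
      by (subst nn_integral_eq_integral) (auto intro!: int)
    with * show ?thesis by (simp add: ennreal_tendsto_0_iff)
  qed
  show ?thesis
    unfolding converges_in_distribution_def Lq
  proof (intro allI impI)
    fix f :: "'a \<Rightarrow> real" assume "bounded (range f)"
    then obtain B where B: "\<And>x. \<bar>f x\<bar> \<le> B" by (auto simp: bounded_iff)
    have E: "integral\<^sup>L (measure_pmf r) f = (\<integral>x. pmf r x * f x \<partial>count_space UNIV)" for r :: "'a pmf"
      by (subst measure_pmf_eq_density, subst integral_density) auto
    have fi: "integrable (count_space UNIV) (\<lambda>x. pmf r x * f x)" for r :: "'a pmf"
    proof (rule Bochner_Integration.integrable_bound[OF integrable_mult_left[OF int[of r], where c=B]])
      have "\<bar>f x\<bar> \<le> \<bar>B\<bar>" for x using B[of x] by simp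
      then show "AE x in count_space UNIV. norm (pmf r x * f x) \<le> norm (pmf r x * B)"
        by (intro AE_I2) (simp add: abs_mult mult_left_mono)
    qed simp
    have bd: "norm (integral\<^sup>L (measure_pmf (p k)) f - integral\<^sup>L (measure_pmf q) f) \<le>
        B * (\<integral>x. \<bar>pmf (p k) x - pmf q x\<bar> \<partial>count_space UNIV)" for k
    proof -
      have "integral\<^sup>L (measure_pmf (p k)) f - integral\<^sup>L (measure_pmf q) f =
          (\<integral>x. (pmf (p k) x - pmf q x) * f x \<partial>count_space UNIV)"
        unfolding E by (subst Bochner_Integration.integral_diff[symmetric]) (auto simp: fi left_diff_distrib)
      also have "norm \<dots> \<le> (\<integral>x. \<bar>(pmf (p k) x - pmf q x) * f x\<bar> \<partial>count_space UNIV)"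
        using integral_abs_bound by simp
      also have "\<dots> \<le> (\<integral>x. B * \<bar>pmf (p k) x - pmf q x\<bar> \<partial>count_space UNIV)"
      proof (rule integral_mono)
        show "integrable (count_space UNIV) (\<lambda>x. \<bar>(pmf (p k) x - pmf q x) * f x\<bar>)"
          using fi by (intro integrable_abs) (auto simp: left_diff_distrib)
        show "integrable (count_space UNIV) (\<lambda>x. B * \<bar>pmf (p k) x - pmf q x\<bar>)"
          by (intro integrable_mult_right integrable_abs Bochner_Integration.integrable_diff int)
        show "\<bar>(pmf (p k) x - pmf q x) * f x\<bar> \<le> B * \<bar>pmf (p k) x - pmf q x\<bar>" for x
          using B[of x] by (simp add: abs_mult mult.commute[of B] mult_left_mono)
      qed
      finally show ?thesis by simp
    qed
    have "(\<lambda>k. integral\<^sup>L (measure_pmf (p k)) f - integral\<^sup>L (measure_pmf q) f) \<longlonglongrightarrow> 0"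
      by (rule Lim_null_comparison[OF always_eventually]) (use bd tendsto_mult_right_zero[OF d, of B] in auto)
    then show "(\<lambda>k. integral\<^sup>L (measure_pmf (p k)) f) \<longlonglongrightarrow> integral\<^sup>L (measure_pmf q) f"
      by (rule LIM_zero_cancel)
  qed
qed

theorem theorem36:
  shows "\<forall>r :: nat. converges_in_distribution
    (\<lambda>k. measure_pmf (map_pmf (rtree_ball r)
       (cond_pmf steady_state_cluster {t. num_vertices t = k})))
    (distr configuration_law (count_space UNIV) (\<lambda>\<omega>. aged_ball r (hat_H_tree \<omega>)))"
proof
  fix r
  interpret prob_space configuration_law
    by (rule prob_spaceI) (simp add: emeasure_configuration_law)
  let ?L = "distr configuration_law (count_space UNIV) (\<lambda>\<omega>. aged_ball r (hat_H_tree \<omega>))"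
  show "converges_in_distribution (\<lambda>k. measure_pmf (map_pmf (rtree_ball r)
       (cond_pmf steady_state_cluster {t. num_vertices t = k}))) ?L"
  proof (rule pmf_tendsto_imp_converges_in_distribution)
    show "prob_space ?L" by (rule prob_space_distr) measurable
    fix t
    have "0 \<le> (\<integral>a. ball_spine r t a \<partial>exp_age)"
    proof (rule integral_nonneg_AE)
      show "AE a in exp_age. 0 \<le> ball_spine r t a"
        using AE_exp_age_nonneg by eventually_elim (rule ball_spine_nonneg)
    qed
    then have "measure ?L {t} = (\<integral>a. ball_spine r t a \<partial>exp_age)"
      by (simp add: measure_def hat_H_ball_prob)
    then show "(\<lambda>k. pmf (map_pmf (rtree_ball r) (cond_pmf steady_state_cluster {t. num_vertices t = k})) t) \<longlonglongrightarrow> measure ?L {t}"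
      using conditioned_ball_limit[of r t] by simp
  qed simp
qed

end
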